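(* Let $G$ be an orbifold groupoid. Then $G$ is Morita equivalent (as a topological groupoid) to a translation groupoid associated to a continuous almost free action of a proper bundle of topological groups on a topological space. The bundle can be chosen such that its fibers are finite products of unitary groups.
   Context: Topological groupoids. A topological groupoid $G$ over a Hausdorff space $G_0$ is a groupoid with space of arrows a topological space $G$ and space of objects $G_0$, whose structure maps (source $s$, target $t$, multiplication $\mathrm{mlt}$, inverse $\mathrm{inv}$, unit $\mathrm{uni}$) are continuous, with $s,t,\mathrm{mlt}$ open and $\mathrm{uni}$ an embedding. It is proper if $G$ is Hausdorff and $(s,t):G\to G_0\times G_0$ is a proper continuous map. A Lie groupoid is a topological groupoid with $G$, $G_0$ smooth manifolds ($G_0$ Hausdorff and second countable), all structure maps smooth, and $s,t$ submersions with Hausdorff fibers. It is étale if $s,t$ are local diffeomorphisms. An orbifold groupoid is a proper étale Lie groupoid. Actions. A continuous left action of $G$ on a space $P$ along a continuous map $\pi:P\to G_0$ is a continuous map $G\times_{G_0}^{s,\pi}P\to P$, $(g,p)\mapsto g\cdot p$, with $\pi(g\cdot p)=t(g)$, $1_{\pi(p)}\cdot p=p$, $g'\cdot(g\cdot p)=(g'g)\cdot p$ whenever defined. Right actions are defined similarly: for a right action along $\phi:P\to H_0$ of a groupoid $H$, $p\cdot h$ is defined when $\phi(p)=t(h)$, and $\phi(p\cdot h)=s(h)$. Morita equivalence of topological groupoids. For topological groupoids $G$ and $H$, a principal $H$-bundle over $G$ is a space $P$ with a continuous left action of $G$ along a continuous open surjection $\pi:P\to G_0$ and a continuous right action of $H$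 along a continuous map $\phi:P\to H_0$, such that $\phi$ is $G$-invariant, $\pi$ is $H$-invariant, the actions commute, and the map $P\times_{H_0}^{\phi,t}H\to P\times_{G_0}^{\pi,\pi}P$, $(p,h)\mapsto(p,p\cdot h)$, is a homeomorphism. It is a Morita equivalence if it is also left $G$-principal, i.e. $\phi$ is an open surjection and $G\times_{G_0}^{s,\pi}P\to P\times_{H_0}^{\phi,\phi}P$, $(g,p)\mapsto(g\cdot p,p)$, is a homeomorphism. $G$ and $H$ are Morita equivalent if such a $P$ exists. Bundles of topological groups. A bundle of topological groups over a Hausdorff space $Q$ is a topological space $U$ with an open (continuous) surjection $r:U\to Q$ such that each fiber of $r$ has the structure of a topological group and these structures vary continuously over $Q$; it is regarded as a topological groupoid over $Q$ with $s=t=r$ and with $\mathrm{uni},\mathrm{mlt},\mathrm{inv}$ given by the fibrewise group structures. It is proper if it is proper as a topological groupoid. No local triviality is required. Translation groupoid. Let $r:U\to Q$ be a bundle of topological groups acting continuously from the right on a Hausdorff space $P$ along $\phi:P\to Q$. The translation groupoid $P\rtimes U$ is the topological groupoid over $P$ with space of arrows $P\times_Q U$, $t(p,u)=p$, $s(p,u)=p\cdot u$, $(p,u)(p',u')=(p,uu')$ when $p'=p\cdot u$, units $(p,1_{\phi(p)})$ and inverse $(p,u)^{-1}=(p\cdot u,u^{-1})$. The action is almost free if the isotropy groups of $P\rtimes U$ are finite. *)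

theory Defs
  imports "HOL-Analysis.Analysis" "HOL-Algebra.Product_Groups"
begin

section \<open>Topological groupoids\<close>

text \<open>The product of two arrows \<open>g\<close>, \<open>h\<close> is defined when \<open>src g = tgt h\<close>; the values of the
  operations on other arguments are irrelevant.\<close>

record ('a, 'o) groupoid =
  Arr :: "'a topology"
  Obj :: "'o topology"
  src :: "'a \<Rightarrow> 'o"
  tgt :: "'a \<Rightarrow> 'o"
  mlt :: "'a \<Rightarrow> 'a \<Rightarrow> 'a"
  ginv :: "'a \<Rightarrow> 'a"
  uni :: "'o \<Rightarrow> 'a"

definition fibre_product ::
    "'a topology \<Rightarrow> ('a \<Rightarrow> 'c) \<Rightarrow> 'b topology \<Rightarrow> ('b \<Rightarrow> 'c) \<Rightarrow> ('a \<times> 'b) topology" where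
  "fibre_product X f Y g = subtopology (prod_topology X Y) {(x, y). f x = g y}"

definition groupoid_axioms :: "('a, 'o, 'm) groupoid_scheme \<Rightarrow> bool" where
  "groupoid_axioms G \<longleftrightarrow>
     src G \<in> topspace (Arr G) \<rightarrow> topspace (Obj G) \<and>
     tgt G \<in> topspace (Arr G) \<rightarrow> topspace (Obj G) \<and>
     (\<forall>g \<in> topspace (Arr G). \<forall>h \<in> topspace (Arr G). src G g = tgt G h \<longrightarrow>
        mlt G g h \<in> topspace (Arr G) \<and>
        src G (mlt G g h) = src G h \<and> tgt G (mlt G g h) = tgt G g) \<and>
     (\<forall>g \<in> topspace (Arr G). \<forall>h \<in> topspace (Arr G). \<forall>k \<in> topspace (Arr G).
        src G g = tgt G h \<longrightarrow> src G h = tgt G k \<longrightarrow>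
        mlt G (mlt G g h) k = mlt G g (mlt G h k)) \<and>
     (\<forall>x \<in> topspace (Obj G). uni G x \<in> topspace (Arr G) \<and>
        src G (uni G x) = x \<and> tgt G (uni G x) = x) \<and>
     (\<forall>g \<in> topspace (Arr G).
        mlt G g (uni G (src G g)) = g \<and> mlt G (uni G (tgt G g)) g = g) \<and>
     (\<forall>g \<in> topspace (Arr G). ginv G g \<in> topspace (Arr G) \<and>
        src G (ginv G g) = tgt G g \<and> tgt G (ginv G g) = src G g \<and>
        mlt G g (ginv G g) = uni G (tgt G g) \<and> mlt G (ginv G g) g = uni G (src G g))"

definition topological_groupoid :: "('a, 'o, 'm) groupoid_scheme \<Rightarrow> bool" where
  "topological_groupoid G \<longleftrightarrow>
     groupoid_axioms G \<and>
     Hausdorff_space (Obj G) \<and>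
     continuous_map (Arr G) (Obj G) (src G) \<and> open_map (Arr G) (Obj G) (src G) \<and>
     continuous_map (Arr G) (Obj G) (tgt G) \<and> open_map (Arr G) (Obj G) (tgt G) \<and>
     continuous_map (fibre_product (Arr G) (src G) (Arr G) (tgt G)) (Arr G) (\<lambda>(g, h). mlt G g h) \<and>
     open_map (fibre_product (Arr G) (src G) (Arr G) (tgt G)) (Arr G) (\<lambda>(g, h). mlt G g h) \<and>
     continuous_map (Arr G) (Arr G) (ginv G) \<and>
     continuous_map (Obj G) (Arr G) (uni G) \<and> embedding_map (Obj G) (Arr G) (uni G)"

text \<open>The library's \<^const>\<open>proper_map\<close> means closed with compact fibres.  For a continuous map this
  implies that preimages of compact sets are compact, and it is equivalent to that property when
  the codomain is locally compact Hausdorff, as it is for Lie groupoids.\<close>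

definition proper_groupoid :: "('a, 'o, 'm) groupoid_scheme \<Rightarrow> bool" where
  "proper_groupoid G \<longleftrightarrow>
     topological_groupoid G \<and> Hausdorff_space (Arr G) \<and>
     proper_map (Arr G) (prod_topology (Obj G) (Obj G)) (\<lambda>g. (src G g, tgt G g))"

definition isotropy :: "('a, 'o, 'm) groupoid_scheme \<Rightarrow> 'o \<Rightarrow> 'a set" where
  "isotropy G x = {g \<in> topspace (Arr G). src G g = x \<and> tgt G g = x}"


section \<open>Smooth manifolds\<close>

text \<open>Points of Euclidean \<open>n\<close>-space are the functions \<open>nat \<Rightarrow> real\<close> vanishing from index \<open>n\<close> on.
  \<open>ck_on k n W f\<close>: the function \<open>f\<close> is of class \<open>C\<^sup>k\<close> on \<open>W\<close>, an open subset of Euclidean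
  \<open>n\<close>-space, i.e. its partial derivatives up to order \<open>k\<close> exist and are continuous on \<open>W\<close>.\<close>

primrec ck_on :: "nat \<Rightarrow> nat \<Rightarrow> (nat \<Rightarrow> real) set \<Rightarrow> ((nat \<Rightarrow> real) \<Rightarrow> real) \<Rightarrow> bool" where
  "ck_on 0 n W f \<longleftrightarrow> continuous_map (subtopology (Euclidean_space n) W) euclideanreal f"
| "ck_on (Suc k) n W f \<longleftrightarrow>
     continuous_map (subtopology (Euclidean_space n) W) euclideanreal f \<and>
     (\<forall>i<n. \<exists>f'. (\<forall>x\<in>W. ((\<lambda>s. f (x(i := s))) has_real_derivative f' x) (at (x i))) \<and>
                  ck_on k n W f')"

definition smooth_on ::
    "nat \<Rightarrow> nat \<Rightarrow> (nat \<Rightarrow> real) set \<Rightarrow> ((nat \<Rightarrow> real) \<Rightarrow> nat \<Rightarrow> real) \<Rightarrow> bool" where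
  "smooth_on n m W F \<longleftrightarrow> (\<forall>j<m. \<forall>k. ck_on k n W (\<lambda>x. F x j))"

text \<open>A chart \<open>(n, U, c)\<close> is a homeomorphism \<open>c\<close> from the open set \<open>U\<close> onto an open subset of
  Euclidean \<open>n\<close>-space.  The dimension \<open>n\<close> may differ between components of a manifold.\<close>

type_synonym 'a chart = "nat \<times> 'a set \<times> ('a \<Rightarrow> nat \<Rightarrow> real)"

definition chart_of :: "'a topology \<Rightarrow> 'a chart \<Rightarrow> bool" where
  "chart_of X = (\<lambda>(n, U, c). openin X U \<and> openin (Euclidean_space n) (c ` U) \<and>
     homeomorphic_map (subtopology X U) (subtopology (Euclidean_space n) (c ` U)) c)"

definition smooth_transition :: "'a chart \<Rightarrow> 'a chart \<Rightarrow> bool" where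
  "smooth_transition = (\<lambda>(n, U, c) (m, V, d). smooth_on n m (c ` (U \<inter> V)) (d \<circ> inv_into U c))"

definition smooth_atlas :: "'a topology \<Rightarrow> 'a chart set \<Rightarrow> bool" where
  "smooth_atlas X A \<longleftrightarrow>
     (\<forall>c\<in>A. chart_of X c) \<and>
     (\<Union>(n, U, c)\<in>A. U) = topspace X \<and>
     (\<forall>c\<in>A. \<forall>d\<in>A. smooth_transition c d)"

definition maximal_atlas :: "'a topology \<Rightarrow> 'a chart set \<Rightarrow> 'a chart set" where
  "maximal_atlas X A =
     {c. chart_of X c \<and> (\<forall>d\<in>A. smooth_transition c d \<and> smooth_transition d c)}"

definition smooth_map ::
    "'a topology \<Rightarrow> 'a chart set \<Rightarrow> 'b topology \<Rightarrow> 'b chart set \<Rightarrow> ('a \<Rightarrow> 'b) \<Rightarrow> bool" where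
  "smooth_map X A Y B f \<longleftrightarrow>
     continuous_map X Y f \<and>
     (\<forall>x \<in> topspace X. \<exists>(n, U, c) \<in> A. \<exists>(m, V, d) \<in> B. x \<in> U \<and> f x \<in> V \<and>
        smooth_on n m (c ` {u \<in> U. f u \<in> V}) (d \<circ> f \<circ> inv_into U c))"

text \<open>Partial derivatives: \<open>\<partial>F\<^sub>j/\<partial>x\<^sub>i\<close> at \<open>x\<close>.\<close>

definition jacobian :: "((nat \<Rightarrow> real) \<Rightarrow> nat \<Rightarrow> real) \<Rightarrow> (nat \<Rightarrow> real) \<Rightarrow> nat \<Rightarrow> nat \<Rightarrow> real" where
  "jacobian F x j i = deriv (\<lambda>s. F (x(i := s)) j) (x i)"

definition submersion ::
    "'a topology \<Rightarrow> 'a chart set \<Rightarrow> 'b topology \<Rightarrow> 'b chart set \<Rightarrow> ('a \<Rightarrow> 'b) \<Rightarrow> bool" where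
  "submersion X A Y B f \<longleftrightarrow>
     smooth_map X A Y B f \<and>
     (\<forall>(n, U, c) \<in> A. \<forall>(m, V, d) \<in> B. \<forall>x \<in> U. f x \<in> V \<longrightarrow>
        (\<forall>w. \<exists>v. \<forall>j<m. (\<Sum>i<n. jacobian (d \<circ> f \<circ> inv_into U c) (c x) j i * v i) = w j))"

definition prod_atlas :: "'a chart set \<Rightarrow> 'b chart set \<Rightarrow> ('a \<times> 'b) chart set" where
  "prod_atlas A B =
     {(n + m, U \<times> V, \<lambda>(x, y) i. if i < n then c x i else d y (i - n)) | n U c m V d.
        (n, U, c) \<in> A \<and> (m, V, d) \<in> B}"

text \<open>The atlas of slice charts of an embedded submanifold \<open>S\<close>: the slice of Euclidean \<open>n\<close>-space
  given by the vanishing of all coordinates from index \<open>k\<close> on is literally Euclidean \<open>k\<close>-space.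
  For an open subset \<open>S\<close> these are the charts of the open submanifold.\<close>

definition submanifold_atlas :: "'a topology \<Rightarrow> 'a chart set \<Rightarrow> 'a set \<Rightarrow> 'a chart set" where
  "submanifold_atlas X A S =
     {(k, W \<inter> S, c) | k n W c. (n, W, c) \<in> maximal_atlas X A \<and> k \<le> n \<and>
        c ` (W \<inter> S) = c ` W \<inter> topspace (Euclidean_space k)}"

definition diffeomorphism ::
    "'a topology \<Rightarrow> 'a chart set \<Rightarrow> 'b topology \<Rightarrow> 'b chart set \<Rightarrow> ('a \<Rightarrow> 'b) \<Rightarrow> bool" where
  "diffeomorphism X A Y B f \<longleftrightarrow>
     smooth_map X A Y B f \<and>
     (\<exists>g. smooth_map Y B X A g \<and>
          (\<forall>x \<in> topspace X. g (f x) = x) \<and> (\<forall>y \<in> topspace Y. f (g y) = y))"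

definition local_diffeomorphism ::
    "'a topology \<Rightarrow> 'a chart set \<Rightarrow> 'b topology \<Rightarrow> 'b chart set \<Rightarrow> ('a \<Rightarrow> 'b) \<Rightarrow> bool" where
  "local_diffeomorphism X A Y B f \<longleftrightarrow>
     smooth_map X A Y B f \<and>
     (\<forall>x \<in> topspace X. \<exists>U. openin X U \<and> x \<in> U \<and> openin Y (f ` U) \<and>
        diffeomorphism (subtopology X U) (submanifold_atlas X A U)
                       (subtopology Y (f ` U)) (submanifold_atlas Y B (f ` U)) f)"


section \<open>Lie groupoids and orbifold groupoids\<close>

record ('a, 'o) lie_groupoid = "('a, 'o) groupoid" +
  arr_atlas :: "'a chart set"
  obj_atlas :: "'o chart set"

definition smooth_structure_maps :: "('a, 'o) lie_groupoid \<Rightarrow> bool" where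
  "smooth_structure_maps G \<longleftrightarrow>
     smooth_map (Arr G) (arr_atlas G) (Obj G) (obj_atlas G) (src G) \<and>
     smooth_map (Arr G) (arr_atlas G) (Obj G) (obj_atlas G) (tgt G) \<and>
     smooth_map (fibre_product (Arr G) (src G) (Arr G) (tgt G))
                (submanifold_atlas (prod_topology (Arr G) (Arr G))
                   (prod_atlas (arr_atlas G) (arr_atlas G))
                   (topspace (fibre_product (Arr G) (src G) (Arr G) (tgt G))))
                (Arr G) (arr_atlas G) (\<lambda>(g, h). mlt G g h) \<and>
     smooth_map (Arr G) (arr_atlas G) (Arr G) (arr_atlas G) (ginv G) \<and>
     smooth_map (Obj G) (obj_atlas G) (Arr G) (arr_atlas G) (uni G)"

definition Lie_groupoid :: "('a, 'o) lie_groupoid \<Rightarrow> bool" where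
  "Lie_groupoid G \<longleftrightarrow>
     topological_groupoid G \<and>
     smooth_atlas (Arr G) (arr_atlas G) \<and>
     smooth_atlas (Obj G) (obj_atlas G) \<and>
     Hausdorff_space (Obj G) \<and> second_countable (Obj G) \<and>
     smooth_structure_maps G \<and>
     submersion (Arr G) (arr_atlas G) (Obj G) (obj_atlas G) (src G) \<and>
     submersion (Arr G) (arr_atlas G) (Obj G) (obj_atlas G) (tgt G) \<and>
     (\<forall>x \<in> topspace (Obj G).
        Hausdorff_space (subtopology (Arr G) {g. src G g = x}) \<and>
        Hausdorff_space (subtopology (Arr G) {g. tgt G g = x}))"

definition etale_groupoid :: "('a, 'o) lie_groupoid \<Rightarrow> bool" where
  "etale_groupoid G \<longleftrightarrow>
     Lie_groupoid G \<and>
     local_diffeomorphism (Arr G) (arr_atlas G) (Obj G) (obj_atlas G) (src G) \<and>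
     local_diffeomorphism (Arr G) (arr_atlas G) (Obj G) (obj_atlas G) (tgt G)"

definition orbifold_groupoid :: "('a, 'o) lie_groupoid \<Rightarrow> bool" where
  "orbifold_groupoid G \<longleftrightarrow> etale_groupoid G \<and> proper_groupoid G"


section \<open>Actions and Morita equivalence\<close>

definition left_action ::
    "('a, 'o, 'm) groupoid_scheme \<Rightarrow> 'p topology \<Rightarrow> ('p \<Rightarrow> 'o) \<Rightarrow> ('a \<Rightarrow> 'p \<Rightarrow> 'p) \<Rightarrow> bool" where
  "left_action G P \<pi> act \<longleftrightarrow>
     continuous_map P (Obj G) \<pi> \<and>
     continuous_map (fibre_product (Arr G) (src G) P \<pi>) P (\<lambda>(g, p). act g p) \<and>
     (\<forall>g \<in> topspace (Arr G). \<forall>p \<in> topspace P. src G g = \<pi> p \<longrightarrow> \<pi> (act g p) = tgt G g) \<and>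
     (\<forall>p \<in> topspace P. act (uni G (\<pi> p)) p = p) \<and>
     (\<forall>g' \<in> topspace (Arr G). \<forall>g \<in> topspace (Arr G). \<forall>p \<in> topspace P.
        src G g' = tgt G g \<longrightarrow> src G g = \<pi> p \<longrightarrow> act g' (act g p) = act (mlt G g' g) p)"

definition right_action ::
    "('b, 'q, 'm) groupoid_scheme \<Rightarrow> 'p topology \<Rightarrow> ('p \<Rightarrow> 'q) \<Rightarrow> ('p \<Rightarrow> 'b \<Rightarrow> 'p) \<Rightarrow> bool" where
  "right_action H P \<phi> act \<longleftrightarrow>
     continuous_map P (Obj H) \<phi> \<and>
     continuous_map (fibre_product P \<phi> (Arr H) (tgt H)) P (\<lambda>(p, h). act p h) \<and>
     (\<forall>p \<in> topspace P. \<forall>h \<in> topspace (Arr H). \<phi> p = tgt H h \<longrightarrow> \<phi> (act p h) = src H h) \<and>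
     (\<forall>p \<in> topspace P. act p (uni H (\<phi> p)) = p) \<and>
     (\<forall>p \<in> topspace P. \<forall>h \<in> topspace (Arr H). \<forall>h' \<in> topspace (Arr H).
        \<phi> p = tgt H h \<longrightarrow> src H h = tgt H h' \<longrightarrow> act (act p h) h' = act p (mlt H h h'))"

definition principal_bundle ::
    "('a, 'o, 'm) groupoid_scheme \<Rightarrow> ('b, 'q, 'n) groupoid_scheme \<Rightarrow> 'p topology \<Rightarrow>
     ('p \<Rightarrow> 'o) \<Rightarrow> ('p \<Rightarrow> 'q) \<Rightarrow> ('a \<Rightarrow> 'p \<Rightarrow> 'p) \<Rightarrow> ('p \<Rightarrow> 'b \<Rightarrow> 'p) \<Rightarrow> bool" where
  "principal_bundle G H P \<pi> \<phi> lact ract \<longleftrightarrow>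
     left_action G P \<pi> lact \<and> open_map P (Obj G) \<pi> \<and> \<pi> ` topspace P = topspace (Obj G) \<and>
     right_action H P \<phi> ract \<and>
     (\<forall>g \<in> topspace (Arr G). \<forall>p \<in> topspace P. src G g = \<pi> p \<longrightarrow> \<phi> (lact g p) = \<phi> p) \<and>
     (\<forall>p \<in> topspace P. \<forall>h \<in> topspace (Arr H). \<phi> p = tgt H h \<longrightarrow> \<pi> (ract p h) = \<pi> p) \<and>
     (\<forall>g \<in> topspace (Arr G). \<forall>p \<in> topspace P. \<forall>h \<in> topspace (Arr H).
        src G g = \<pi> p \<longrightarrow> \<phi> p = tgt H h \<longrightarrow> ract (lact g p) h = lact g (ract p h)) \<and>
     homeomorphic_map (fibre_product P \<phi> (Arr H) (tgt H)) (fibre_product P \<pi> P \<pi>)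
       (\<lambda>(p, h). (p, ract p h))"

definition morita_bibundle ::
    "('a, 'o, 'm) groupoid_scheme \<Rightarrow> ('b, 'q, 'n) groupoid_scheme \<Rightarrow> 'p topology \<Rightarrow>
     ('p \<Rightarrow> 'o) \<Rightarrow> ('p \<Rightarrow> 'q) \<Rightarrow> ('a \<Rightarrow> 'p \<Rightarrow> 'p) \<Rightarrow> ('p \<Rightarrow> 'b \<Rightarrow> 'p) \<Rightarrow> bool" where
  "morita_bibundle G H P \<pi> \<phi> lact ract \<longleftrightarrow>
     principal_bundle G H P \<pi> \<phi> lact ract \<and>
     open_map P (Obj H) \<phi> \<and> \<phi> ` topspace P = topspace (Obj H) \<and>
     homeomorphic_map (fibre_product (Arr G) (src G) P \<pi>) (fibre_product P \<phi> P \<phi>)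
       (\<lambda>(g, p). (lact g p, p))"

text \<open>HOL cannot quantify over the type of points of the bibundle, so one type has to be fixed.
  The choice made here (objects of \<open>G\<close> paired with arrows of \<open>H\<close>) is no restriction: by
  \<open>morita_equivalentI\<close> below, a bibundle on any type whatsoever yields one on this type.\<close>

definition morita_equivalent ::
    "('a, 'o, 'm) groupoid_scheme \<Rightarrow> ('b, 'q, 'n) groupoid_scheme \<Rightarrow> bool" where
  "morita_equivalent G H \<longleftrightarrow>
     topological_groupoid G \<and> topological_groupoid H \<and>
     (\<exists>(P :: ('o \<times> 'b) topology) \<pi> \<phi> lact ract. morita_bibundle G H P \<pi> \<phi> lact ract)"

lemma topspace_fibre_product:
  "topspace (fibre_product X f Y g) = {(x, y). x \<in> topspace X \<and> y \<in> topspace Y \<and> f x = g y}"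
  by (auto simp: fibre_product_def)

lemma continuous_map_fibre_product_map_prod:
  assumes "continuous_map X X' a" "continuous_map Y Y' b"
    and "\<And>x y. x \<in> topspace X \<Longrightarrow> y \<in> topspace Y \<Longrightarrow> f x = g y \<Longrightarrow> f' (a x) = g' (b y)"
  shows "continuous_map (fibre_product X f Y g) (fibre_product X' f' Y' g') (map_prod a b)"
proof -
  have "continuous_map (prod_topology X Y) (prod_topology X' Y') (map_prod a b)"
    using continuous_map_compose[OF continuous_map_fst[of X Y] assms(1)]
      continuous_map_compose[OF continuous_map_snd[of X Y] assms(2)]
    by (simp add: map_prod_def case_prod_unfold continuous_map_paired o_def)
  then show ?thesis
    unfolding fibre_product_def
    by (auto simp: continuous_map_in_subtopology continuous_map_from_subtopology assms(3))
qed

lemma homeomorphic_maps_fibre_product: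
  assumes "homeomorphic_maps X X' a a'" "homeomorphic_maps Y Y' b b'"
    and "\<And>x y. x \<in> topspace X \<Longrightarrow> y \<in> topspace Y \<Longrightarrow> f x = g y \<longleftrightarrow> f' (a x) = g' (b y)"
  shows "homeomorphic_maps (fibre_product X f Y g) (fibre_product X' f' Y' g')
           (map_prod a b) (map_prod a' b')"
  unfolding homeomorphic_maps_def
proof (intro conjI)
  have c: "continuous_map X X' a" "continuous_map X' X a'"
    "continuous_map Y Y' b" "continuous_map Y' Y b'"
    and i: "\<And>x. x \<in> topspace X \<Longrightarrow> a' (a x) = x" "\<And>x. x \<in> topspace X' \<Longrightarrow> a (a' x) = x"
    "\<And>x. x \<in> topspace Y \<Longrightarrow> b' (b x) = x" "\<And>x. x \<in> topspace Y' \<Longrightarrow> b (b' x) = x"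
    using assms(1,2) by (auto simp: homeomorphic_maps_def)
  have m: "\<And>x. x \<in> topspace X' \<Longrightarrow> a' x \<in> topspace X" "\<And>x. x \<in> topspace Y' \<Longrightarrow> b' x \<in> topspace Y"
    using c by (auto simp: continuous_map_def)
  show "continuous_map (fibre_product X f Y g) (fibre_product X' f' Y' g') (map_prod a b)"
    by (rule continuous_map_fibre_product_map_prod[OF c(1,3)]) (use assms(3) in auto)
  show "continuous_map (fibre_product X' f' Y' g') (fibre_product X f Y g) (map_prod a' b')"
    by (rule continuous_map_fibre_product_map_prod[OF c(2,4)]) (use assms(3) i m in auto)
  show "\<forall>x\<in>topspace (fibre_product X f Y g). map_prod a' b' (map_prod a b x) = x"
    "\<forall>x\<in>topspace (fibre_product X' f' Y' g'). map_prod a b (map_prod a' b' x) = x"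
    using i by (auto simp: topspace_fibre_product)
qed

lemma homeomorphic_map_conjugate:
  assumes "homeomorphic_maps X X' a a'" "homeomorphic_maps Y Y' b b'" "homeomorphic_map X Y h"
    and "\<And>x. x \<in> topspace X' \<Longrightarrow> k x = b (h (a' x))"
  shows "homeomorphic_map X' Y' k"
proof -
  have "homeomorphic_map X' X a'" "homeomorphic_map Y Y' b"
    using assms(1,2) homeomorphic_maps_map by (metis homeomorphic_maps_sym)+
  then have "homeomorphic_map X' Y' (b \<circ> h \<circ> a')"
    using assms(3) by (metis homeomorphic_map_compose comp_assoc)
  then show ?thesis
    by (rule homeomorphic_map_eq) (use assms(4) in auto)
qed

text \<open>Transport of a Morita bibundle along a homeomorphism, possibly to another type.\<close>

lemma morita_bibundle_transport:
  assumes f: "homeomorphic_maps P P' f g" and B: "morita_bibundle G H P \<pi> \<phi> l r"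
  shows "morita_bibundle G H P' (\<pi> \<circ> g) (\<phi> \<circ> g) (\<lambda>a p. f (l a (g p))) (\<lambda>p b. f (r (g p) b))"
proof -
  have cf: "continuous_map P P' f" and cg: "continuous_map P' P g"
    and gf: "\<And>p. p \<in> topspace P \<Longrightarrow> g (f p) = p" and fg: "\<And>p. p \<in> topspace P' \<Longrightarrow> f (g p) = p"
    using f by (auto simp: homeomorphic_maps_def)
  have gP: "\<And>p. p \<in> topspace P' \<Longrightarrow> g p \<in> topspace P"
    using cg by (auto simp: continuous_map_def)
  have hg: "homeomorphic_map P' P g"
    using f homeomorphic_maps_map homeomorphic_maps_sym by metis
  then have og: "open_map P' P g" and ig: "g ` topspace P' = topspace P"
    by (auto simp: homeomorphic_imp_open_map homeomorphic_imp_surjective_map)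
  have la: "left_action G P \<pi> l" and ra: "right_action H P \<phi> r"
    and op: "open_map P (Obj G) \<pi>" "open_map P (Obj H) \<phi>"
    and im: "\<pi> ` topspace P = topspace (Obj G)" "\<phi> ` topspace P = topspace (Obj H)"
    and \<phi>l: "\<And>a p. a \<in> topspace (Arr G) \<Longrightarrow> p \<in> topspace P \<Longrightarrow> src G a = \<pi> p \<Longrightarrow> \<phi> (l a p) = \<phi> p"
    and \<pi>r: "\<And>p b. p \<in> topspace P \<Longrightarrow> b \<in> topspace (Arr H) \<Longrightarrow> \<phi> p = tgt H b \<Longrightarrow> \<pi> (r p b) = \<pi> p"
    and rl: "\<And>a p b. a \<in> topspace (Arr G) \<Longrightarrow> p \<in> topspace P \<Longrightarrow> b \<in> topspace (Arr H) \<Longrightarrow>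
        src G a = \<pi> p \<Longrightarrow> \<phi> p = tgt H b \<Longrightarrow> r (l a p) b = l a (r p b)"
    and hr: "homeomorphic_map (fibre_product P \<phi> (Arr H) (tgt H)) (fibre_product P \<pi> P \<pi>)
       (\<lambda>(p, h). (p, r p h))"
    and hl: "homeomorphic_map (fibre_product (Arr G) (src G) P \<pi>) (fibre_product P \<phi> P \<phi>)
       (\<lambda>(g, p). (l g p, p))"
    using B unfolding morita_bibundle_def principal_bundle_def by simp_all
  note la = la[unfolded left_action_def] and ra = ra[unfolded right_action_def]
  have idG: "homeomorphic_maps (Arr G) (Arr G) id id" and idH: "homeomorphic_maps (Arr H) (Arr H) id id"
    by (auto simp: homeomorphic_maps_id)
  have cl: "continuous_map (fibre_product (Arr G) (src G) P \<pi>) P (\<lambda>(g, p). l g p)"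
    and cr: "continuous_map (fibre_product P \<phi> (Arr H) (tgt H)) P (\<lambda>(p, h). r p h)"
    and c\<pi>: "continuous_map P (Obj G) \<pi>" and c\<phi>: "continuous_map P (Obj H) \<phi>"
    using la ra by simp_all
  have lP: "l a p \<in> topspace P" if "a \<in> topspace (Arr G)" "p \<in> topspace P" "src G a = \<pi> p" for a p
    using cl that by (auto simp: continuous_map_def topspace_fibre_product Pi_def)
  have rP: "r p b \<in> topspace P" if "b \<in> topspace (Arr H)" "p \<in> topspace P" "\<phi> p = tgt H b" for b p
    using cr that by (auto simp: continuous_map_def topspace_fibre_product Pi_def)
  have cl': "continuous_map (fibre_product (Arr G) (src G) P' (\<pi> \<circ> g)) P' (\<lambda>(a, p). f (l a (g p)))"
  proof -
    have "continuous_map (fibre_product (Arr G) (src G) P' (\<pi> \<circ> g)) (fibre_product (Arr G) (src G) P \<pi>)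
            (map_prod id g)"
      by (rule continuous_map_fibre_product_map_prod) (use cg in auto)
    then have "continuous_map (fibre_product (Arr G) (src G) P' (\<pi> \<circ> g)) P'
         (f \<circ> ((\<lambda>(g, p). l g p) \<circ> map_prod id g))"
      by (intro continuous_map_compose[OF _ cf] continuous_map_compose[OF _ cl])
    then show ?thesis by (simp add: o_def map_prod_def case_prod_unfold)
  qed
  have cr': "continuous_map (fibre_product P' (\<phi> \<circ> g) (Arr H) (tgt H)) P' (\<lambda>(p, b). f (r (g p) b))"
  proof -
    have "continuous_map (fibre_product P' (\<phi> \<circ> g) (Arr H) (tgt H)) (fibre_product P \<phi> (Arr H) (tgt H))
            (map_prod g id)"
      by (rule continuous_map_fibre_product_map_prod) (use cg in auto)
    then have "continuous_map (fibre_product P' (\<phi> \<circ> g) (Arr H) (tgt H)) P'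
         (f \<circ> ((\<lambda>(p, h). r p h) \<circ> map_prod g id))"
      by (intro continuous_map_compose[OF _ cf] continuous_map_compose[OF _ cr])
    then show ?thesis by (simp add: o_def map_prod_def case_prod_unfold)
  qed
  have hr': "homeomorphic_map (fibre_product P' (\<phi> \<circ> g) (Arr H) (tgt H)) (fibre_product P' (\<pi> \<circ> g) P' (\<pi> \<circ> g))
       (\<lambda>(p, h). (p, f (r (g p) h)))"
  proof (rule homeomorphic_map_conjugate[OF _ _ hr])
    show "homeomorphic_maps (fibre_product P \<phi> (Arr H) (tgt H))
       (fibre_product P' (\<phi> \<circ> g) (Arr H) (tgt H)) (map_prod f id) (map_prod g id)"
      by (rule homeomorphic_maps_fibre_product[OF f idH]) (simp add: gf)
    show "homeomorphic_maps (fibre_product P \<pi> P \<pi>) (fibre_product P' (\<pi> \<circ> g) P' (\<pi> \<circ> g))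
        (map_prod f f) (map_prod g g)"
      by (rule homeomorphic_maps_fibre_product[OF f f]) (simp add: gf)
  qed (auto simp: topspace_fibre_product fg)
  have hl': "homeomorphic_map (fibre_product (Arr G) (src G) P' (\<pi> \<circ> g))
        (fibre_product P' (\<phi> \<circ> g) P' (\<phi> \<circ> g)) (\<lambda>(a, p). (f (l a (g p)), p))"
  proof (rule homeomorphic_map_conjugate[OF _ _ hl])
    show "homeomorphic_maps (fibre_product (Arr G) (src G) P \<pi>)
       (fibre_product (Arr G) (src G) P' (\<pi> \<circ> g)) (map_prod id f) (map_prod id g)"
      by (rule homeomorphic_maps_fibre_product[OF idG f]) (simp add: gf)
    show "homeomorphic_maps (fibre_product P \<phi> P \<phi>) (fibre_product P' (\<phi> \<circ> g) P' (\<phi> \<circ> g))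
        (map_prod f f) (map_prod g g)"
      by (rule homeomorphic_maps_fibre_product[OF f f]) (simp add: gf)
  qed (auto simp: topspace_fibre_product fg)
  have la': "left_action G P' (\<pi> \<circ> g) (\<lambda>a p. f (l a (g p)))"
    unfolding left_action_def using cl' continuous_map_compose[OF cg c\<pi>] la
    by (simp add: gf fg gP lP)
  have ra': "right_action H P' (\<phi> \<circ> g) (\<lambda>p b. f (r (g p) b))"
    unfolding right_action_def using cr' continuous_map_compose[OF cg c\<phi>] ra
    by (simp add: gf fg gP rP)
  have op': "open_map P' (Obj G) (\<pi> \<circ> g)" "open_map P' (Obj H) (\<phi> \<circ> g)"
    using og op by (auto intro: open_map_compose)
  have im': "(\<pi> \<circ> g) ` topspace P' = topspace (Obj G)" "(\<phi> \<circ> g) ` topspace P' = topspace (Obj H)"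
    by (simp_all only: image_comp[symmetric] im ig)
  have \<phi>l': "\<forall>a \<in> topspace (Arr G). \<forall>p \<in> topspace P'. src G a = (\<pi> \<circ> g) p \<longrightarrow>
      (\<phi> \<circ> g) (f (l a (g p))) = (\<phi> \<circ> g) p"
    by (simp add: gf gP lP \<phi>l)
  have \<pi>r': "\<forall>p \<in> topspace P'. \<forall>b \<in> topspace (Arr H). (\<phi> \<circ> g) p = tgt H b \<longrightarrow>
      (\<pi> \<circ> g) (f (r (g p) b)) = (\<pi> \<circ> g) p"
    by (simp add: gf gP rP \<pi>r)
  have rl': "\<forall>a \<in> topspace (Arr G). \<forall>p \<in> topspace P'. \<forall>b \<in> topspace (Arr H).
      src G a = (\<pi> \<circ> g) p \<longrightarrow> (\<phi> \<circ> g) p = tgt H b \<longrightarrow>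
      f (r (g (f (l a (g p)))) b) = f (l a (g (f (r (g p) b))))"
    by (simp add: gf gP rP lP rl \<phi>l \<pi>r)
  show ?thesis
    unfolding morita_bibundle_def principal_bundle_def
    by (intro conjI hr' hl' la' ra' op' im' \<phi>l' \<pi>r' rl')
qed

lemma homeomorphic_maps_relabel:
  assumes "inj_on f (topspace P)"
  shows "homeomorphic_maps P (pullback_topology (f ` topspace P) (inv_into (topspace P) f) P)
           f (inv_into (topspace P) f)"
proof -
  define g where "g = inv_into (topspace P) f"
  have gf: "g (f p) = p" if "p \<in> topspace P" for p
    unfolding g_def by (rule inv_into_f_f[OF assms that])
  have c: "continuous_map P P (g \<circ> f)"
    by (rule continuous_map_eq[OF continuous_map_id]) (simp add: gf)
  have "topspace P \<subseteq> f -` (f ` topspace P)"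
    by blast
  from continuous_map_pullback'[OF c this]
  have 1: "continuous_map P (pullback_topology (f ` topspace P) g P) f" .
  have 2: "continuous_map (pullback_topology (f ` topspace P) g P) P g"
    using continuous_map_pullback[OF continuous_map_id[of P], of "f ` topspace P" g]
    by (simp only: id_comp)
  have "f (g y) = y" if "y \<in> topspace (pullback_topology (f ` topspace P) g P)" for y
    using that by (auto simp only: topspace_pullback_topology Int_iff gf)
  then show ?thesis
    using 1 2 gf unfolding homeomorphic_maps_def g_def by blast
qed

lemma morita_equivalentI:
  fixes G :: "('a, 'o, 'm) groupoid_scheme" and H :: "('b, 'q, 'n) groupoid_scheme"
    and P :: "'p topology"
  assumes "topological_groupoid G" "topological_groupoid H"
    and B: "morita_bibundle G H P \<pi> \<phi> lact ract"
  shows "morita_equivalent G H"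
proof -
  define \<sigma> where "\<sigma> x = (SOME p. p \<in> topspace P \<and> \<pi> p = x)" for x
  define c where "c p = (SOME h. ract (\<sigma> (\<pi> p)) h = p)" for p
  have \<sigma>: "\<sigma> (\<pi> p) \<in> topspace P \<and> \<pi> (\<sigma> (\<pi> p)) = \<pi> p" if "p \<in> topspace P" for p
    unfolding \<sigma>_def
    by (rule someI[where P = "\<lambda>p'. p' \<in> topspace P \<and> \<pi> p' = \<pi> p" and x = p]) (simp add: that)
  have "homeomorphic_map (fibre_product P \<phi> (Arr H) (tgt H)) (fibre_product P \<pi> P \<pi>)
          (\<lambda>(p, h). (p, ract p h))"
    using B unfolding morita_bibundle_def principal_bundle_def by simp
  note surj = homeomorphic_imp_surjective_map[OF this]
  have c: "ract (\<sigma> (\<pi> p)) (c p) = p" if p: "p \<in> topspace P" for p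
  proof -
    have "(\<sigma> (\<pi> p), p) \<in> topspace (fibre_product P \<pi> P \<pi>)"
      using \<sigma>[OF p] p by (simp add: topspace_fibre_product)
    then obtain h where "p = ract (\<sigma> (\<pi> p)) h"
      unfolding surj[symmetric] by auto
    then have "ract (\<sigma> (\<pi> p)) h = p" ..
    then show ?thesis
      unfolding c_def by (rule someI)
  qed
  have "inj_on (\<lambda>p. (\<pi> p, c p)) (topspace P)"
    by (rule inj_onI) (metis c prod.inject)
  from morita_bibundle_transport[OF homeomorphic_maps_relabel[OF this] B]
  show ?thesis unfolding morita_equivalent_def using assms(1,2) by blast
qed

section \<open>Bundles of topological groups\<close>

record ('u, 'q) group_bundle =
  Total :: "'u topology"
  Base :: "'q topology"
  bproj :: "'u \<Rightarrow> 'q"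
  bmlt :: "'u \<Rightarrow> 'u \<Rightarrow> 'u"
  bone :: "'q \<Rightarrow> 'u"

definition fibre_top :: "('u, 'q) group_bundle \<Rightarrow> 'q \<Rightarrow> 'u topology" where
  "fibre_top U q = subtopology (Total U) {u. bproj U u = q}"

definition fibre_group :: "('u, 'q) group_bundle \<Rightarrow> 'q \<Rightarrow> 'u monoid" where
  "fibre_group U q =
     \<lparr>carrier = topspace (fibre_top U q), monoid.mult = bmlt U, one = bone U q\<rparr>"

definition bundle_inv :: "('u, 'q) group_bundle \<Rightarrow> 'u \<Rightarrow> 'u" where
  "bundle_inv U u = inv\<^bsub>fibre_group U (bproj U u)\<^esub> u"

definition topological_group :: "'g topology \<Rightarrow> 'g monoid \<Rightarrow> bool" where
  "topological_group T K \<longleftrightarrow>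
     group K \<and> topspace T = carrier K \<and>
     continuous_map (prod_topology T T) T (\<lambda>(x, y). x \<otimes>\<^bsub>K\<^esub> y) \<and>
     continuous_map T T (\<lambda>x. inv\<^bsub>K\<^esub> x)"

definition bundle_of_topological_groups :: "('u, 'q) group_bundle \<Rightarrow> bool" where
  "bundle_of_topological_groups U \<longleftrightarrow>
     Hausdorff_space (Base U) \<and>
     continuous_map (Total U) (Base U) (bproj U) \<and>
     open_map (Total U) (Base U) (bproj U) \<and>
     bproj U ` topspace (Total U) = topspace (Base U) \<and>
     (\<forall>q \<in> topspace (Base U). topological_group (fibre_top U q) (fibre_group U q)) \<and>
     continuous_map (fibre_product (Total U) (bproj U) (Total U) (bproj U)) (Total U)
       (\<lambda>(u, v). bmlt U u v) \<and>
     continuous_map (Total U) (Total U) (bundle_inv U) \<and>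
     continuous_map (Base U) (Total U) (bone U)"

definition bundle_groupoid :: "('u, 'q) group_bundle \<Rightarrow> ('u, 'q) groupoid" where
  "bundle_groupoid U =
     \<lparr>Arr = Total U, Obj = Base U, src = bproj U, tgt = bproj U,
      mlt = bmlt U, ginv = bundle_inv U, uni = bone U\<rparr>"

definition translation_groupoid ::
    "'p topology \<Rightarrow> ('p \<Rightarrow> 'q) \<Rightarrow> ('p \<Rightarrow> 'u \<Rightarrow> 'p) \<Rightarrow> ('u, 'q) group_bundle \<Rightarrow>
     ('p \<times> 'u, 'p) groupoid" where
  "translation_groupoid P \<phi> act U =
     \<lparr>Arr = fibre_product P \<phi> (Total U) (bproj U), Obj = P,
      src = (\<lambda>(p, u). act p u), tgt = (\<lambda>(p, u). p),
      mlt = (\<lambda>(p, u) (p', u'). (p, bmlt U u u')),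
      ginv = (\<lambda>(p, u). (act p u, bundle_inv U u)),
      uni = (\<lambda>p. (p, bone U (\<phi> p)))\<rparr>"

definition almost_free ::
    "'p topology \<Rightarrow> ('p \<Rightarrow> 'q) \<Rightarrow> ('p \<Rightarrow> 'u \<Rightarrow> 'p) \<Rightarrow> ('u, 'q) group_bundle \<Rightarrow> bool" where
  "almost_free P \<phi> act U \<longleftrightarrow>
     (\<forall>p \<in> topspace P. finite (isotropy (translation_groupoid P \<phi> act U) p))"


section \<open>Unitary groups\<close>

text \<open>An \<open>n \<times> n\<close> matrix is a function on pairs of indices which vanishes unless both indices
  are \<open>< n\<close>; its topology is the one of entrywise convergence.\<close>

definition unitary_mats :: "nat \<Rightarrow> (nat \<Rightarrow> nat \<Rightarrow> complex) set" where
  "unitary_mats n =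
     {A. (\<forall>i j. \<not> (i < n \<and> j < n) \<longrightarrow> A i j = 0) \<and>
         (\<forall>i<n. \<forall>j<n. (\<Sum>k<n. A i k * cnj (A j k)) = (if i = j then 1 else 0)) \<and>
         (\<forall>i<n. \<forall>j<n. (\<Sum>k<n. cnj (A k i) * A k j) = (if i = j then 1 else 0))}"

definition unitary_top :: "nat \<Rightarrow> (nat \<Rightarrow> nat \<Rightarrow> complex) topology" where
  "unitary_top n = subtopology euclidean (unitary_mats n)"

definition unitary_group :: "nat \<Rightarrow> (nat \<Rightarrow> nat \<Rightarrow> complex) monoid" where
  "unitary_group n =
     \<lparr>carrier = unitary_mats n,
      monoid.mult = (\<lambda>A B i j. \<Sum>k<n. A i k * B k j),
      one = (\<lambda>i j. if i < n \<and> i = j then 1 else 0)\<rparr>"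

definition isomorphic_topological_groups ::
    "'g topology \<Rightarrow> 'g monoid \<Rightarrow> 'h topology \<Rightarrow> 'h monoid \<Rightarrow> bool" where
  "isomorphic_topological_groups T K T' K' \<longleftrightarrow> (\<exists>f \<in> iso K K'. homeomorphic_map T T' f)"

definition finite_product_of_unitary_groups :: "'g topology \<Rightarrow> 'g monoid \<Rightarrow> bool" where
  "finite_product_of_unitary_groups T K \<longleftrightarrow>
     (\<exists>ns :: nat list. isomorphic_topological_groups T K
        (product_topology (\<lambda>i. unitary_top (ns ! i)) {..<length ns})
        (product_group {..<length ns} (\<lambda>i. unitary_group (ns ! i))))"


section \<open>A supply of points\<close>

text \<open>HOL cannot quantify existentially over the types of points of the spaces to be constructed.
  The type used for them has the cardinality of the continuum, hence accommodates every second
  countable \<open>T\<^sub>0\<close> space: given a countable base \<open>B\<close>, send \<open>x\<close> to \<open>{n. x \<in> B n}\<close>.  It carries no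
  topology of its own here.\<close>

type_synonym point = "nat set"

end

theory Submission
  imports Defs
begin

text \<open>
  Around every object \<open>x\<close> there is an open set \<open>V\<close> such that the number of arrows from \<open>y\<close> to
  \<open>V\<close> is finite, non-zero and constant for \<open>y\<close> near \<open>x\<close>, the arrows depending continuously on
  \<open>y\<close>.  Hence the spaces \<open>\<ell>\<^sup>2\<close> of functions on the sets \<open>Q y\<close> of these arrows form, over the
  saturation of a neighbourhood of \<open>x\<close>, a Hermitian vector bundle on which the groupoid acts by
  right translation, faithfully on isotropy groups.  Countably many such sets \<open>V i\<close>, together
  with a point-finite family of invariant weights \<open>w i\<close> vanishing outside the corresponding
  saturations, cover the groupoid.

  Let \<open>E\<close> be the space of all families of orthonormal frames of these bundles, where the
  \<open>i\<close>-th frame is rescaled by \<open>w i\<close> and thereby collapses continuously where the \<open>i\<close>-th bundle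
  ends.  The groupoid acts freely on \<open>E\<close> from the left, and the groups
  \<open>\<Prod>\<^bsub>w i y > 0\<^esub> U(n i)\<close>, collapsing in the same way, act from the right, simply transitively
  on the fibres of \<open>E\<close> over the objects.  So \<open>E\<close> is a bibundle between the groupoid and the
  translation groupoid of the action on the quotient of \<open>E\<close> by the groupoid.  The bundle of
  unitary groups lives over the space of all possible values of \<open>(w i)\<^sub>i\<close>; no model of the orbit
  space is needed.
\<close>

section \<open>Limits along filters in abstract topologies\<close>

text \<open>The vector bundles live on different saturated open sets and have unrelated ranks, so no
  single frame bundle with a fixed structure group is at hand; hence the group is allowed to vary
  with the point. The rescaling settles what happens at the edge of each set: every entry of the
  i-th frame is bounded by \<open>w i\<close>, so it converges to 0 there whatever the bundle does,
  and the product of two scaled matrices, which has to be divided by the weight, stays continuous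
  because both factors carry that weight. The collapse does not spoil freeness, since at every
  object some weight is positive. Properness of the groupoid enters through the finiteness and local
  constancy of \<open>Q y\<close>. These also make the quotient of E Hausdorff: the arrow between
  two nearby frames has only finitely many candidates, so one of them recurs. Collapse is a
  statement about limits, and E comes without a trivialisation; continuity is therefore expressed
  throughout by convergence along arbitrary filters, with subfilters in the place of
  subsequences.\<close>

lemma limitin_filterlim:
  "limitin X f l F \<longleftrightarrow> l \<in> topspace X \<and> filterlim f (nhdsin X l) F"
proof
  assume L: "limitin X f l F"
  have "\<forall>\<^sub>F t in F. P (f t)" if P: "eventually P (nhdsin X l)" for P
  proof -
    obtain S where "openin X S" "l \<in> S" and S: "\<forall>x\<in>S. P x"
      using P L by (auto simp: eventually_nhdsin limitin_def)
    then have "\<forall>\<^sub>F t in F. f t \<in> S"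
      using L by (simp add: limitin_def)
    then show ?thesis
      by (rule eventually_mono) (use S in blast)
  qed
  then show "l \<in> topspace X \<and> filterlim f (nhdsin X l) F"
    using L by (simp add: filterlim_iff limitin_def)
next
  assume R: "l \<in> topspace X \<and> filterlim f (nhdsin X l) F"
  have "\<forall>\<^sub>F t in F. f t \<in> U" if "openin X U" "l \<in> U" for U
  proof -
    have "\<forall>\<^sub>F y in nhdsin X l. y \<in> U"
      using that by (auto simp: eventually_nhdsin)
    then show ?thesis
      using R unfolding filterlim_iff by blast
  qed
  then show "limitin X f l F"
    using R by (simp add: limitin_def)
qed

lemma eventually_limitin:
  assumes "limitin X f l F" "eventually P (nhdsin X l)"
  shows "\<forall>\<^sub>F t in F. P (f t)"
  using assms by (auto simp: limitin_filterlim filterlim_iff)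

lemma eventually_nhdsin_self: "eventually P (nhdsin X x) \<Longrightarrow> x \<in> topspace X \<Longrightarrow> P x"
  by (auto simp: eventually_nhdsin)

lemma eventually_in_topspace_nhdsin: "\<forall>\<^sub>F y in nhdsin X x. y \<in> topspace X"
  by (auto simp: eventually_nhdsin)

lemma eventually_nhdsinI: "(\<And>y. y \<in> topspace X \<Longrightarrow> P y) \<Longrightarrow> eventually P (nhdsin X x)"
  by (rule eventually_mono[OF eventually_in_topspace_nhdsin])

lemma eventually_nhdsin_open: "openin X S \<Longrightarrow> x \<in> S \<Longrightarrow> \<forall>\<^sub>F y in nhdsin X x. y \<in> S"
  by (auto simp: eventually_nhdsin)

lemma eventually_nhdsin_nhdsin:
  "eventually P (nhdsin X x) \<Longrightarrow> \<forall>\<^sub>F y in nhdsin X x. eventually P (nhdsin X y)"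
  by (cases "x \<in> topspace X") (auto simp: eventually_nhdsin)

lemma limitin_ident: "x \<in> topspace X \<Longrightarrow> limitin X (\<lambda>y. y) x (nhdsin X x)"
  by (simp add: limitin_filterlim filterlim_ident)

lemma limitin_eventually_topspace: "limitin X f l F \<Longrightarrow> \<forall>\<^sub>F t in F. f t \<in> topspace X"
  using eventually_limitin[OF _ eventually_in_topspace_nhdsin] .

lemma limitin_compose:
  assumes "limitin X f l F" "limitin Y g m (nhdsin X l)"
  shows "limitin Y (\<lambda>t. g (f t)) m F"
  using assms filterlim_compose by (auto simp: limitin_filterlim)

text \<open>\<open>atin\<close> removes the point itself, which makes limits fail to compose;
  \<open>nhdsin\<close> keeps it, so that \<open>limitin_compose\<close> applies as it
  stands.\<close>

lemma continuous_map_nhdsin: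
  "continuous_map X Y f \<longleftrightarrow> (\<forall>x\<in>topspace X. limitin Y f (f x) (nhdsin X x))"
proof
  assume "continuous_map X Y f"
  then show "\<forall>x\<in>topspace X. limitin Y f (f x) (nhdsin X x)"
    using continuous_map_limit[of X Y f "\<lambda>y. y", unfolded o_def] limitin_ident by metis
next
  assume "\<forall>x\<in>topspace X. limitin Y f (f x) (nhdsin X x)"
  then show "continuous_map X Y f"
    unfolding continuous_map_atin limitin_filterlim atin_def
    by (meson filterlim_mono inf_le1 order_refl)
qed

lemma continuous_map_limitin:
  "continuous_map X Y f \<Longrightarrow> limitin X h l F \<Longrightarrow> limitin Y (\<lambda>t. f (h t)) (f l) F"
  using continuous_map_limit[of X Y f h l F] by (simp add: o_def)

lemma openin_nhdsin:
  "openin X S \<longleftrightarrow> S \<subseteq> topspace X \<and> (\<forall>x\<in>S. \<forall>\<^sub>F y in nhdsin X x. y \<in> S)"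
proof
  assume "S \<subseteq> topspace X \<and> (\<forall>x\<in>S. \<forall>\<^sub>F y in nhdsin X x. y \<in> S)"
  then show "openin X S"
    unfolding eventually_nhdsin by (subst openin_subopen) (meson subset_eq)
qed (auto simp: openin_subset eventually_nhdsin)

lemma limitin_fibre_product:
  "limitin (fibre_product X f Y g) h l F \<longleftrightarrow>
     limitin X (\<lambda>t. fst (h t)) (fst l) F \<and> limitin Y (\<lambda>t. snd (h t)) (snd l) F \<and>
     f (fst l) = g (snd l) \<and> (\<forall>\<^sub>F t in F. f (fst (h t)) = g (snd (h t)))"
  by (auto simp: fibre_product_def limitin_subtopology limitin_pairwise o_def case_prod_unfold)

text \<open>A point y near f x is the image of s y, and s y lies in a given open set around x as
  soon as y is close enough. The section has to converge only at f x. This criterion serves for the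
  structure maps of both groupoids constructed below and for the projection of E.\<close>

lemma open_map_local_sections:
  assumes "f \<in> topspace X \<rightarrow> topspace Y"
    and s: "\<And>x. x \<in> topspace X \<Longrightarrow>
      \<exists>s. limitin X s x (nhdsin Y (f x)) \<and> (\<forall>\<^sub>F y in nhdsin Y (f x). f (s y) = y)"
  shows "open_map X Y f"
  unfolding open_map_def
proof (intro allI impI)
  fix S assume S: "openin X S"
  have "\<forall>\<^sub>F y in nhdsin Y (f x). y \<in> f ` S" if "x \<in> S" for x
  proof -
    have "x \<in> topspace X"
      using S that openin_subset by blast
    from s[OF this] obtain s where l: "limitin X s x (nhdsin Y (f x))"
      and e: "\<forall>\<^sub>F y in nhdsin Y (f x). f (s y) = y"
      by blast
    have "\<forall>\<^sub>F y in nhdsin Y (f x). s y \<in> S"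
      using limitinD[OF l S that] .
    then show ?thesis
      using e
    proof eventually_elim
      case (elim y)
      then show ?case using imageI[of "s y" S f] by simp
    qed
  qed
  then show "openin Y (f ` S)"
    using assms(1) openin_subset[OF S] by (auto simp: openin_nhdsin)
qed

text \<open>The sets that m enters eventually if they contain e are stable under finite
  intersections and arbitrary unions, so the subbase decides.\<close>

lemma limitin_topology_generated_by:
  "limitin (topology_generated_by \<S>) m e F \<longleftrightarrow>
     e \<in> \<Union>\<S> \<and> (\<forall>S\<in>\<S>. e \<in> S \<longrightarrow> (\<forall>\<^sub>F t in F. m t \<in> S))" (is "?L \<longleftrightarrow> ?R")
proof
  assume L: ?L
  then have "e \<in> \<Union>\<S>"
    using limitin_topspace[OF L] by simp
  then show ?R
    using limitinD[OF L topology_generated_by_Basis] by simp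
next
  assume R: ?R
  have "e \<in> S \<longrightarrow> (\<forall>\<^sub>F t in F. m t \<in> S)" if "generate_topology_on \<S> S" for S
    using that
  proof induction
    case (Int a b)
    then show ?case by (simp add: eventually_conj_iff)
  next
    case (UN K)
    show ?case
    proof
      assume "e \<in> \<Union>K"
      then obtain k where k: "k \<in> K" "e \<in> k" by blast
      then have "\<forall>\<^sub>F t in F. m t \<in> k"
        using UN by blast
      then show "\<forall>\<^sub>F t in F. m t \<in> \<Union>K"
        by (rule eventually_mono) (use k in blast)
    qed
  next
    case (Basis S)
    then show ?case using R by blast
  qed simp
  then show ?L
    using R by (simp add: limitin_def openin_topology_generated_by_iff)
qed

lemma tendsto_fun_iff:
  fixes f :: "'a \<Rightarrow> 'i \<Rightarrow> 'b::topological_space"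
  shows "(f \<longlongrightarrow> l) F \<longleftrightarrow> (\<forall>i. ((\<lambda>t. f t i) \<longlongrightarrow> l i) F)"
  using limitin_componentwise[of "\<lambda>_. euclidean" UNIV f l F]
  unfolding euclidean_product_topology by simp

lemma tendsto_pair_iff:
  "(f \<longlongrightarrow> l) F \<longleftrightarrow> ((\<lambda>t. fst (f t)) \<longlongrightarrow> fst l) F \<and> ((\<lambda>t. snd (f t)) \<longlongrightarrow> snd l) F"
  using limitin_pairwise[of euclidean euclidean f l F]
  by (simp add: prod_topology_euclidean o_def)

section \<open>Multiples of unitary matrices\<close>

text \<open>Matrices with rows indexed by \<open>S\<close> and columns by \<open>T\<close>, vanishing elsewhere.  The only multiple of
  a unitary matrix by \<open>0\<close> is \<open>0\<close>; the product \<open>mcomp\<close> respects this, as division by \<open>0\<close>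
  yields \<open>0\<close>.\<close>

definition cunitary :: "real \<Rightarrow> 'a set \<Rightarrow> 'b set \<Rightarrow> ('a \<Rightarrow> 'b \<Rightarrow> complex) \<Rightarrow> bool" where
  "cunitary c S T M \<longleftrightarrow>
     (\<forall>g l. \<not> (g \<in> S \<and> l \<in> T) \<longrightarrow> M g l = 0) \<and>
     (\<forall>g\<in>S. \<forall>h\<in>S. (\<Sum>l\<in>T. M g l * cnj (M h l)) = (if g = h then (of_real c)\<^sup>2 else 0)) \<and>
     (\<forall>k\<in>T. \<forall>l\<in>T. (\<Sum>g\<in>S. cnj (M g k) * M g l) = (if k = l then (of_real c)\<^sup>2 else 0))"

text \<open>For M = cA and N = cB with A, B unitary the value is c AB: scaled matrices are
  multiplied as the unitary matrices that they stand for.\<close>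

definition mcomp ::
    "real \<Rightarrow> 'b set \<Rightarrow> ('a \<Rightarrow> 'b \<Rightarrow> complex) \<Rightarrow> ('b \<Rightarrow> 'c \<Rightarrow> complex) \<Rightarrow> 'a \<Rightarrow> 'c \<Rightarrow> complex" where
  "mcomp c T M N = (\<lambda>g l. (\<Sum>k\<in>T. M g k * N k l) / of_real c)"

definition madj :: "('a \<Rightarrow> 'b \<Rightarrow> complex) \<Rightarrow> 'b \<Rightarrow> 'a \<Rightarrow> complex" where
  "madj M = (\<lambda>l g. cnj (M g l))"

definition mid :: "real \<Rightarrow> 'a set \<Rightarrow> 'a \<Rightarrow> 'a \<Rightarrow> complex" where
  "mid c S = (\<lambda>k l. if k \<in> S \<and> k = l then of_real c else 0)"

text \<open>The row of index g has squared norm c^2 = 0. Finiteness is asked of the columns only,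
  since nothing is known about the row set \<open>Q i x\<close> where \<open>w i x\<close>
  vanishes.\<close>

lemma cunitary_zero:
  assumes "cunitary 0 S T M" "finite T"
  shows "M = (\<lambda>_ _. 0)"
proof (intro ext)
  fix g l
  show "M g l = 0"
  proof (cases "g \<in> S \<and> l \<in> T")
    case True
    have "of_real (\<Sum>l\<in>T. (cmod (M g l))\<^sup>2) = (\<Sum>l\<in>T. M g l * cnj (M g l))"
      by (simp only: of_real_sum complex_norm_square)
    also have "\<dots> = 0"
      using assms True by (simp add: cunitary_def)
    finally have "(\<Sum>l\<in>T. (cmod (M g l))\<^sup>2) = 0"
      by (simp only: of_real_eq_0_iff)
    then show ?thesis
      using assms(2) True by (simp add: sum_nonneg_eq_0_iff)
  qed (use assms in \<open>auto simp: cunitary_def\<close>)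
qed

lemma cunitary_0: "cunitary 0 S T (\<lambda>_ _. 0)"
  by (simp add: cunitary_def)

text \<open>The squared modulus is one summand of the squared row norm c^2. This bound sends
  collapsing entries to 0 and, for c \<le> 1, yields compact fibres.\<close>

lemma cunitary_bound:
  assumes "cunitary c S T M" "finite T" "c \<ge> 0"
  shows "cmod (M g l) \<le> c"
proof (cases "g \<in> S \<and> l \<in> T")
  case True
  have "(\<Sum>l\<in>T. M g l * cnj (M g l)) = of_real (\<Sum>l\<in>T. (cmod (M g l))\<^sup>2)"
    by (simp only: of_real_sum complex_norm_square)
  moreover have "(\<Sum>l\<in>T. M g l * cnj (M g l)) = of_real (c\<^sup>2)"
    using assms True by (simp add: cunitary_def)
  ultimately have "(\<Sum>l\<in>T. (cmod (M g l))\<^sup>2) = c\<^sup>2"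
    by (metis of_real_eq_iff)
  moreover have "(cmod (M g l))\<^sup>2 \<le> (\<Sum>l\<in>T. (cmod (M g l))\<^sup>2)"
    using True assms(2) by (intro member_le_sum) auto
  ultimately show ?thesis
    using assms(3) power2_le_imp_le by fastforce
qed (use assms in \<open>auto simp: cunitary_def\<close>)

lemma cunitary_outside: "cunitary c S T M \<Longrightarrow> \<not> (g \<in> S \<and> l \<in> T) \<Longrightarrow> M g l = 0"
  by (auto simp: cunitary_def)

text \<open>For c = 0 the matrix is zero and finiteness is demanded only otherwise; the same guard
  recurs below, because the index sets are under control only where the weight is non-zero.\<close>

lemma cunitary_mid: "(c \<noteq> 0 \<Longrightarrow> finite S) \<Longrightarrow> cunitary c S S (mid c S)"
proof (cases "c = 0")
  case True
  then have "mid c S = (\<lambda>_ _. 0)"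
    by (auto simp: mid_def fun_eq_iff)
  then show ?thesis
    using True cunitary_0 by simp
next
  case False
  assume "c \<noteq> 0 \<Longrightarrow> finite S"
  with False have S: "finite S" by simp
  have *: "(\<Sum>k\<in>S. mid c S g k * cnj (mid c S h k)) = (if g = h then (of_real c)\<^sup>2 else 0)"
    if "g \<in> S" for g h
  proof -
    have "(\<Sum>k\<in>S. mid c S g k * cnj (mid c S h k)) =
        (\<Sum>k\<in>S. if g = k then (if g = h then (of_real c)\<^sup>2 else 0) else 0)"
      by (rule sum.cong) (auto simp: mid_def power2_eq_square)
    then show ?thesis
      using S that by simp
  qed
  have "mid c S k g = mid c S g k" "cnj (mid c S k g) = mid c S k g" for k g
    by (auto simp: mid_def)
  with * show ?thesis
    unfolding cunitary_def by (simp add: mult.commute) (auto simp: mid_def)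
qed

lemma cunitary_madj: "cunitary c S T M \<Longrightarrow> cunitary c T S (madj M)"
  unfolding cunitary_def madj_def
  by (auto simp: mult.commute)

lemma madj_madj [simp]: "madj (madj M) = M"
  by (simp add: madj_def)

lemma mcomp_zero [simp]: "mcomp 0 T M N = (\<lambda>_ _. 0)"
  by (simp add: mcomp_def)

lemma mcomp_assoc: "mcomp c T (mcomp c S M N) P = mcomp c S M (mcomp c T N P)"
proof (intro ext)
  fix g l
  have "(\<Sum>k\<in>T. (\<Sum>j\<in>S. M g j * N j k) / of_real c * P k l) =
      (\<Sum>k\<in>T. \<Sum>j\<in>S. M g j * (N j k * P k l) / of_real c)"
    by (simp add: sum_distrib_left sum_distrib_right sum_divide_distrib mult.assoc)
  also have "\<dots> = (\<Sum>j\<in>S. \<Sum>k\<in>T. M g j * (N j k * P k l) / of_real c)"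
    by (rule sum.swap)
  also have "\<dots> = (\<Sum>j\<in>S. M g j * ((\<Sum>k\<in>T. N j k * P k l) / of_real c))"
    by (simp add: sum_distrib_left sum_distrib_right sum_divide_distrib mult.assoc)
  finally show "mcomp c T (mcomp c S M N) P g l = mcomp c S M (mcomp c T N P) g l"
    by (simp add: mcomp_def)
qed

lemma madj_mcomp: "madj (mcomp c T M N) = mcomp c T (madj N) (madj M)"
  by (simp add: mcomp_def madj_def fun_eq_iff mult.commute)

lemma mcomp_madj_right:
  assumes "cunitary c S T M" "finite T"
  shows "mcomp c T M (madj M) = mid c S"
proof (intro ext)
  fix g h
  have "(\<Sum>k\<in>T. M g k * cnj (M h k)) = of_real c * mid c S g h"
  proof (cases "g \<in> S \<and> h \<in> S")
    case False
    then have "(\<Sum>k\<in>T. M g k * cnj (M h k)) = 0"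
      using cunitary_outside[OF assms(1)] by (intro sum.neutral) auto
    then show ?thesis using False by (auto simp: mid_def)
  qed (use assms in \<open>auto simp: cunitary_def mid_def power2_eq_square\<close>)
  then show "mcomp c T M (madj M) g h = mid c S g h"
    by (cases "c = 0") (auto simp: mcomp_def madj_def mid_def)
qed

lemma mcomp_madj_left:
  assumes "cunitary c S T M"
  shows "mcomp c S (madj M) M = mid c T"
proof (intro ext)
  fix k l
  have "(\<Sum>g\<in>S. cnj (M g k) * M g l) = of_real c * mid c T k l"
  proof (cases "k \<in> T \<and> l \<in> T")
    case False
    then have "(\<Sum>g\<in>S. cnj (M g k) * M g l) = 0"
      using cunitary_outside[OF assms(1)] by (intro sum.neutral) auto
    then show ?thesis using False by (auto simp: mid_def)
  qed (use assms in \<open>auto simp: cunitary_def mid_def power2_eq_square\<close>)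
  then show "mcomp c S (madj M) M k l = mid c T k l"
    by (cases "c = 0") (auto simp: mcomp_def madj_def mid_def)
qed

lemma mcomp_mid_left:
  assumes "cunitary c S T M" "finite T" "c \<noteq> 0 \<Longrightarrow> finite S"
  shows "mcomp c S (mid c S) M = M"
proof (cases "c = 0")
  case False
  have "(\<Sum>k\<in>S. mid c S g k * M k l) = of_real c * M g l" for g l
  proof -
    have "(\<Sum>k\<in>S. mid c S g k * M k l) = (\<Sum>k\<in>S. if g = k then of_real c * M k l else 0)"
      by (rule sum.cong) (auto simp: mid_def)
    then show ?thesis
      using assms False by (auto simp: cunitary_outside)
  qed
  then show ?thesis
    using False by (simp add: mcomp_def)
qed (use assms cunitary_zero in fastforce)

lemma mcomp_mid_right:
  assumes "cunitary c S T M" "finite T"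
  shows "mcomp c T M (mid c T) = M"
proof (cases "c = 0")
  case False
  have "(\<Sum>k\<in>T. M g k * mid c T k l) = of_real c * M g l" for g l
  proof -
    have "(\<Sum>k\<in>T. M g k * mid c T k l) = (\<Sum>k\<in>T. if k = l then of_real c * M g k else 0)"
      by (rule sum.cong) (auto simp: mid_def)
    then show ?thesis
      using assms False by (auto simp: cunitary_outside)
  qed
  then show ?thesis
    using False by (simp add: mcomp_def)
qed (use assms cunitary_zero in fastforce)

text \<open>For c \<noteq> 0 the scalar cancels from the defining sums, which turns the definition
  into matrix identities and makes the algebra of adjoints available.\<close>

lemma cunitary_iff:
  assumes "c \<noteq> 0" "finite T"
  shows "cunitary c S T M \<longleftrightarrow> (\<forall>g l. \<not> (g \<in> S \<and> l \<in> T) \<longrightarrow> M g l = 0) \<and>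
     mcomp c T M (madj M) = mid c S \<and> mcomp c S (madj M) M = mid c T"
proof
  assume R: "(\<forall>g l. \<not> (g \<in> S \<and> l \<in> T) \<longrightarrow> M g l = 0) \<and>
     mcomp c T M (madj M) = mid c S \<and> mcomp c S (madj M) M = mid c T"
  have "(\<Sum>k\<in>T. M g k * cnj (M h k)) = of_real c * mid c S g h" for g h
    using R assms by (auto simp: mcomp_def madj_def fun_eq_iff field_simps)
  moreover have "(\<Sum>k\<in>S. cnj (M k g) * M k h) = of_real c * mid c T g h" for g h
    using R assms by (auto simp: mcomp_def madj_def fun_eq_iff field_simps)
  ultimately show "cunitary c S T M"
    using R by (auto simp: cunitary_def mid_def power2_eq_square)
qed (use assms in \<open>simp add: mcomp_madj_right mcomp_madj_left cunitary_outside\<close>)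

lemma cunitary_mcomp:
  assumes M: "cunitary c S T M" and N: "cunitary c T R N"
    and fin: "c \<noteq> 0 \<Longrightarrow> finite S \<and> finite T \<and> finite R"
  shows "cunitary c S R (mcomp c T M N)"
proof (cases "c = 0")
  case False
  have "mcomp c R (mcomp c T M N) (madj (mcomp c T M N)) =
      mcomp c T M (mcomp c T (mcomp c R N (madj N)) (madj M))"
    by (simp add: madj_mcomp mcomp_assoc)
  also have "\<dots> = mcomp c T M (madj M)"
    using mcomp_mid_left[OF cunitary_madj[OF M]] fin False N
    by (simp add: mcomp_madj_right)
  also have "\<dots> = mid c S"
    using M fin False by (simp add: mcomp_madj_right)
  finally have 1: "mcomp c R (mcomp c T M N) (madj (mcomp c T M N)) = mid c S" .
  have "mcomp c S (madj (mcomp c T M N)) (mcomp c T M N) =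
      mcomp c T (madj N) (mcomp c T (mcomp c S (madj M) M) N)"
    by (simp add: madj_mcomp mcomp_assoc)
  also have "\<dots> = mcomp c T (madj N) N"
    using mcomp_mid_left[OF N] fin False M by (simp add: mcomp_madj_left)
  also have "\<dots> = mid c R"
    using N by (simp add: mcomp_madj_left)
  finally have 2: "mcomp c S (madj (mcomp c T M N)) (mcomp c T M N) = mid c R" .
  have 3: "mcomp c T M N g l = 0" if "\<not> (g \<in> S \<and> l \<in> R)" for g l
    using M N that by (auto simp: mcomp_def cunitary_def intro!: sum.neutral)
  show ?thesis
    using cunitary_iff[OF False, of R] fin False 1 2 3 by blast
qed (simp add: cunitary_0)

text \<open>With d = c'/c this carries a matrix from scale c to scale c', which is how frames and
  group elements are extended to nearby points.\<close>

lemma cunitary_scale: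
  assumes "cunitary c S T M"
  shows "cunitary (d * c) S T (\<lambda>g l. of_real d * M g l)"
proof -
  have "(\<Sum>l\<in>T. of_real d * M g l * cnj (of_real d * M h l)) = (of_real d)\<^sup>2 * (\<Sum>l\<in>T. M g l * cnj (M h l))" for g h
    by (simp add: sum_distrib_left power2_eq_square mult_ac)
  moreover have "(\<Sum>g\<in>S. cnj (of_real d * M g k) * (of_real d * M g l)) = (of_real d)\<^sup>2 * (\<Sum>g\<in>S. cnj (M g k) * M g l)" for k l
    by (simp add: sum_distrib_left power2_eq_square mult_ac)
  ultimately show ?thesis
    using assms unfolding cunitary_def by (auto simp: power_mult_distrib)
qed

text \<open>Renaming the rows preserves the relations. Right translation by an arrow and transport
  along local sections both act on frames in this way, leaving the columns alone.\<close>

lemma cunitary_reindex: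
  assumes M: "cunitary c S T M" and \<beta>: "bij_betw \<beta> S' S"
  shows "cunitary c S' T (\<lambda>g l. if g \<in> S' then M (\<beta> g) l else 0)"
proof -
  have "(\<Sum>g\<in>S'. cnj (M (\<beta> g) k) * M (\<beta> g) l) = (\<Sum>g\<in>S. cnj (M g k) * M g l)" for k l
    using sum.reindex_bij_betw[OF \<beta>] .
  moreover have "\<beta> g = \<beta> h \<longleftrightarrow> g = h" "\<beta> g \<in> S" if "g \<in> S'" "h \<in> S'" for g h
    using \<beta> that by (auto simp: bij_betw_def inj_on_def)
  ultimately show ?thesis
    using M by (simp add: cunitary_def cong: sum.cong)
qed

lemma cunitary_exists:
  assumes "c \<noteq> 0 \<Longrightarrow> finite S \<and> card S = card T" "finite T"
  shows "\<exists>M. cunitary c S T M"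
proof (cases "c = 0")
  case False
  then obtain \<beta> where "bij_betw \<beta> S T"
    using assms finite_same_card_bij by blast
  then show ?thesis
    using cunitary_reindex[OF cunitary_mid] assms(2) by blast
qed (use cunitary_0 in blast)

text \<open>Equal rows of different index would have inner product 0 by orthogonality and c^2 by
  their length. Freeness of the groupoid action on frames rests on this.\<close>

lemma cunitary_row_inj:
  assumes "cunitary c S T M" "c \<noteq> 0" "g \<in> S" "h \<in> S" "M g = M h"
  shows "g = h"
proof (rule ccontr)
  assume "g \<noteq> h"
  then have "(\<Sum>l\<in>T. M g l * cnj (M h l)) = 0" "(\<Sum>l\<in>T. M h l * cnj (M h l)) = (of_real c)\<^sup>2"
    using assms(1,3,4) by (simp_all add: cunitary_def)
  then show False
    using assms(2,5) by simp
qed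

text \<open>If c0 = 0, each product is at most c^2 in modulus, so the quotient is at most
  \<open>card K\<close> times c and tends to 0: multiplication is continuous across the
  collapse.\<close>

lemma tendsto_scaled_sum:
  fixes a b :: "'k \<Rightarrow> 't \<Rightarrow> complex"
  assumes K: "finite K" and a: "\<And>k. k \<in> K \<Longrightarrow> (a k \<longlongrightarrow> a0 k) F" and b: "\<And>k. k \<in> K \<Longrightarrow> (b k \<longlongrightarrow> b0 k) F"
    and c: "(c \<longlongrightarrow> c0) F"
    and le: "\<forall>\<^sub>F t in F. \<forall>k\<in>K. cmod (a k t) \<le> c t" "\<forall>\<^sub>F t in F. \<forall>k\<in>K. cmod (b k t) \<le> c t"
  shows "((\<lambda>t. (\<Sum>k\<in>K. a k t * b k t) / of_real (c t)) \<longlongrightarrow> (\<Sum>k\<in>K. a0 k * b0 k) / of_real c0) F"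
proof (cases "c0 = 0")
  case True
  have "((\<lambda>t. (\<Sum>k\<in>K. a k t * b k t) / of_real (c t)) \<longlongrightarrow> 0) F"
  proof (rule Lim_null_comparison)
    show "\<forall>\<^sub>F t in F. norm ((\<Sum>k\<in>K. a k t * b k t) / of_real (c t)) \<le> of_nat (card K) * \<bar>c t\<bar>"
      using le
    proof eventually_elim
      case (elim t)
      have "cmod (a k t * b k t) \<le> \<bar>c t\<bar> * \<bar>c t\<bar>" if "k \<in> K" for k
        unfolding norm_mult using elim that
        by (intro mult_mono) (auto intro: order_trans[OF _ abs_ge_self])
      then have "cmod (\<Sum>k\<in>K. a k t * b k t) \<le> of_nat (card K) * (\<bar>c t\<bar> * \<bar>c t\<bar>)"
        by (rule sum_norm_bound)
      then show ?case
        \<comment> \<open>At c t = 0 the quotient is 0 by the convention on division, so the bound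
          holds there as well.\<close>
        by (cases "c t = 0") (auto simp: norm_divide divide_simps mult.assoc)
    qed
    show "((\<lambda>t. real (card K) * \<bar>c t\<bar>) \<longlongrightarrow> 0) F"
      using tendsto_mult_right_zero[OF tendsto_rabs_zero] c True by blast
  qed
  then show ?thesis using True by simp
next
  case False
  then show ?thesis
    using a b c by (intro tendsto_intros) auto
qed

section \<open>Local structure of proper groupoids with etale source map\<close>

text \<open>The topological content of an orbifold groupoid: charts of the objects are replaced by
  local compactness, and the etale condition by the source map being a local homeomorphism.\<close>

locale proper_etale_groupoid =
  fixes G :: "('a, 'o, 'm) groupoid_scheme" (structure)
  assumes proper: "proper_groupoid G"
    and etale: "\<And>g. g \<in> topspace (Arr G) \<Longrightarrow>
      \<exists>B. openin (Arr G) B \<and> g \<in> B \<and> openin (Obj G) (src G ` B) \<and>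
        homeomorphic_map (subtopology (Arr G) B) (subtopology (Obj G) (src G ` B)) (src G)"
    and locally_compact: "locally_compact_space (Obj G)"
    and second_countable: "second_countable (Obj G)"
begin

abbreviation "Ar \<equiv> topspace (Arr G)"
abbreviation "Ob \<equiv> topspace (Obj G)"
abbreviation "s \<equiv> src G"
abbreviation "t \<equiv> tgt G"
abbreviation "\<mu> \<equiv> mlt G"
abbreviation "\<iota> \<equiv> ginv G"

lemma topological: "topological_groupoid G" and Hausdorff_Arr: "Hausdorff_space (Arr G)"
  using proper by (auto simp: proper_groupoid_def)

lemma Hausdorff_Obj: "Hausdorff_space (Obj G)"
  and cont_t: "continuous_map (Arr G) (Obj G) t"
  and cont_\<mu>: "continuous_map (fibre_product (Arr G) s (Arr G) t) (Arr G) (\<lambda>(g, h). \<mu> g h)"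
  and cont_\<iota>: "continuous_map (Arr G) (Arr G) \<iota>"
  using topological by (auto simp: topological_groupoid_def)

lemma axioms: "groupoid_axioms G"
  using topological by (auto simp: topological_groupoid_def)

lemma s_in [simp]: "g \<in> Ar \<Longrightarrow> s g \<in> Ob" and t_in [simp]: "g \<in> Ar \<Longrightarrow> t g \<in> Ob"
  using axioms by (auto simp: groupoid_axioms_def)

lemma \<mu>_in [simp]: "g \<in> Ar \<Longrightarrow> h \<in> Ar \<Longrightarrow> s g = t h \<Longrightarrow> \<mu> g h \<in> Ar"
  and s_\<mu> [simp]: "g \<in> Ar \<Longrightarrow> h \<in> Ar \<Longrightarrow> s g = t h \<Longrightarrow> s (\<mu> g h) = s h"
  and t_\<mu> [simp]: "g \<in> Ar \<Longrightarrow> h \<in> Ar \<Longrightarrow> s g = t h \<Longrightarrow> t (\<mu> g h) = t g"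
  using axioms by (auto simp: groupoid_axioms_def)

lemma \<mu>_assoc: "g \<in> Ar \<Longrightarrow> h \<in> Ar \<Longrightarrow> k \<in> Ar \<Longrightarrow> s g = t h \<Longrightarrow> s h = t k \<Longrightarrow>
    \<mu> (\<mu> g h) k = \<mu> g (\<mu> h k)"
  using axioms by (simp add: groupoid_axioms_def)

lemma uni_in [simp]: "x \<in> Ob \<Longrightarrow> uni G x \<in> Ar" and s_uni [simp]: "x \<in> Ob \<Longrightarrow> s (uni G x) = x"
  and t_uni [simp]: "x \<in> Ob \<Longrightarrow> t (uni G x) = x"
  using axioms by (simp_all add: groupoid_axioms_def)

lemma \<mu>_uni [simp]: "g \<in> Ar \<Longrightarrow> x = s g \<Longrightarrow> \<mu> g (uni G x) = g"
  and uni_\<mu> [simp]: "g \<in> Ar \<Longrightarrow> x = t g \<Longrightarrow> \<mu> (uni G x) g = g"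
  using axioms by (simp_all add: groupoid_axioms_def)

lemma \<iota>_in [simp]: "g \<in> Ar \<Longrightarrow> \<iota> g \<in> Ar" and s_\<iota> [simp]: "g \<in> Ar \<Longrightarrow> s (\<iota> g) = t g"
  and t_\<iota> [simp]: "g \<in> Ar \<Longrightarrow> t (\<iota> g) = s g"
  and \<mu>_\<iota> [simp]: "g \<in> Ar \<Longrightarrow> \<mu> g (\<iota> g) = uni G (t g)"
  and \<iota>_\<mu> [simp]: "g \<in> Ar \<Longrightarrow> \<mu> (\<iota> g) g = uni G (s g)"
  using axioms by (simp_all add: groupoid_axioms_def)

lemma \<mu>_\<iota>_cancel [simp]: "g \<in> Ar \<Longrightarrow> a \<in> Ar \<Longrightarrow> s g = t a \<Longrightarrow> \<mu> (\<mu> g a) (\<iota> a) = g"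
  by (simp add: \<mu>_assoc)

lemma \<mu>_\<iota>_cancel2 [simp]: "g \<in> Ar \<Longrightarrow> a \<in> Ar \<Longrightarrow> s g = s a \<Longrightarrow> \<mu> (\<mu> g (\<iota> a)) a = g"
  by (simp add: \<mu>_assoc)

lemma \<iota>_\<mu>_cancel [simp]: "g \<in> Ar \<Longrightarrow> a \<in> Ar \<Longrightarrow> s a = t g \<Longrightarrow> \<mu> (\<iota> a) (\<mu> a g) = g"
  by (simp add: \<mu>_assoc[symmetric])

lemma limitin_\<mu>:
  assumes "limitin (Arr G) g g0 F" "limitin (Arr G) h h0 F" "s g0 = t h0" "\<forall>\<^sub>F i in F. s (g i) = t (h i)"
  shows "limitin (Arr G) (\<lambda>i. \<mu> (g i) (h i)) (\<mu> g0 h0) F"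
  using continuous_map_limitin[OF cont_\<mu>, of "\<lambda>i. (g i, h i)" "(g0, h0)" F] assms
  by (simp add: limitin_fibre_product)

lemma limitin_t: "limitin (Arr G) g g0 F \<Longrightarrow> limitin (Obj G) (\<lambda>i. t (g i)) (t g0) F"
  and limitin_\<iota>: "limitin (Arr G) g g0 F \<Longrightarrow> limitin (Arr G) (\<lambda>i. \<iota> (g i)) (\<iota> g0) F"
  by (fact continuous_map_limitin[OF cont_t]
      continuous_map_limitin[OF cont_\<iota>])+

subsection \<open>Local sections of the source map\<close>

text \<open>A condition at the single object y: continuity at y and the section property near y.
  Neighbourhoods are expressed by \<open>eventually\<close>, so no domains of sections have to be
  carried along.\<close>

definition local_section :: "('o \<Rightarrow> 'a) \<Rightarrow> 'o \<Rightarrow> bool" where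
  "local_section \<sigma> y \<longleftrightarrow> y \<in> Ob \<and> limitin (Arr G) \<sigma> (\<sigma> y) (nhdsin (Obj G) y) \<and>
     (\<forall>\<^sub>F x in nhdsin (Obj G) y. s (\<sigma> x) = x)"

text \<open>Invert the source map on a sheet B around g. The last clause records that all arrows
  near g lie on this section, which forces any two sections through g to agree locally.\<close>

lemma local_section_exists:
  assumes g: "g \<in> Ar"
  shows "\<exists>\<sigma>. \<sigma> (s g) = g \<and> (\<forall>\<^sub>F y in nhdsin (Obj G) (s g). local_section \<sigma> y) \<and>
           (\<forall>\<^sub>F h in nhdsin (Arr G) g. \<sigma> (s h) = h)"
proof -
  obtain B where B: "openin (Arr G) B" "g \<in> B" "openin (Obj G) (s ` B)"
    and h: "homeomorphic_map (subtopology (Arr G) B) (subtopology (Obj G) (s ` B)) s"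
    using etale[OF g] by blast
  then obtain \<sigma> where \<sigma>: "homeomorphic_maps (subtopology (Arr G) B) (subtopology (Obj G) (s ` B)) s \<sigma>"
    using homeomorphic_map_maps by blast
  have tB: "topspace (subtopology (Arr G) B) = B" "topspace (subtopology (Obj G) (s ` B)) = s ` B"
    using B openin_subset by fastforce+
  have \<sigma>s: "\<sigma> (s h) = h" if "h \<in> B" for h
    using \<sigma> that unfolding homeomorphic_maps_def tB by blast
  have c: "continuous_map (subtopology (Obj G) (s ` B)) (Arr G) \<sigma>"
    using \<sigma> unfolding homeomorphic_maps_def continuous_map_in_subtopology by blast
  have ls: "local_section \<sigma> y" if y: "y \<in> s ` B" for y
  proof -
    have y': "y \<in> Ob" using y B(3) openin_subset by blast
    have ev: "\<forall>\<^sub>F x in nhdsin (Obj G) y. x \<in> s ` B"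
      using eventually_nhdsin_open[OF B(3) y] .
    have "limitin (subtopology (Obj G) (s ` B)) (\<lambda>x. x) y (nhdsin (Obj G) y)"
      using y ev limitin_ident[OF y'] by (simp add: limitin_subtopology)
    from continuous_map_limitin[OF c this]
    have "limitin (Arr G) \<sigma> (\<sigma> y) (nhdsin (Obj G) y)" .
    moreover have "\<forall>\<^sub>F x in nhdsin (Obj G) y. s (\<sigma> x) = x"
      using ev by eventually_elim (auto simp: \<sigma>s)
    ultimately show ?thesis using y' by (simp add: local_section_def)
  qed
  have "\<forall>\<^sub>F y in nhdsin (Obj G) (s g). y \<in> s ` B"
    using eventually_nhdsin_open[OF B(3)] B(2) by blast
  then have "\<forall>\<^sub>F y in nhdsin (Obj G) (s g). local_section \<sigma> y"
    by eventually_elim (rule ls)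
  moreover have "\<forall>\<^sub>F h in nhdsin (Arr G) g. h \<in> B"
    using eventually_nhdsin_open[OF B(1,2)] .
  then have "\<forall>\<^sub>F h in nhdsin (Arr G) g. \<sigma> (s h) = h"
    by eventually_elim (rule \<sigma>s)
  ultimately show ?thesis using \<sigma>s B(2) by blast
qed

text \<open>\<open>sec g y\<close> continues the arrow g to the source y. It is meaningful for y
  near \<open>s g\<close>; elsewhere the value is arbitrary.\<close>

definition sec :: "'a \<Rightarrow> 'o \<Rightarrow> 'a" where
  "sec g = (SOME \<sigma>. \<sigma> (s g) = g \<and> (\<forall>\<^sub>F y in nhdsin (Obj G) (s g). local_section \<sigma> y) \<and>
           (\<forall>\<^sub>F h in nhdsin (Arr G) g. \<sigma> (s h) = h))"

lemma
  assumes "g \<in> Ar"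
  shows sec_s: "sec g (s g) = g"
    and eventually_local_section_sec: "\<forall>\<^sub>F y in nhdsin (Obj G) (s g). local_section (sec g) y"
    and eventually_sec_eq: "\<forall>\<^sub>F h in nhdsin (Arr G) g. sec g (s h) = h"
  using someI_ex[OF local_section_exists[OF assms]] unfolding sec_def by blast+

lemma local_section_sec: "g \<in> Ar \<Longrightarrow> local_section (sec g) (s g)"
  using eventually_nhdsin_self[OF eventually_local_section_sec] by simp

lemma local_section_in: "local_section \<sigma> y \<Longrightarrow> \<sigma> y \<in> Ar" and local_section_s: "local_section \<sigma> y \<Longrightarrow> s (\<sigma> y) = y"
proof -
  assume *: "local_section \<sigma> y"
  then show "\<sigma> y \<in> Ar"
    using limitin_topspace[of "Arr G" \<sigma> "\<sigma> y" "nhdsin (Obj G) y"] by (simp add: local_section_def)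
  show "s (\<sigma> y) = y"
    using * eventually_nhdsin_self[of "\<lambda>x. s (\<sigma> x) = x" "Obj G" y] by (simp add: local_section_def)
qed

lemma limitin_sec: "g \<in> Ar \<Longrightarrow> limitin (Arr G) (sec g) g (nhdsin (Obj G) (s g))"
  using local_section_sec[of g] sec_s[of g] by (simp add: local_section_def)

lemma limitin_sec': "g \<in> Ar \<Longrightarrow> limitin (Obj G) y (s g) F \<Longrightarrow> limitin (Arr G) (\<lambda>i. sec g (y i)) g F"
  by (rule limitin_compose[OF _ limitin_sec])

lemma eventually_s_sec:
  "g \<in> Ar \<Longrightarrow> limitin (Obj G) y (s g) F \<Longrightarrow> \<forall>\<^sub>F i in F. sec g (y i) \<in> Ar \<and> s (sec g (y i)) = y i"
  using eventually_limitin[OF _ eventually_local_section_sec[of g], of y F]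
  by (auto elim!: eventually_mono simp: local_section_in local_section_s)

lemma limitin_eventually_sec:
  "limitin (Arr G) h g F \<Longrightarrow> \<forall>\<^sub>F i in F. sec g (s (h i)) = h i"
  by (rule eventually_limitin[OF _ eventually_sec_eq[OF limitin_topspace]])

lemma limitin_eventually_sec':
  "limitin (Arr G) h g F \<Longrightarrow> \<forall>\<^sub>F i in F. s (h i) = y i \<Longrightarrow> \<forall>\<^sub>F i in F. sec g (y i) = h i"
  by (drule limitin_eventually_sec, erule (1) eventually_elim2) auto

text \<open>For x near y the arrow \<sigma> x is close to \<sigma> y, hence lies on the section
  \<open>sec (\<sigma> y)\<close>: the germ of a section is determined by one arrow.\<close>

lemma local_section_eq_sec:
  assumes "local_section \<sigma> y"
  shows "\<forall>\<^sub>F x in nhdsin (Obj G) y. sec (\<sigma> y) x = \<sigma> x"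
  by (rule limitin_eventually_sec') (use assms in \<open>auto simp: local_section_def\<close>)

text \<open>As the space of arrows is Hausdorff, the two continuations stay in disjoint
  neighbourhoods; otherwise distinct arrows could merge nearby.\<close>

lemma sec_separated:
  assumes "g \<in> Ar" "h \<in> Ar" "s g = x" "s h = x" "g \<noteq> h"
  shows "\<forall>\<^sub>F y in nhdsin (Obj G) x. sec g y \<noteq> sec h y"
proof -
  obtain U V where "openin (Arr G) U" "openin (Arr G) V" "g \<in> U" "h \<in> V" and d: "disjnt U V"
    using Hausdorff_Arr assms by (metis Hausdorff_space_def)
  then have "\<forall>\<^sub>F y in nhdsin (Obj G) x. sec g y \<in> U" "\<forall>\<^sub>F y in nhdsin (Obj G) x. sec h y \<in> V"
    using limitin_sec limitinD assms by metis+
  then show ?thesis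
    by eventually_elim (use d in \<open>auto simp: disjnt_iff\<close>)
qed

lemma eventually_inj_on_sec:
  assumes "finite A" "\<And>g. g \<in> A \<Longrightarrow> g \<in> Ar \<and> s g = x"
  shows "\<forall>\<^sub>F y in nhdsin (Obj G) x. inj_on (\<lambda>g. sec g y) A"
proof -
  have "\<forall>\<^sub>F y in nhdsin (Obj G) x. \<forall>p \<in> A \<times> A. fst p \<noteq> snd p \<longrightarrow> sec (fst p) y \<noteq> sec (snd p) y"
    using assms by (intro eventually_ball_finite) (auto intro!: sec_separated simp: eventually_conj_iff)
  then show ?thesis
    by eventually_elim (auto simp: inj_on_def)
qed

subsection \<open>Arrows into a fixed set\<close>

definition Fib :: "'o set \<Rightarrow> 'o \<Rightarrow> 'a set" where
  "Fib V x = {g \<in> Ar. s g = x \<and> t g \<in> V}"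

lemma FibD: "g \<in> Fib V x \<Longrightarrow> g \<in> Ar" "g \<in> Fib V x \<Longrightarrow> s g = x" "g \<in> Fib V x \<Longrightarrow> t g \<in> V"
  by (auto simp: Fib_def)

text \<open>Right translation, with translation by the inverse arrow as its inverse. Invariance of
  counts and weights and the action on frames all come from here.\<close>

lemma bij_betw_Fib_\<mu>:
  assumes "b \<in> Ar"
  shows "bij_betw (\<lambda>g. \<mu> g b) (Fib V (t b)) (Fib V (s b))"
  by (rule bij_betw_byWitness[where f' = "\<lambda>g. \<mu> g (\<iota> b)"]) (use assms in \<open>auto simp: Fib_def\<close>)

lemma ex_open_sec_eq:
  assumes "g \<in> Ar"
  shows "\<exists>B. openin (Arr G) B \<and> g \<in> B \<and> (\<forall>h\<in>B. sec g (s h) = h)"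
  using eventually_sec_eq[OF assms] assms by (auto simp: eventually_nhdsin)

text \<open>By properness the arrows from x into C form a compact set. Each sheet of the source map
  contains at most one arrow with source x, so a finite subcover by sheets leaves finitely many
  arrows.\<close>

lemma finite_Fib_compact:
  assumes C: "compactin (Obj G) C" and x: "x \<in> Ob"
  shows "finite (Fib C x)"
proof -
  obtain B where B: "\<And>g. g \<in> Ar \<Longrightarrow> openin (Arr G) (B g) \<and> g \<in> B g \<and> (\<forall>h\<in>B g. sec g (s h) = h)"
    using ex_open_sec_eq by metis
  have "compactin (prod_topology (Obj G) (Obj G)) ({x} \<times> C)"
    using C x by (simp add: compactin_Times)
  moreover have "proper_map (Arr G) (prod_topology (Obj G) (Obj G)) (\<lambda>g. (s g, t g))"
    using proper by (simp add: proper_groupoid_def)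
  ultimately have "compactin (Arr G) {g \<in> Ar. (s g, t g) \<in> {x} \<times> C}"
    by (rule compactin_proper_map_preimage[rotated])
  also have "{g \<in> Ar. (s g, t g) \<in> {x} \<times> C} = Fib C x"
    by (auto simp: Fib_def)
  finally have c: "compactin (Arr G) (Fib C x)" .
  have "\<forall>U\<in>B ` Fib C x. openin (Arr G) U" "Fib C x \<subseteq> \<Union>(B ` Fib C x)"
    using B FibD by blast+
  then obtain \<F> where \<F>: "finite \<F>" "\<F> \<subseteq> B ` Fib C x" "Fib C x \<subseteq> \<Union>\<F>"
    using c unfolding compactin_def by meson
  then obtain A where A: "finite A" "A \<subseteq> Fib C x" "\<F> = B ` A"
    by (meson finite_subset_image)
  have "Fib C x \<subseteq> A"
  proof
    fix h assume h: "h \<in> Fib C x"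
    then obtain g where g: "g \<in> A" "h \<in> B g" using \<F>(3) A(3) by blast
    then have g': "g \<in> Ar" "s g = x" using A(2) FibD by blast+
    then have "h = sec g x" using B g h FibD(2) by metis
    also have "\<dots> = g" using g' sec_s by blast
    finally show "h \<in> A" using g by simp
  qed
  then show ?thesis using A(1) finite_subset by blast
qed

text \<open>No arrow into C appears near x unless it continues one at x. The arrows into C that
  avoid the sheets through \<open>Fib C x\<close> have closed image in \<open>Ob \<times> C\<close>
  by properness; projection along the compact C is closed, so their sources stay away from
  x.\<close>

lemma eventually_Fib_subset:
  assumes C: "compactin (Obj G) C" and x: "x \<in> Ob"
  shows "\<forall>\<^sub>F y in nhdsin (Obj G) x. Fib C y \<subseteq> (\<lambda>g. sec g y) ` Fib C x"
proof -
  obtain B where B: "\<And>g. g \<in> Ar \<Longrightarrow> openin (Arr G) (B g) \<and> g \<in> B g \<and> (\<forall>h\<in>B g. sec g (s h) = h)"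
    using ex_open_sec_eq by metis
  define Z where "Z = {h \<in> Ar. t h \<in> C} - (\<Union>g\<in>Fib C x. B g)"
  define I where "I = (\<lambda>g. (s g, t g)) ` Z"
  have "closedin (Obj G) C"
    using C Hausdorff_Obj compactin_imp_closedin by blast
  then have "closedin (Arr G) {h \<in> Ar. t h \<in> C}"
    using cont_t closedin_continuous_map_preimage by blast
  moreover have "openin (Arr G) (\<Union>g\<in>Fib C x. B g)"
    using B FibD by blast
  ultimately have Z: "closedin (Arr G) Z"
    unfolding Z_def by (rule closedin_diff)
  have "closed_map (Arr G) (prod_topology (Obj G) (Obj G)) (\<lambda>g. (s g, t g))"
    using proper by (simp add: proper_groupoid_def proper_imp_closed_map)
  then have I: "closedin (prod_topology (Obj G) (Obj G)) I"
    using Z unfolding I_def closed_map_def by blast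
  have "I \<subseteq> Ob \<times> C"
    by (auto simp: I_def Z_def)
  then have "closedin (subtopology (prod_topology (Obj G) (Obj G)) (Ob \<times> C)) I"
    using I closedin_subset_topspace by blast
  also have "subtopology (prod_topology (Obj G) (Obj G)) (Ob \<times> C) = prod_topology (Obj G) (subtopology (Obj G) C)"
    by (simp add: prod_topology_subtopology)
  finally have "closedin (Obj G) (fst ` I)"
    using closed_map_fst[of "subtopology (Obj G) C" "Obj G"] C
    by (simp add: closed_map_def compact_space_subtopology)
  moreover have "x \<notin> fst ` I"
    using B by (auto simp: I_def Z_def Fib_def)
  ultimately have "\<forall>\<^sub>F y in nhdsin (Obj G) x. y \<in> Ob - fst ` I"
    using x by (intro eventually_nhdsin_open) auto
  then show ?thesis
  proof eventually_elim
    case (elim y)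
    show ?case
    proof
      fix h assume h: "h \<in> Fib C y"
      have "h \<notin> Z"
      proof
        assume "h \<in> Z"
        then have "fst (s h, t h) \<in> fst ` I" unfolding I_def by (intro imageI)
        then show False using elim h by (simp add: Fib_def)
      qed
      then obtain g where "g \<in> Fib C x" "h \<in> B g"
        using h by (auto simp: Z_def Fib_def)
      then show "h \<in> (\<lambda>g. sec g y) ` Fib C x"
        using B h FibD by (metis imageI)
    qed
  qed
qed

lemma finite_isotropy:
  assumes "x \<in> Ob" shows "finite {g \<in> Ar. s g = x \<and> t g = x}"
  using finite_Fib_compact[of "{x}" x] assms by (simp add: Fib_def)

text \<open>The analogue of an evenly covered point of a covering: near x the arrows into V are the
  continuations of the n arrows at x, each obtained once.\<close>

definition evenly_hit :: "'o set \<Rightarrow> nat \<Rightarrow> 'o \<Rightarrow> bool" where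
  "evenly_hit V n x \<longleftrightarrow> x \<in> Ob \<and> finite (Fib V x) \<and> card (Fib V x) = n \<and>
     (\<forall>\<^sub>F y in nhdsin (Obj G) x. bij_betw (\<lambda>g. sec g y) (Fib V x) (Fib V y))"

text \<open>Choose \<open>V\<close> around \<open>x\<close> so small that the only arrows from \<open>x\<close> to the closure of \<open>V\<close>
  are the isotropy arrows: then no arrow can enter or leave through the boundary of \<open>V\<close>.\<close>

lemma evenly_hit_exists:
  assumes x: "x \<in> Ob"
  shows "\<exists>V n. openin (Obj G) V \<and> n \<ge> 1 \<and> evenly_hit V n x"
proof -
  obtain O1 C1 where 1: "openin (Obj G) O1" "compactin (Obj G) C1" "x \<in> O1" "O1 \<subseteq> C1"
    using locally_compact x unfolding locally_compact_space_def by metis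
  \<comment> \<open>The finitely many objects of C1 other than x that an arrow from x reaches;
    removing them leaves only isotropy arrows at x.\<close>
  define T where "T = t ` Fib C1 x - {x}"
  have T: "finite T" "T \<subseteq> Ob"
    using finite_Fib_compact[OF 1(2) x] FibD(1) by (auto simp: T_def)
  then have "closedin (Obj G) T"
    using Hausdorff_Obj Hausdorff_imp_t1_space t1_space_closedin_finite by metis
  then have "openin (Obj G) (O1 - T)"
    using 1 by blast
  moreover have "x \<in> O1 - T"
    using 1 by (simp add: T_def)
  moreover have "neighbourhood_base_of (\<lambda>C. compactin (Obj G) C) (Obj G)"
    using locally_compact Hausdorff_Obj locally_compact_space_neighbourhood_base by blast
  ultimately obtain V C where V: "openin (Obj G) V" "compactin (Obj G) C" "x \<in> V" "V \<subseteq> C" "C \<subseteq> O1 - T"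
    unfolding neighbourhood_base_of by meson
  have tx: "t g = x" if "g \<in> Fib C x" for g
    using that V(5) 1(4) unfolding T_def Fib_def by blast
  \<comment> \<open>Openness of V keeps continued arrows in V, compactness of C excludes new ones;
    since the two fibres over x coincide, these bounds meet.\<close>
  have CV: "Fib C x = Fib V x"
  proof
    show "Fib C x \<subseteq> Fib V x"
    proof
      fix g assume g: "g \<in> Fib C x"
      show "g \<in> Fib V x"
        using g tx[OF g] V(3) by (simp add: Fib_def)
    qed
    show "Fib V x \<subseteq> Fib C x"
      using V(4) by (auto simp: Fib_def)
  qed
  have fin: "finite (Fib V x)"
    using finite_Fib_compact[OF V(2) x] CV by simp
  have "\<forall>\<^sub>F y in nhdsin (Obj G) x. \<forall>g \<in> Fib V x. sec g y \<in> Fib V y"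
  proof (rule eventually_ball_finite[OF fin], rule ballI)
    fix g assume g: "g \<in> Fib V x"
    then have g': "g \<in> Ar" "s g = x" "t g \<in> V" by (simp_all add: Fib_def)
    have "\<forall>\<^sub>F h in nhdsin (Arr G) g. t h \<in> V"
      using limitinD[OF limitin_t[OF limitin_ident[OF g'(1)]] V(1) g'(3)] .
    then have "\<forall>\<^sub>F y in nhdsin (Obj G) x. t (sec g y) \<in> V"
      using eventually_limitin[OF limitin_sec[OF g'(1)]] g'(2) by simp
    moreover have "\<forall>\<^sub>F y in nhdsin (Obj G) x. sec g y \<in> Ar \<and> s (sec g y) = y"
      using eventually_s_sec[OF g'(1)] limitin_ident[OF x] g'(2) by simp
    ultimately show "\<forall>\<^sub>F y in nhdsin (Obj G) x. sec g y \<in> Fib V y"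
      by eventually_elim (simp add: Fib_def)
  qed
  moreover have "\<forall>\<^sub>F y in nhdsin (Obj G) x. inj_on (\<lambda>g. sec g y) (Fib V x)"
    using fin by (rule eventually_inj_on_sec) (auto simp: Fib_def)
  moreover note eventually_Fib_subset[OF V(2) x, unfolded CV]
  ultimately have "\<forall>\<^sub>F y in nhdsin (Obj G) x. bij_betw (\<lambda>g. sec g y) (Fib V x) (Fib V y)"
  proof eventually_elim
    case (elim y)
    have "Fib V y \<subseteq> Fib C y" using V(4) by (auto simp: Fib_def)
    then show ?case using elim unfolding bij_betw_def by blast
  qed
  moreover have "uni G x \<in> Fib V x" using x V(3) by (simp add: Fib_def)
  then have "card (Fib V x) \<ge> 1" using fin by (metis One_nat_def Suc_leI card_gt_0_iff empty_iff)
  ultimately show ?thesis using V(1) x fin unfolding evenly_hit_def by blast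
qed

text \<open>Continuing from x to y and then to z is the same as continuing directly to z, so the
  bijection from \<open>Fib V x\<close> to \<open>Fib V z\<close> factors through
  \<open>Fib V y\<close>.\<close>

lemma eventually_evenly_hit:
  assumes "evenly_hit V n x"
  shows "\<forall>\<^sub>F y in nhdsin (Obj G) x. evenly_hit V n y"
proof -
  have x: "x \<in> Ob" and fin: "finite (Fib V x)" and card: "card (Fib V x) = n"
    and bij: "\<forall>\<^sub>F y in nhdsin (Obj G) x. bij_betw (\<lambda>g. sec g y) (Fib V x) (Fib V y)"
    using assms by (auto simp: evenly_hit_def)
  have "\<forall>\<^sub>F y in nhdsin (Obj G) x. \<forall>g\<in>Fib V x. local_section (sec g) y"
    using eventually_local_section_sec FibD by (intro eventually_ball_finite[OF fin]) metis
  with bij eventually_nhdsin_nhdsin[OF bij] eventually_in_topspace_nhdsin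
  show ?thesis
  proof eventually_elim
    case (elim y)
    have "\<forall>\<^sub>F z in nhdsin (Obj G) y. \<forall>g\<in>Fib V x. sec (sec g y) z = sec g z"
      using elim local_section_eq_sec by (intro eventually_ball_finite[OF fin]) blast
    with elim(2) have "\<forall>\<^sub>F z in nhdsin (Obj G) y. bij_betw (\<lambda>h. sec h z) (Fib V y) (Fib V z)"
    proof eventually_elim
      case (elim z)
      have "bij_betw ((\<lambda>h. sec h z) \<circ> (\<lambda>g. sec g y)) (Fib V x) (Fib V z)"
        using elim by (subst bij_betw_cong[where g = "\<lambda>g. sec g z"]) auto
      then show ?case
        using bij_betw_comp_iff[OF \<open>bij_betw (\<lambda>g. sec g y) (Fib V x) (Fib V y)\<close>] by blast
    qed
    then show ?case
      using elim bij_betw_finite[OF elim(1)] bij_betw_same_card[OF elim(1)] fin card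
      by (simp add: evenly_hit_def)
  qed
qed

text \<open>Continue b together with its source: right translation by the continued arrow identifies
  the fibres near \<open>t b\<close> with those near \<open>s b\<close> and is compatible with
  continuation.\<close>

lemma evenly_hit_invariant:
  assumes e: "evenly_hit V n (t b)" and b: "b \<in> Ar"
  shows "evenly_hit V n (s b)"
proof -
  have fin: "finite (Fib V (t b))" and card: "card (Fib V (t b)) = n"
    and bij: "\<forall>\<^sub>F y in nhdsin (Obj G) (t b). bij_betw (\<lambda>g. sec g y) (Fib V (t b)) (Fib V y)"
    using e by (auto simp: evenly_hit_def)
  note bb = bij_betw_Fib_\<mu>[OF b, of V]
  let ?z = "s b"
  let ?F = "nhdsin (Obj G) ?z"
  let ?x = "\<lambda>z. t (sec b z)"
  have lx: "limitin (Obj G) ?x (t b) ?F"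
    using limitin_t[OF limitin_sec[OF b]] .
  have sb: "\<forall>\<^sub>F z in ?F. sec b z \<in> Ar \<and> s (sec b z) = z"
    using eventually_s_sec[OF b limitin_ident] b by simp
  \<comment> \<open>Both sides continue the product of g and b, so uniqueness of germs identifies
    them.\<close>
  have "\<forall>\<^sub>F z in ?F. \<forall>g\<in>Fib V (t b). sec (\<mu> g b) z = \<mu> (sec g (?x z)) (sec b z)"
  proof (rule eventually_ball_finite[OF fin], rule ballI)
    fix g assume "g \<in> Fib V (t b)"
    then have g: "g \<in> Ar" "s g = t b" by (auto simp: Fib_def)
    have lx': "limitin (Obj G) ?x (s g) ?F" using lx g by simp
    note sg = eventually_s_sec[OF g(1) lx']
    have "limitin (Arr G) (\<lambda>z. \<mu> (sec g (?x z)) (sec b z)) (\<mu> g b) ?F"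
      by (rule limitin_\<mu>[OF limitin_sec'[OF g(1) lx'] limitin_sec[OF b] g(2)])
        (use sg in \<open>eventually_elim, simp\<close>)
    moreover have "\<forall>\<^sub>F z in ?F. s (\<mu> (sec g (?x z)) (sec b z)) = z"
      using sg sb by eventually_elim simp
    ultimately show "\<forall>\<^sub>F z in ?F. sec (\<mu> g b) z = \<mu> (sec g (?x z)) (sec b z)"
      by (rule limitin_eventually_sec')
  qed
  with sb eventually_limitin[OF lx bij]
  have "\<forall>\<^sub>F z in ?F. bij_betw (\<lambda>h. sec h z) (Fib V ?z) (Fib V z)"
  proof eventually_elim
    case (elim z)
    have "bij_betw (\<lambda>g. \<mu> g (sec b z)) (Fib V (?x z)) (Fib V z)"
      using bij_betw_Fib_\<mu>[of "sec b z" V] elim by simp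
    from bij_betw_trans[OF elim(2) this]
    have "bij_betw ((\<lambda>h. sec h z) \<circ> (\<lambda>g. \<mu> g b)) (Fib V (t b)) (Fib V z)"
      using elim(3) by (subst bij_betw_cong[where g = "(\<lambda>g. \<mu> g (sec b z)) \<circ> (\<lambda>g. sec g (?x z))"]) auto
    then show ?case using bij_betw_comp_iff[OF bb] by blast
  qed
  then show ?thesis
    using bij_betw_finite[OF bb] bij_betw_same_card[OF bb] fin card b by (simp add: evenly_hit_def)
qed

section \<open>Invariant weights and a point-finite cover\<close>

text \<open>A function c vanishing outside a compact C is summed over the arrows from y into C,
  evaluated at their targets; properness makes the sum finite. Right translation of arrows makes it
  invariant, and truncation at 1 bounds it.\<close>

lemma invariant_bump:
  assumes x: "x \<in> N" and N: "openin (Obj G) N"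
  shows "\<exists>f. continuous_map (Obj G) euclideanreal f \<and> (\<forall>y\<in>Ob. 0 \<le> f y \<and> f y \<le> 1) \<and>
     (\<forall>g\<in>Ar. f (s g) = f (t g)) \<and> f x > 0 \<and> (\<forall>y\<in>Ob. f y > 0 \<longrightarrow> (\<exists>g\<in>Ar. s g = y \<and> t g \<in> N))"
proof -
  have xO: "x \<in> Ob" using x N openin_subset by blast
  have "neighbourhood_base_of (\<lambda>C. compactin (Obj G) C) (Obj G)"
    using locally_compact Hausdorff_Obj locally_compact_space_neighbourhood_base by blast
  then obtain W C where W: "openin (Obj G) W" "compactin (Obj G) C" "x \<in> W" "W \<subseteq> C" "C \<subseteq> N"
    using x N unfolding neighbourhood_base_of by meson
  have "completely_regular_space (Obj G)"
    using locally_compact_regular_imp_completely_regular_space locally_compact Hausdorff_Obj by blast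
  moreover have "closedin (Obj G) (Ob - W)" "x \<in> Ob - (Ob - W)"
    using W xO by auto
  ultimately obtain k :: "'o \<Rightarrow> real" where k: "continuous_map (Obj G) (top_of_set {0..1}) k"
    "k x = 0" "k ` (Ob - W) \<subseteq> {1}"
    unfolding completely_regular_space_def by meson
  define c where "c y = 1 - k y" for y
  have kc: "continuous_map (Obj G) euclideanreal k" and k01: "\<And>y. y \<in> Ob \<Longrightarrow> k y \<in> {0..1}"
    using k(1) by (auto simp: continuous_map_in_subtopology)
  have c: "continuous_map (Obj G) euclideanreal c"
    unfolding c_def by (intro continuous_intros kc) auto
  have c0: "c y \<ge> 0" if "y \<in> Ob" for y using k01[OF that] by (simp add: c_def)
  have cC: "c y = 0" if "y \<in> Ob" "y \<notin> C" for y using k(3) that W(4) by (auto simp: c_def)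
  define F where "F y = (\<Sum>g\<in>Fib C y. c (t g))" for y
  have F0: "F y \<ge> 0" if "y \<in> Ob" for y
    unfolding F_def using c0 by (intro sum_nonneg) (auto simp: Fib_def)
  have inv: "F (s g) = F (t g)" if g: "g \<in> Ar" for g
  proof -
    have "F (s g) = (\<Sum>h\<in>Fib C (t g). c (t (\<mu> h g)))"
      unfolding F_def by (rule sum.reindex_bij_betw[OF bij_betw_Fib_\<mu>[OF g], symmetric])
    also have "\<dots> = F (t g)"
      unfolding F_def using g by (intro sum.cong) (auto simp: Fib_def)
    finally show ?thesis .
  qed
  have cont: "continuous_map (Obj G) euclideanreal F"
    unfolding continuous_map_nhdsin limitin_canonical_iff
  proof
    fix y assume y: "y \<in> Ob"
    let ?A = "Fib C y"
    have fin: "finite ?A" using finite_Fib_compact[OF W(2) y] .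
    have "((\<lambda>z. \<Sum>g\<in>?A. c (t (sec g z))) \<longlongrightarrow> (\<Sum>g\<in>?A. c (t g))) (nhdsin (Obj G) y)"
    proof (rule tendsto_sum)
      fix g assume "g \<in> ?A"
      then have "g \<in> Ar" "s g = y" by (auto simp: Fib_def)
      then show "((\<lambda>z. c (t (sec g z))) \<longlongrightarrow> c (t g)) (nhdsin (Obj G) y)"
        using continuous_map_limitin[OF c limitin_t[OF limitin_sec]] by fastforce
    qed
    moreover have "\<forall>\<^sub>F z in nhdsin (Obj G) y. (\<Sum>g\<in>?A. c (t (sec g z))) = F z"
    proof -
      have "\<forall>\<^sub>F z in nhdsin (Obj G) y. \<forall>g\<in>?A. sec g z \<in> Ar \<and> s (sec g z) = z"
      proof (rule eventually_ball_finite[OF fin], rule ballI)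
        fix g assume "g \<in> ?A"
        then show "\<forall>\<^sub>F z in nhdsin (Obj G) y. sec g z \<in> Ar \<and> s (sec g z) = z"
          using eventually_s_sec[of g "\<lambda>z. z" "nhdsin (Obj G) y"] limitin_ident[OF y] by (simp add: Fib_def)
      qed
      moreover have "\<forall>\<^sub>F z in nhdsin (Obj G) y. inj_on (\<lambda>g. sec g z) ?A"
        using fin by (rule eventually_inj_on_sec) (auto simp: Fib_def)
      moreover note eventually_Fib_subset[OF W(2) y]
      ultimately show ?thesis
      proof eventually_elim
        case (elim z)
        have "(\<Sum>g\<in>?A. c (t (sec g z))) = (\<Sum>h\<in>(\<lambda>g. sec g z) ` ?A. c (t h))"
          using elim by (simp add: sum.reindex)
        also have "\<dots> = F z"
          unfolding F_def
        \<comment> \<open>Continued arrows that have left C contribute 0, and no others enter C by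
          \<open>eventually_Fib_subset\<close>; the sum over continuations is therefore F.\<close>
        proof (rule sum.mono_neutral_right)
          show "\<forall>h\<in>(\<lambda>g. sec g z) ` ?A - Fib C z. c (t h) = 0"
          proof
            fix h assume h: "h \<in> (\<lambda>g. sec g z) ` ?A - Fib C z"
            then obtain g where "g \<in> ?A" "h = sec g z" by blast
            then have "h \<in> Ar \<and> s h = z" using elim(1) by simp
            then show "c (t h) = 0" using h cC by (simp add: Fib_def)
          qed
        qed (use fin elim in auto)
        finally show ?case .
      qed
    qed
    ultimately show "(F \<longlongrightarrow> F y) (nhdsin (Obj G) y)"
      unfolding F_def[of y] by (rule Lim_transform_eventually)
  qed
  define f where "f y = min 1 (F y)" for y
  have "continuous_map (Obj G) euclideanreal f"
    unfolding f_def using cont by (intro continuous_map_real_min) auto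
  moreover have "f x > 0"
  proof -
    have u: "uni G x \<in> Fib C x" using W xO by (auto simp: Fib_def)
    have "c (t (uni G x)) \<le> F x"
      unfolding F_def using c0 finite_Fib_compact[OF W(2) xO] u by (intro member_le_sum) (auto simp: Fib_def)
    then show ?thesis using xO k(2) by (simp add: f_def c_def)
  qed
  moreover have "\<exists>g\<in>Ar. s g = y \<and> t g \<in> N" if "y \<in> Ob" "f y > 0" for y
  proof -
    have "Fib C y \<noteq> {}" using that by (auto simp: f_def F_def)
    then show ?thesis using W(5) by (auto simp: Fib_def)
  qed
  ultimately show ?thesis using F0 inv by (intro exI[of _ f]) (auto simp: f_def)
qed

text \<open>If the invariant function is positive at y, some arrow leads from y into the
  neighbourhood on which V is evenly hit, and this property passes back along the arrow. Second
  countability then reduces the family to a sequence.\<close>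

lemma evenly_hit_cover:
  "\<exists>V n f. \<forall>i::nat. openin (Obj G) (V i) \<and> n i \<ge> 1 \<and> continuous_map (Obj G) euclideanreal (f i) \<and>
     (\<forall>y\<in>Ob. 0 \<le> f i y \<and> f i y \<le> 1) \<and> (\<forall>g\<in>Ar. f i (s g) = f i (t g)) \<and>
     (\<forall>y\<in>Ob. f i y > 0 \<longrightarrow> evenly_hit (V i) (n i) y) \<and> (\<forall>x\<in>Ob. \<exists>i. f i x > 0)"
proof -
  let ?good = "\<lambda>V n f. openin (Obj G) V \<and> n \<ge> 1 \<and> continuous_map (Obj G) euclideanreal f \<and>
     (\<forall>y\<in>Ob. 0 \<le> f y \<and> f y \<le> 1) \<and> (\<forall>g\<in>Ar. f (s g) = f (t g)) \<and>
     (\<forall>y\<in>Ob. f y > 0 \<longrightarrow> evenly_hit V n y)"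
  have "\<exists>V n f. ?good V n f \<and> f x > (0::real)" if x: "x \<in> Ob" for x
  proof -
    obtain V n where V: "openin (Obj G) V" "n \<ge> 1" "evenly_hit V n x"
      using evenly_hit_exists[OF x] by blast
    obtain N where N: "openin (Obj G) N" "x \<in> N" "\<forall>y\<in>N. evenly_hit V n y"
      using eventually_evenly_hit[OF V(3)] x unfolding eventually_nhdsin by blast
    obtain f where f: "continuous_map (Obj G) euclideanreal f" "\<forall>y\<in>Ob. 0 \<le> f y \<and> f y \<le> 1"
      "\<forall>g\<in>Ar. f (s g) = f (t g)" "f x > 0" "\<forall>y\<in>Ob. f y > 0 \<longrightarrow> (\<exists>g\<in>Ar. s g = y \<and> t g \<in> N)"
      using invariant_bump[OF N(2,1)] by blast
    have "\<forall>y\<in>Ob. f y > 0 \<longrightarrow> evenly_hit V n y"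
      using f(5) N(3) evenly_hit_invariant by blast
    then show ?thesis using V f by blast
  qed
  then obtain V n f where g: "\<And>x. x \<in> Ob \<Longrightarrow> ?good (V x) (n x) (f x) \<and> f x x > 0"
    by metis
  define W where "W x = {y \<in> Ob. f x y > 0}" for x
  have "\<forall>U\<in>W ` Ob. openin (Obj G) U"
  proof
    fix U assume "U \<in> W ` Ob"
    then obtain x where x: "x \<in> Ob" "U = W x" by blast
    have "openin (Obj G) {y \<in> Ob. f x y \<in> {0<..}}"
      using g[OF x(1)] by (intro openin_continuous_map_preimage) auto
    then show "openin (Obj G) U" using x by (simp add: W_def)
  qed
  moreover have "\<Union>(W ` Ob) = Ob" using g by (auto simp: W_def)
  ultimately obtain \<V> where \<V>: "countable \<V>" "\<V> \<subseteq> W ` Ob" "\<Union>\<V> = Ob"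
    using second_countable_imp_Lindelof_space[OF second_countable] unfolding Lindelof_space_def by metis
  then obtain D where D: "countable D" "D \<subseteq> Ob" "\<V> = W ` D"
    by (metis countable_subset_image)
  show ?thesis
  proof (cases "D = {}")
    case True
    then have "Ob = {}" using \<V> D by auto
    moreover from this have "Ar = {}" using s_in by blast
    ultimately show ?thesis
      by (intro exI[of _ "\<lambda>_. {}"] exI[of _ "\<lambda>_. 1"] exI[of _ "\<lambda>_ _. 0"]) auto
  next
    case False
    define d where "d = from_nat_into D"
    have r: "range d = D" using range_from_nat_into[OF False D(1)] by (simp add: d_def)
    have "\<exists>i. f (d i) x > 0" if x: "x \<in> Ob" for x
    proof -
      obtain y where "y \<in> D" "x \<in> W y" using x \<V>(3) D(3) by blast
      then show ?thesis using r by (auto simp: W_def)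
    qed
    moreover have "d i \<in> Ob" for i using r D(2) by blast
    ultimately show ?thesis
      using g by (intro exI[of _ "\<lambda>i. V (d i)"] exI[of _ "\<lambda>i. n (d i)"] exI[of _ "\<lambda>i. f (d i)"]) blast
  qed
qed

text \<open>Subtracting multiples of the preceding functions makes the family point-finite without
  losing the covering property (M. Mather's trick).\<close>

lemma point_finite_evenly_hit_cover:
  "\<exists>V n f. (\<forall>i::nat. openin (Obj G) (V i) \<and> n i \<ge> 1 \<and> continuous_map (Obj G) euclideanreal (f i) \<and>
     (\<forall>y\<in>Ob. 0 \<le> f i y \<and> f i y \<le> 1) \<and> (\<forall>g\<in>Ar. f i (s g) = f i (t g)) \<and>
     (\<forall>y\<in>Ob. f i y > 0 \<longrightarrow> evenly_hit (V i) (n i) y)) \<and>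
     (\<forall>x\<in>Ob. (\<exists>i. f i x > 0) \<and> finite {i. f i x \<noteq> 0})"
proof -
  obtain V n f where f: "\<forall>i::nat. openin (Obj G) (V i) \<and> n i \<ge> 1 \<and> continuous_map (Obj G) euclideanreal (f i) \<and>
     (\<forall>y\<in>Ob. 0 \<le> f i y \<and> f i y \<le> 1) \<and> (\<forall>g\<in>Ar. f i (s g) = f i (t g)) \<and>
     (\<forall>y\<in>Ob. f i y > 0 \<longrightarrow> evenly_hit (V i) (n i) y) \<and> (\<forall>x\<in>Ob. \<exists>i. f i x > 0)"
    using evenly_hit_cover by blast
  define h where "h i x = max 0 (f i x - real i * (\<Sum>j<i. f j x))" for i x
  have S0: "(\<Sum>j<i. f j x) \<ge> 0" if "x \<in> Ob" for i x
    using f that by (intro sum_nonneg) blast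
  have le: "h i x \<le> f i x" if "x \<in> Ob" for i x
    using f that S0[OF that, of i] by (auto simp: h_def)
  have "continuous_map (Obj G) euclideanreal (h i)" for i
    unfolding h_def using f by (intro continuous_intros continuous_map_real_max continuous_map_sum) auto
  moreover have "h i (s g) = h i (t g)" if "g \<in> Ar" for i g
    using f that by (simp add: h_def)
  moreover have "(\<exists>i. h i x > 0) \<and> finite {i. h i x \<noteq> 0}" if x: "x \<in> Ob" for x
  proof
    \<comment> \<open>At the first index with a positive value nothing is subtracted, which
      preserves the covering property.\<close>
    define m where "m = (LEAST i. f i x > 0)"
    have m: "f m x > 0" using f x unfolding m_def by (metis LeastI_ex)
    have "f j x = 0" if "j < m" for j
      using not_less_Least[of j "\<lambda>i. f i x > 0"] that f x unfolding m_def by (metis antisym_conv1 not_le)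
    then have "h m x = f m x" using m by (simp add: h_def)
    then show "\<exists>i. h i x > 0" using m by metis
    \<comment> \<open>For i > m with i \<ge> K the subtracted term contains i times f m x, so it is
      at least 1, an upper bound for f i x.\<close>
    obtain K where K: "real K * f m x \<ge> 1"
      using m by (metis real_arch_simple pos_divide_le_eq)
    have "h i x = 0" if i: "i > m" "i \<ge> K" for i
    proof -
      have "f m x \<le> (\<Sum>j<i. f j x)" using i f x by (intro member_le_sum) auto
      then have "real K * f m x \<le> real i * (\<Sum>j<i. f j x)"
        using i m by (intro mult_mono) auto
      then have "f i x - real i * (\<Sum>j<i. f j x) \<le> 0" using K f x by (smt (verit))
      then show ?thesis by (simp add: h_def)
    qed
    then have "{i. h i x \<noteq> 0} \<subseteq> {..max m K}"
      by (smt (verit) atMost_iff max.cobounded1 max.cobounded2 mem_Collect_eq not_le order_trans subsetI less_imp_le)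
    then show "finite {i. h i x \<noteq> 0}" using finite_subset by blast
  qed
  moreover have "0 \<le> h i x" for i x by (simp add: h_def)
  ultimately show ?thesis
    using f le by (intro exI[of _ V] exI[of _ n] exI[of _ h]) (meson order.strict_trans2 order_trans)
qed

end

section \<open>Encoding points as sets of natural numbers\<close>

text \<open>A pair of sets is coded by its disjoint union. Bijections, not mere injections, are
  built, since every \<open>point\<close> is to be decoded and topologies are transported by pulling
  them back along the decoding.\<close>

lemma bij_prod_nat_set:
  assumes f: "bij (f :: 'a \<Rightarrow> nat set)" and g: "bij (g :: 'b \<Rightarrow> nat set)"
  shows "\<exists>h :: 'a \<times> 'b \<Rightarrow> nat set. bij h"
proof -
  define h where "h = (\<lambda>(a, b). sum_encode ` (f a <+> g b))"
  have "inj h"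
  proof (rule injI)
    fix x y assume "h x = h y"
    then have "f (fst x) <+> g (snd x) = f (fst y) <+> g (snd y)"
      by (simp add: h_def case_prod_unfold inj_image_eq_iff[OF inj_sum_encode])
    then have "f (fst x) = f (fst y)" "g (snd x) = g (snd y)"
      by (auto simp: Plus_def set_eq_iff)
    then show "x = y"
      using f g by (auto simp: bij_def inj_eq prod_eq_iff)
  qed
  moreover have "surj h"
  proof (rule surjI)
    fix S :: "nat set"
    have "f (inv_into UNIV f {i. sum_encode (Inl i) \<in> S}) = {i. sum_encode (Inl i) \<in> S}"
      "g (inv_into UNIV g {i. sum_encode (Inr i) \<in> S}) = {i. sum_encode (Inr i) \<in> S}"
      using f g by (simp_all add: bij_def surj_f_inv_f)
    moreover have "sum_encode ` ({i. sum_encode (Inl i) \<in> S} <+> {i. sum_encode (Inr i) \<in> S}) = S"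
    proof
      show "S \<subseteq> sum_encode ` ({i. sum_encode (Inl i) \<in> S} <+> {i. sum_encode (Inr i) \<in> S})"
      proof
        fix x assume x: "x \<in> S"
        obtain y where y: "x = sum_encode y" by (metis sum_decode_inverse)
        then have "y \<in> {i. sum_encode (Inl i) \<in> S} <+> {i. sum_encode (Inr i) \<in> S}"
          using x by (cases y) auto
        then show "x \<in> sum_encode ` ({i. sum_encode (Inl i) \<in> S} <+> {i. sum_encode (Inr i) \<in> S})"
          using y by blast
      qed
    qed auto
    ultimately show "h (inv_into UNIV f {i. sum_encode (Inl i) \<in> S}, inv_into UNIV g {i. sum_encode (Inr i) \<in> S}) = S"
      by (simp add: h_def)
  qed
  ultimately show ?thesis by (auto simp: bij_def)
qed

text \<open>A sequence of sets of numbers is a set of pairs of numbers, read row by row.\<close>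

lemma bij_fun_nat_set:
  assumes f: "bij (f :: 'a \<Rightarrow> nat set)"
  shows "\<exists>h :: (nat \<Rightarrow> 'a) \<Rightarrow> nat set. bij h"
proof -
  define h where "h = (\<lambda>F. prod_encode ` (SIGMA i:UNIV. f (F i)))"
  have "inj h"
  proof (rule injI)
    fix x y assume "h x = h y"
    then have "(SIGMA i:UNIV. f (x i)) = (SIGMA i:UNIV. f (y i))"
      by (simp add: h_def inj_image_eq_iff[OF inj_prod_encode])
    then have "f (x i) = f (y i)" for i
      by (auto simp: set_eq_iff)
    then show "x = y"
      using f by (simp add: bij_def inj_eq fun_eq_iff)
  qed
  moreover have "surj h"
  proof (rule surjI)
    fix S :: "nat set"
    have "f (inv_into UNIV f {j. prod_encode (i, j) \<in> S}) = {j. prod_encode (i, j) \<in> S}" for i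
      using f by (simp add: bij_def surj_f_inv_f)
    moreover have "prod_encode ` (SIGMA i:UNIV. {j. prod_encode (i, j) \<in> S}) = S"
    proof
      show "S \<subseteq> prod_encode ` (SIGMA i:UNIV. {j. prod_encode (i, j) \<in> S})"
      proof
        fix x assume x: "x \<in> S"
        obtain i j where "x = prod_encode (i, j)" by (metis prod_decode_inverse surj_pair)
        then show "x \<in> prod_encode ` (SIGMA i:UNIV. {j. prod_encode (i, j) \<in> S})"
          using x by blast
      qed
    qed auto
    ultimately show "h (\<lambda>i. inv_into UNIV f {j. prod_encode (i, j) \<in> S}) = S"
      by (simp add: h_def)
  qed
  ultimately show ?thesis by (auto simp: bij_def)
qed

lemma bij_real_nat_set: "\<exists>f :: real \<Rightarrow> nat set. bij f"
  using eqpoll_sym[OF nat_sets_eqpoll_reals] by (simp add: eqpoll_def)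

lemma bij_complex_nat_set: "\<exists>f :: complex \<Rightarrow> nat set. bij f"
proof -
  obtain f :: "real \<times> real \<Rightarrow> nat set" where f: "bij f"
    using bij_real_nat_set bij_prod_nat_set by metis
  have "bij (\<lambda>z. (Re z, Im z))"
    by (rule o_bij[of "\<lambda>p. Complex (fst p) (snd p)"]) (auto simp: fun_eq_iff)
  then have "bij (f \<circ> (\<lambda>z. (Re z, Im z)))"
    using f by (rule bij_comp)
  then show ?thesis by blast
qed

lemma ex_decode_base: "\<exists>d :: point \<Rightarrow> nat \<Rightarrow> real. bij d"
  using bij_real_nat_set bij_fun_nat_set bij_imp_bij_inv by metis

lemma bij_matrices_nat_set: "\<exists>f :: (nat \<Rightarrow> nat \<Rightarrow> nat \<Rightarrow> complex) \<Rightarrow> nat set. bij f"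
  using bij_complex_nat_set bij_fun_nat_set by metis

type_synonym scaled_matrices = "(nat \<Rightarrow> real) \<times> (nat \<Rightarrow> nat \<Rightarrow> nat \<Rightarrow> complex)"

lemma ex_decode_total: "\<exists>d :: point \<Rightarrow> scaled_matrices. bij d"
proof -
  obtain f :: "(nat \<Rightarrow> real) \<Rightarrow> nat set" where f: "bij f"
    using bij_real_nat_set bij_fun_nat_set by metis
  obtain g :: "(nat \<Rightarrow> nat \<Rightarrow> nat \<Rightarrow> complex) \<Rightarrow> nat set" where g: "bij g"
    using bij_matrices_nat_set by blast
  show ?thesis
    using bij_prod_nat_set[OF f g] bij_imp_bij_inv by metis
qed

text \<open>Any bijection will do: the topology on codes is the one pulled back along it, so
  decoding is a homeomorphism by construction.\<close>

definition decode_base :: "point \<Rightarrow> nat \<Rightarrow> real" where "decode_base = (SOME d. bij d)"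
definition decode_total :: "point \<Rightarrow> scaled_matrices" where
  "decode_total = (SOME d. bij d)"

lemma bij_decode_base: "bij decode_base" and bij_decode_total: "bij decode_total"
  unfolding decode_base_def decode_total_def
  using someI_ex[OF ex_decode_base] someI_ex[OF ex_decode_total] by auto

abbreviation "db \<equiv> decode_base"
abbreviation "dt \<equiv> decode_total"
abbreviation "eb \<equiv> inv_into UNIV decode_base"
abbreviation "et \<equiv> inv_into UNIV decode_total"

lemma db_eb [simp]: "db (eb q) = q" and eb_db [simp]: "eb (db p) = p"
  and dt_et [simp]: "dt (et x) = x" and et_dt [simp]: "et (dt u) = u"
  using bij_decode_base bij_decode_total by (simp_all add: bij_def surj_f_inv_f)

lemma eb_eq [simp]: "eb q = eb q' \<longleftrightarrow> q = q'"
  by (metis db_eb)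

lemma limitin_pullback_topology:
  "limitin (pullback_topology UNIV d X) h u F \<longleftrightarrow> limitin X (\<lambda>t. d (h t)) (d u) F"
proof
  assume L: "limitin (pullback_topology UNIV d X) h u F"
  have "\<forall>\<^sub>F t in F. d (h t) \<in> V" if V: "openin X V" "d u \<in> V" for V
  proof -
    have "openin (pullback_topology UNIV d X) (d -` V)"
      using V(1) by (auto simp: openin_pullback_topology)
    from limitinD[OF L this] show ?thesis using V(2) by simp
  qed
  moreover have "d u \<in> topspace X"
    using limitin_topspace[OF L] by (simp add: topspace_pullback_topology)
  ultimately show "limitin X (\<lambda>t. d (h t)) (d u) F"
    by (simp add: limitin_def)
next
  assume L: "limitin X (\<lambda>t. d (h t)) (d u) F"
  have "\<forall>\<^sub>F t in F. h t \<in> W" if W: "openin (pullback_topology UNIV d X) W" "u \<in> W" for W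
  proof -
    obtain V where V: "openin X V" "W = d -` V"
      using W(1) by (auto simp: openin_pullback_topology)
    then show ?thesis using limitinD[OF L V(1)] W(2) by simp
  qed
  moreover have "u \<in> topspace (pullback_topology UNIV d X)"
    using limitin_topspace[OF L] by (simp add: topspace_pullback_topology)
  ultimately show "limitin (pullback_topology UNIV d X) h u F"
    by (simp add: limitin_def)
qed

lemma homeomorphic_map_pullback_topology:
  assumes "bij d"
  shows "homeomorphic_map (pullback_topology UNIV d X) X d"
proof -
  have "continuous_map (pullback_topology UNIV d X) X d"
    using continuous_map_pullback[of X X id UNIV d] by simp
  moreover have "continuous_map X (pullback_topology UNIV d X) (inv_into UNIV d)"
    by (rule continuous_map_pullback')
      (use assms in \<open>auto simp: bij_def surj_f_inv_f o_def\<close>)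
  ultimately have "homeomorphic_maps (pullback_topology UNIV d X) X d (inv_into UNIV d)"
    using assms by (auto simp: homeomorphic_maps_def bij_def surj_f_inv_f)
  then show ?thesis
    using homeomorphic_maps_map by blast
qed

section \<open>A bundle of unitary groups which degenerate\<close>

text \<open>The fibre over \<open>q\<close> is the product of the unitary groups \<open>U(n i)\<close> with \<open>q i \<noteq> 0\<close>; an element of
  \<open>U(n i)\<close> is stored multiplied by \<open>q i\<close>, so that this factor shrinks to a point as \<open>q i\<close>
  tends to \<open>0\<close>.\<close>

definition base_points :: "(nat \<Rightarrow> real) set" where
  "base_points = {q. (\<forall>i. 0 \<le> q i \<and> q i \<le> 1) \<and> finite {i. q i \<noteq> 0}}"

locale unitary_bundle =
  fixes n :: "nat \<Rightarrow> nat"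
begin

abbreviation "N i \<equiv> {..<n i}"

definition total_points :: "scaled_matrices set" where
  "total_points = {(q, A). q \<in> base_points \<and> (\<forall>i. cunitary (q i) (N i) (N i) (A i))}"

definition umul where
  "umul u v = (fst u, \<lambda>i. mcomp (fst u i) (N i) (snd u i) (snd v i))"

definition uadj :: "scaled_matrices \<Rightarrow> scaled_matrices"
  where "uadj u = (fst u, \<lambda>i. madj (snd u i))"

definition uone :: "(nat \<Rightarrow> real) \<Rightarrow> scaled_matrices"
  where "uone q = (q, \<lambda>i. mid (q i) (N i))"

definition U :: "(point, point) group_bundle" where
  "U = \<lparr>Total = pullback_topology UNIV dt (top_of_set total_points),
        Base = pullback_topology UNIV db (top_of_set base_points),
        bproj = (\<lambda>u. eb (fst (dt u))),
        bmlt = (\<lambda>u v. et (umul (dt u) (dt v))),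
        bone = (\<lambda>q. et (uone (db q)))\<rparr>"

lemma in_Total [simp]: "u \<in> topspace (Total U) \<longleftrightarrow> dt u \<in> total_points"
  and in_Base [simp]: "q \<in> topspace (Base U) \<longleftrightarrow> db q \<in> base_points"
  by (auto simp: U_def topspace_pullback_topology)

lemma bproj_U: "bproj U u = eb (fst (dt u))" and bmlt_U: "bmlt U u v = et (umul (dt u) (dt v))"
  and bone_U: "bone U q = et (uone (db q))"
  by (simp_all add: U_def)

lemma fst_ops [simp]: "fst (umul u v) = fst u" "fst (uadj u) = fst u" "fst (uone q) = q"
  by (simp_all add: umul_def uadj_def uone_def)

lemma total_pointsD:
  assumes "u \<in> total_points"
  shows "fst u \<in> base_points" "cunitary (fst u i) (N i) (N i) (snd u i)"
  using assms by (auto simp: total_points_def)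

lemma base_points_nonneg: "q \<in> base_points \<Longrightarrow> 0 \<le> q i" and base_points_le_1: "q \<in> base_points \<Longrightarrow> q i \<le> 1"
  by (auto simp: base_points_def)

lemma umul_in [simp]: "u \<in> total_points \<Longrightarrow> v \<in> total_points \<Longrightarrow> fst u = fst v \<Longrightarrow> umul u v \<in> total_points"
  by (auto simp: total_points_def umul_def intro!: cunitary_mcomp)

lemma uadj_in [simp]: "u \<in> total_points \<Longrightarrow> uadj u \<in> total_points"
  by (auto simp: total_points_def uadj_def intro!: cunitary_madj)

lemma uone_in [simp]: "q \<in> base_points \<Longrightarrow> uone q \<in> total_points"
  by (auto simp: total_points_def uone_def intro!: cunitary_mid)

lemma fst_total_points [simp]: "u \<in> total_points \<Longrightarrow> fst u \<in> base_points"
  by (auto simp: total_points_def)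

lemma umul_assoc: "fst u = fst v \<Longrightarrow> umul (umul u v) w = umul u (umul v w)"
  by (simp add: umul_def mcomp_assoc)

lemma umul_uone [simp]: "u \<in> total_points \<Longrightarrow> q = fst u \<Longrightarrow> umul u (uone q) = u"
  using mcomp_mid_right[OF total_pointsD(2)] by (simp add: umul_def uone_def prod_eq_iff)

lemma uone_umul [simp]: "u \<in> total_points \<Longrightarrow> q = fst u \<Longrightarrow> umul (uone q) u = u"
  using mcomp_mid_left[OF total_pointsD(2)] by (simp add: umul_def uone_def prod_eq_iff)

lemma umul_uadj [simp]: "u \<in> total_points \<Longrightarrow> umul u (uadj u) = uone (fst u)"
  using mcomp_madj_right[OF total_pointsD(2)] by (simp add: umul_def uone_def uadj_def)

lemma uadj_umul [simp]: "u \<in> total_points \<Longrightarrow> umul (uadj u) u = uone (fst u)"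
  using mcomp_madj_left[OF total_pointsD(2)] by (simp add: umul_def uone_def uadj_def)

lemma fibre_carrier: "carrier (fibre_group U q) = {u. dt u \<in> total_points \<and> fst (dt u) = db q}"
  by (auto simp: fibre_group_def fibre_top_def bproj_U)

lemma mult_fibre: "x \<otimes>\<^bsub>fibre_group U q\<^esub> y = et (umul (dt x) (dt y))"
  and one_fibre: "\<one>\<^bsub>fibre_group U q\<^esub> = et (uone (db q))"
  by (simp_all add: fibre_group_def bmlt_U bone_U)

lemma group_fibre:
  assumes "q \<in> topspace (Base U)"
  shows "group (fibre_group U q)"
proof (rule groupI)
  show "\<exists>y\<in>carrier (fibre_group U q). y \<otimes>\<^bsub>fibre_group U q\<^esub> x = \<one>\<^bsub>fibre_group U q\<^esub>"
    if "x \<in> carrier (fibre_group U q)" for x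
    using that assms
    by (intro bexI[of _ "et (uadj (dt x))"]) (auto simp: fibre_carrier mult_fibre one_fibre)
qed (use assms in \<open>auto simp: fibre_carrier mult_fibre one_fibre umul_assoc\<close>)

lemma inv_fibre:
  assumes u: "u \<in> carrier (fibre_group U q)" and q: "q \<in> topspace (Base U)"
  shows "inv\<^bsub>fibre_group U q\<^esub> u = et (uadj (dt u))"
proof -
  have "et (uadj (dt u)) \<in> carrier (fibre_group U q)"
    "et (uadj (dt u)) \<otimes>\<^bsub>fibre_group U q\<^esub> u = \<one>\<^bsub>fibre_group U q\<^esub>"
    using u by (auto simp: fibre_carrier mult_fibre one_fibre)
  then show ?thesis
    using group.inv_equality[OF group_fibre[OF q] _ u] by blast
qed

lemma bundle_inv_U:
  assumes "dt u \<in> total_points"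
  shows "bundle_inv U u = et (uadj (dt u))"
  unfolding bundle_inv_def
  by (rule inv_fibre) (use assms in \<open>simp_all add: fibre_carrier bproj_U\<close>)

subsection \<open>Topology of the bundle\<close>

lemma limitin_Total:
  "limitin (Total U) h u F \<longleftrightarrow> dt u \<in> total_points \<and> (\<forall>\<^sub>F t in F. dt (h t) \<in> total_points) \<and>
     (\<forall>i. ((\<lambda>t. fst (dt (h t)) i) \<longlongrightarrow> fst (dt u) i) F) \<and>
     (\<forall>i j k. ((\<lambda>t. snd (dt (h t)) i j k) \<longlongrightarrow> snd (dt u) i j k) F)"
  unfolding U_def
  by (simp add: limitin_pullback_topology limitin_subtopology tendsto_pair_iff tendsto_fun_iff)

lemma limitin_Base:
  "limitin (Base U) h q F \<longleftrightarrow> db q \<in> base_points \<and> (\<forall>\<^sub>F t in F. db (h t) \<in> base_points) \<and>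
     (\<forall>i. ((\<lambda>t. db (h t) i) \<longlongrightarrow> db q i) F)"
  unfolding U_def
  by (simp add: limitin_pullback_topology limitin_subtopology tendsto_fun_iff)

lemma homeomorphic_map_dt: "homeomorphic_map (Total U) (top_of_set total_points) dt"
  and homeomorphic_map_db: "homeomorphic_map (Base U) (top_of_set base_points) db"
  by (simp_all add: U_def homeomorphic_map_pullback_topology bij_decode_base bij_decode_total)

lemma Hausdorff_Base: "Hausdorff_space (Base U)"
proof -
  have "Hausdorff_space (top_of_set base_points)"
    by (intro Hausdorff_space_subtopology Hausdorff_space_euclidean)
  then show ?thesis
    using homeomorphic_Hausdorff_space homeomorphic_map_imp_homeomorphic_space homeomorphic_map_db by blast
qed

lemma Hausdorff_Total: "Hausdorff_space (Total U)"
proof -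
  have "Hausdorff_space (top_of_set total_points)"
    by (intro Hausdorff_space_subtopology Hausdorff_space_euclidean)
  then show ?thesis
    using homeomorphic_Hausdorff_space homeomorphic_map_imp_homeomorphic_space homeomorphic_map_dt by blast
qed

lemma limitin_bproj: "limitin (Total U) h u F \<Longrightarrow> limitin (Base U) (\<lambda>t. bproj U (h t)) (bproj U u) F"
  by (auto simp: limitin_Total limitin_Base bproj_U elim!: eventually_mono)

lemma limitin_TotalI:
  assumes "u \<in> total_points" "\<forall>\<^sub>F t in F. h t \<in> total_points"
    "\<And>i. ((\<lambda>t. fst (h t) i) \<longlongrightarrow> fst u i) F" "\<And>i j k. ((\<lambda>t. snd (h t) i j k) \<longlongrightarrow> snd u i j k) F"
  shows "limitin (Total U) (\<lambda>t. et (h t)) (et u) F"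
  using assms by (simp add: limitin_Total)

lemma limitin_TotalD:
  assumes "limitin (Total U) h u F"
  shows "dt u \<in> total_points" "\<forall>\<^sub>F t in F. dt (h t) \<in> total_points"
    "((\<lambda>t. fst (dt (h t)) i) \<longlongrightarrow> fst (dt u) i) F" "((\<lambda>t. snd (dt (h t)) i j k) \<longlongrightarrow> snd (dt u) i j k) F"
  using assms by (simp_all add: limitin_Total)

lemma snd_ops: "snd (umul u v) i j k = (\<Sum>l\<in>N i. snd u i j l * snd v i l k) / of_real (fst u i)"
  "snd (uadj u) i j k = cnj (snd u i k j)" "snd (uone q) i j k = mid (q i) (N i) j k"
  by (simp_all add: umul_def uadj_def uone_def mcomp_def madj_def)

lemma limitin_bone:
  assumes "limitin (Base U) h q F" shows "limitin (Total U) (\<lambda>t. bone U (h t)) (bone U q) F"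
  unfolding bone_U
proof (rule limitin_TotalI)
  show "((\<lambda>t. snd (uone (db (h t))) i j k) \<longlongrightarrow> snd (uone (db q)) i j k) F" for i j k
    unfolding snd_ops using assms by (auto simp: mid_def limitin_Base intro!: tendsto_intros)
  have "\<forall>\<^sub>F t in F. db (h t) \<in> base_points" using assms by (simp add: limitin_Base)
  then show "\<forall>\<^sub>F t in F. uone (db (h t)) \<in> total_points"
    by eventually_elim simp
qed (use assms in \<open>simp_all add: limitin_Base\<close>)

lemma limitin_bundle_inv:
  assumes "limitin (Total U) h u F" shows "limitin (Total U) (\<lambda>t. bundle_inv U (h t)) (bundle_inv U u) F"
proof -
  note h = limitin_TotalD[OF assms]
  have 1: "limitin (Total U) (\<lambda>t. et (uadj (dt (h t)))) (et (uadj (dt u))) F"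
  proof (rule limitin_TotalI)
    show "((\<lambda>t. snd (uadj (dt (h t))) i j k) \<longlongrightarrow> snd (uadj (dt u)) i j k) F" for i j k
      unfolding snd_ops by (intro tendsto_intros h)
    show "\<forall>\<^sub>F t in F. uadj (dt (h t)) \<in> total_points"
      using h(2) by eventually_elim simp
  qed (use h in simp_all)
  have 2: "\<forall>\<^sub>F t in F. et (uadj (dt (h t))) = bundle_inv U (h t)"
    using h(2) by eventually_elim (simp add: bundle_inv_U)
  have 3: "et (uadj (dt u)) = bundle_inv U u"
    using h(1) by (simp add: bundle_inv_U)
  show ?thesis using limitin_transform_eventually[OF 2 1] by (simp add: 3)
qed

lemma total_points_bound:
  assumes "u \<in> total_points" shows "cmod (snd u i j k) \<le> fst u i"
  using cunitary_bound[OF total_pointsD(2)[OF assms]] base_points_nonneg assms by simp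

text \<open>The entries of both factors are bounded by their common scale, so
  \<open>tendsto_scaled_sum\<close> also covers the points where a factor collapses.\<close>

lemma limitin_bmlt:
  assumes f: "limitin (Total U) f u F" and g: "limitin (Total U) g v F"
    and "bproj U u = bproj U v" "\<forall>\<^sub>F t in F. bproj U (f t) = bproj U (g t)"
  shows "limitin (Total U) (\<lambda>t. bmlt U (f t) (g t)) (bmlt U u v) F"
proof -
  have ev: "\<forall>\<^sub>F t in F. dt (f t) \<in> total_points \<and> dt (g t) \<in> total_points \<and> fst (dt (f t)) = fst (dt (g t))"
    using assms unfolding limitin_Total by (auto simp: bproj_U eventually_conj_iff)
  have "((\<lambda>t. (\<Sum>l\<in>N i. snd (dt (f t)) i j l * snd (dt (g t)) i l k) / of_real (fst (dt (f t)) i)) \<longlongrightarrow>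
     (\<Sum>l\<in>N i. snd (dt u) i j l * snd (dt v) i l k) / of_real (fst (dt u) i)) F" for i j k
  proof (rule tendsto_scaled_sum)
    show "\<forall>\<^sub>F t in F. \<forall>l\<in>N i. cmod (snd (dt (f t)) i j l) \<le> fst (dt (f t)) i"
      "\<forall>\<^sub>F t in F. \<forall>l\<in>N i. cmod (snd (dt (g t)) i l k) \<le> fst (dt (f t)) i"
      using ev by (eventually_elim, use total_points_bound in metis)+
  qed (use f g in \<open>auto simp: limitin_Total\<close>)
  note lim = this
  show ?thesis
    unfolding bmlt_U
  proof (rule limitin_TotalI)
    show "\<forall>\<^sub>F t in F. umul (dt (f t)) (dt (g t)) \<in> total_points"
      using ev by eventually_elim simp
    show "((\<lambda>t. snd (umul (dt (f t)) (dt (g t))) i j k) \<longlongrightarrow> snd (umul (dt u) (dt v)) i j k) F" for i j k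
      unfolding snd_ops by (rule lim)
  qed (use f g assms(3) in \<open>simp_all add: limitin_Total bproj_U\<close>)
qed

text \<open>A section of the projection through u: each factor is rescaled from its scale at u to
  its scale at q. A factor that is collapsed at u is approached by any choice, and the scaled
  identity is taken. This replaces local triviality.\<close>

definition through :: "point \<Rightarrow> point \<Rightarrow> point" where
  "through u q = et (db q, \<lambda>i. if fst (dt u) i = 0 then mid (db q i) (N i)
     else (\<lambda>j k. of_real (db q i / fst (dt u) i) * snd (dt u) i j k))"

lemma through_in [simp]:
  assumes "dt u \<in> total_points" "db q \<in> base_points"
  shows "dt (through u q) \<in> total_points"
proof -
  have "cunitary (db q i) (N i) (N i) (\<lambda>j k. of_real (db q i / fst (dt u) i) * snd (dt u) i j k)"
    if "fst (dt u) i \<noteq> 0" for i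
    using cunitary_scale[OF total_pointsD(2)[OF assms(1), of i], of "db q i / fst (dt u) i"] that by simp
  then show ?thesis
    using assms by (auto simp: through_def total_points_def cunitary_mid)
qed

lemma bproj_through [simp]: "bproj U (through u q) = q"
  by (simp add: bproj_U through_def)

lemma through_self:
  assumes "dt u \<in> total_points" shows "through u (bproj U u) = u"
proof -
  have "mid 0 (N i) = snd (dt u) i" if "fst (dt u) i = 0" for i
    using total_pointsD(2)[OF assms, of i] cunitary_zero[of "N i" "N i" "snd (dt u) i"] that
    by (auto simp: mid_def fun_eq_iff)
  then have "dt (through u (bproj U u)) = dt u"
    by (auto simp: through_def bproj_U prod_eq_iff fun_eq_iff)
  then show ?thesis by (metis et_dt)
qed

lemma limitin_through:
  assumes u: "dt u \<in> total_points" and h: "limitin (Base U) h q F"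
  shows "limitin (Total U) (\<lambda>t. through u (h t)) (through u q) F"
  unfolding limitin_Total
proof (intro conjI allI)
  show "dt (through u q) \<in> total_points" using u h by (simp add: limitin_Base)
  show "\<forall>\<^sub>F t in F. dt (through u (h t)) \<in> total_points"
    using h u by (auto simp: limitin_Base elim!: eventually_mono)
  show "((\<lambda>t. fst (dt (through u (h t))) i) \<longlongrightarrow> fst (dt (through u q)) i) F" for i
    using h by (simp add: limitin_Base through_def)
  show "((\<lambda>t. snd (dt (through u (h t))) i j k) \<longlongrightarrow> snd (dt (through u q)) i j k) F" for i j k
    using h by (cases "fst (dt u) i = 0") (auto simp: limitin_Base through_def mid_def divide_inverse intro!: tendsto_intros)
qed

section \<open>Compactness of the fibres and properness of the projection\<close>

lemma compact_fun_space:
  fixes S :: "'b::topological_space set"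
  assumes "compact S"
  shows "compact {f :: nat \<Rightarrow> 'b. \<forall>i. f i \<in> S}"
proof -
  have "compactin (product_topology (\<lambda>_::nat. euclidean) UNIV) (PiE UNIV (\<lambda>_. S))"
    using assms by (simp add: compactin_PiE)
  moreover have "PiE UNIV (\<lambda>_. S) = {f :: nat \<Rightarrow> 'b. \<forall>i. f i \<in> S}"
    by (auto simp: PiE_def Pi_def)
  ultimately show ?thesis by (simp add: euclidean_product_topology)
qed

text \<open>The conditions are equations between continuous functions of scales and entries, without
  any division, so they survive limits in which scales tend to 0.\<close>

lemma closed_cunitary: "closed {u. \<forall>i. cunitary (fst u i) (N i) (N i) (snd u i)}"
proof -
  have "((\<lambda>u. u) \<longlongrightarrow> u) (at u)" for u :: "scaled_matrices"
    by (rule tendsto_ident_at)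
  then have c: "continuous_on UNIV (\<lambda>u :: scaled_matrices. fst u i)"
    "continuous_on UNIV (\<lambda>u :: scaled_matrices. snd u i j k)" for i j k
    unfolding continuous_on_def by (simp_all add: tendsto_pair_iff[of "\<lambda>u. u"] tendsto_fun_iff)
  then have "continuous_on UNIV (\<lambda>u :: scaled_matrices.
      if j = k then (complex_of_real (fst u i))\<^sup>2 else 0)" for i and j k :: nat
    by (cases "j = k") (auto intro!: continuous_intros)
  then show ?thesis
    unfolding cunitary_def Ball_def
    by (intro closed_Collect_all closed_Collect_conj closed_Collect_imp open_Collect_const closed_Collect_eq
        continuous_intros c)
qed

text \<open>Entries are bounded by the scales and these by 1. So the total space is a closed
  subspace of the product of the base with a fixed compact space C of matrix families, from which
  the projection is proper.\<close>

lemma proper_map_fst_total: "proper_map (top_of_set total_points) (top_of_set base_points) fst"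
proof -
  define C where "C = {A :: nat \<Rightarrow> nat \<Rightarrow> nat \<Rightarrow> complex. \<forall>i. A i \<in> {B. \<forall>j. B j \<in> {r. \<forall>k. r k \<in> cball 0 1}}}"
  have "compact C"
    unfolding C_def by (intro compact_fun_space compact_cball)
  then have C: "compact_space (top_of_set C)"
    by (simp add: compact_space_subtopology)
  have eq: "prod_topology (top_of_set base_points) (top_of_set C) = top_of_set (base_points \<times> C)"
    by (simp add: subtopology_Times prod_topology_euclidean flip: subtopology_Times)
  have "snd u \<in> C" if "u \<in> total_points" for u
    using base_points_le_1[OF total_pointsD(1)[OF that]] unfolding C_def
    by (auto intro: order_trans[OF total_points_bound[OF that]])
  then have sub: "total_points \<subseteq> base_points \<times> C"
    by (auto simp: total_points_def)
  have tp: "total_points = (base_points \<times> C) \<inter> {u. \<forall>i. cunitary (fst u i) (N i) (N i) (snd u i)}"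
    using sub by (auto simp: total_points_def)
  have cl: "closedin (top_of_set (base_points \<times> C)) total_points"
    unfolding tp by (rule closedin_closed_Int[OF closed_cunitary])
  have "proper_map (prod_topology (top_of_set base_points) (top_of_set C)) (top_of_set base_points) fst"
    unfolding proper_map_def
  proof
    show "closed_map (prod_topology (top_of_set base_points) (top_of_set C)) (top_of_set base_points) fst"
      by (rule closed_map_fst[OF C])
    show "\<forall>q\<in>topspace (top_of_set base_points). compactin (prod_topology (top_of_set base_points) (top_of_set C))
       {u \<in> topspace (prod_topology (top_of_set base_points) (top_of_set C)). fst u = q}"
    proof
      fix q assume "q \<in> topspace (top_of_set base_points)"
      then have "{u \<in> topspace (prod_topology (top_of_set base_points) (top_of_set C)). fst u = q} = {q} \<times> topspace (top_of_set C)"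
        by auto
      then show "compactin (prod_topology (top_of_set base_points) (top_of_set C))
       {u \<in> topspace (prod_topology (top_of_set base_points) (top_of_set C)). fst u = q}"
        using \<open>compact C\<close> \<open>q \<in> _\<close> unfolding eq
        by (auto simp: compactin_subtopology compact_Times)
    qed
  qed
  moreover have "proper_map (subtopology (top_of_set (base_points \<times> C)) total_points) (top_of_set (base_points \<times> C)) id"
    using cl sub by (subst proper_map_inclusion) (auto intro: closed_Int_compactin)
  ultimately have "proper_map (subtopology (top_of_set (base_points \<times> C)) total_points) (top_of_set base_points) (fst \<circ> id)"
    unfolding eq by (rule proper_map_compose[rotated])
  then show ?thesis
    using sub by (simp add: subtopology_subtopology inf.absorb2)
qed

lemma proper_map_bproj: "proper_map (Total U) (Base U) (bproj U)"
proof -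
  have "homeomorphic_map (top_of_set base_points) (Base U) eb"
  proof -
    have "homeomorphic_maps (Base U) (top_of_set base_points) db eb"
    proof -
      obtain g where g: "homeomorphic_maps (Base U) (top_of_set base_points) db g"
        using homeomorphic_map_db homeomorphic_map_maps by blast
      then have "g q = eb q" if "q \<in> base_points" for q
        using that unfolding homeomorphic_maps_def by (metis eb_db topspace_euclidean_subtopology)
      then have "continuous_map (top_of_set base_points) (Base U) eb"
        using g unfolding homeomorphic_maps_def
        by (auto intro: continuous_map_eq[of "top_of_set base_points" "Base U" g])
      then show ?thesis using g by (simp add: homeomorphic_maps_def)
    qed
    then show ?thesis using homeomorphic_maps_map homeomorphic_maps_sym by blast
  qed
  then have "proper_map (top_of_set base_points) (Base U) eb"
    by (rule homeomorphic_imp_proper_map)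
  moreover have "proper_map (Total U) (top_of_set total_points) dt"
    using homeomorphic_map_dt homeomorphic_imp_proper_map by blast
  ultimately have "proper_map (Total U) (Base U) (eb \<circ> (fst \<circ> dt))"
    by (intro proper_map_compose[OF proper_map_compose[OF _ proper_map_fst_total]])
  moreover have "eb \<circ> (fst \<circ> dt) = bproj U"
    by (simp add: bproj_U fun_eq_iff)
  ultimately show ?thesis by simp
qed

section \<open>Continuity and openness of the structure maps of the bundle\<close>

lemma continuous_map_bproj: "continuous_map (Total U) (Base U) (bproj U)"
  unfolding continuous_map_nhdsin using limitin_bproj[OF limitin_ident] by blast

lemma continuous_map_bone: "continuous_map (Base U) (Total U) (bone U)"
  unfolding continuous_map_nhdsin using limitin_bone[OF limitin_ident] by blast

lemma continuous_map_bundle_inv: "continuous_map (Total U) (Total U) (bundle_inv U)"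
  unfolding continuous_map_nhdsin using limitin_bundle_inv[OF limitin_ident] by blast

lemma continuous_map_bmlt:
  "continuous_map (fibre_product (Total U) (bproj U) (Total U) (bproj U)) (Total U) (\<lambda>(u, v). bmlt U u v)"
  unfolding continuous_map_nhdsin
proof
  fix p assume "p \<in> topspace (fibre_product (Total U) (bproj U) (Total U) (bproj U))"
  from limitin_ident[OF this]
  show "limitin (Total U) (\<lambda>(u, v). bmlt U u v) (case p of (u, v) \<Rightarrow> bmlt U u v)
     (nhdsin (fibre_product (Total U) (bproj U) (Total U) (bproj U)) p)"
    unfolding limitin_fibre_product case_prod_unfold by (intro limitin_bmlt) auto
qed

lemma open_map_bproj: "open_map (Total U) (Base U) (bproj U)"
proof (rule open_map_local_sections)
  show "bproj U \<in> topspace (Total U) \<rightarrow> topspace (Base U)" by (simp add: bproj_U)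
  fix u assume u: "u \<in> topspace (Total U)"
  then have "bproj U u \<in> topspace (Base U)" by (simp add: bproj_U)
  from limitin_through[OF _ limitin_ident[OF this], of u]
  have "limitin (Total U) (through u) u (nhdsin (Base U) (bproj U u))"
    using u by (simp add: through_self)
  then show "\<exists>s. limitin (Total U) s u (nhdsin (Base U) (bproj U u)) \<and>
      (\<forall>\<^sub>F y in nhdsin (Base U) (bproj U u). bproj U (s y) = y)"
    by (intro exI[of _ "through u"]) simp
qed

text \<open>An element z near the product of u and v is split into a and the product of the inverse
  of a with z, where a continues u by \<open>through\<close> to the base point of z.\<close>

lemma open_map_bmlt:
  "open_map (fibre_product (Total U) (bproj U) (Total U) (bproj U)) (Total U) (\<lambda>(u, v). bmlt U u v)"
proof (rule open_map_local_sections)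
  show "(\<lambda>(u, v). bmlt U u v) \<in> topspace (fibre_product (Total U) (bproj U) (Total U) (bproj U)) \<rightarrow> topspace (Total U)"
    by (auto simp: topspace_fibre_product bmlt_U bproj_U)
  fix p assume p: "p \<in> topspace (fibre_product (Total U) (bproj U) (Total U) (bproj U))"
  obtain u v where p_eq: "p = (u, v)" by fastforce
  then have uv: "dt u \<in> total_points" "dt v \<in> total_points" "fst (dt u) = fst (dt v)"
    using p by (auto simp: topspace_fibre_product bproj_U)
  define w where "w = bmlt U u v"
  have w: "w \<in> topspace (Total U)" "bproj U w = bproj U u"
    using uv by (auto simp: w_def bmlt_U bproj_U)
  define a where "a z = through u (bproj U z)" for z
  define b where "b z = bmlt U (bundle_inv U (a z)) z" for z
  let ?F = "nhdsin (Total U) w"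
  have a: "limitin (Total U) a (a w) ?F"
    unfolding a_def using uv(1) limitin_bproj[OF limitin_ident[OF w(1)]] by (rule limitin_through)
  have aw: "a w = u"
    unfolding a_def w(2) using uv(1) by (rule through_self)
  have a_in: "dt (a z) \<in> total_points" "fst (dt (a z)) = fst (dt z)" if "z \<in> topspace (Total U)" for z
    using that uv by (simp_all add: a_def bproj_U) (simp add: through_def)
  have "limitin (Total U) b (b w) ?F"
    unfolding b_def
  proof (rule limitin_bmlt[OF limitin_bundle_inv[OF a] limitin_ident[OF w(1)]])
    have "bproj U (bundle_inv U (a z)) = bproj U z" if "z \<in> topspace (Total U)" for z
      using a_in[OF that] by (simp add: bundle_inv_U bproj_U)
    then show "bproj U (bundle_inv U (a w)) = bproj U w" "\<forall>\<^sub>F z in ?F. bproj U (bundle_inv U (a z)) = bproj U z"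
      using w(1) by (auto intro: eventually_nhdsinI)
  qed
  moreover have "b w = v"
    using uv unfolding b_def aw by (simp add: w_def bmlt_U bundle_inv_U flip: umul_assoc)
  moreover have "bmlt U (a z) (b z) = z \<and> bproj U (a z) = bproj U (b z)" if "z \<in> topspace (Total U)" for z
    using a_in[OF that] that by (simp add: b_def bmlt_U bundle_inv_U bproj_U flip: umul_assoc)
  then have "\<forall>\<^sub>F z in ?F. bmlt U (a z) (b z) = z \<and> bproj U (a z) = bproj U (b z)"
    by (auto intro: eventually_nhdsinI)
  ultimately show "\<exists>s. limitin (fibre_product (Total U) (bproj U) (Total U) (bproj U)) s p (nhdsin (Total U) (case p of (u, v) \<Rightarrow> bmlt U u v)) \<and>
     (\<forall>\<^sub>F y in nhdsin (Total U) (case p of (u, v) \<Rightarrow> bmlt U u v). (case s y of (u, v) \<Rightarrow> bmlt U u v) = y)"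
    using a uv unfolding p_eq w_def[symmetric] prod.case
    by (intro exI[of _ "\<lambda>z. (a z, b z)"])
      (auto simp: limitin_fibre_product aw bproj_U eventually_conj_iff)
qed

lemma topological_group_fibre:
  assumes q: "q \<in> topspace (Base U)"
  shows "topological_group (fibre_top U q) (fibre_group U q)"
  unfolding topological_group_def
proof (intro conjI)
  have fib: "limitin (fibre_top U q) h u F \<longleftrightarrow> limitin (Total U) h u F \<and> bproj U u = q \<and> (\<forall>\<^sub>F t in F. bproj U (h t) = q)" for h u and F :: "'x filter"
    by (auto simp: fibre_top_def limitin_subtopology)
  show "group (fibre_group U q)" using q by (rule group_fibre)
  show "topspace (fibre_top U q) = carrier (fibre_group U q)" by (simp add: fibre_group_def)
  have mult: "x \<otimes>\<^bsub>fibre_group U q\<^esub> y = bmlt U x y" for x y by (simp add: fibre_group_def)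
  show "continuous_map (prod_topology (fibre_top U q) (fibre_top U q)) (fibre_top U q) (\<lambda>(x, y). x \<otimes>\<^bsub>fibre_group U q\<^esub> y)"
    unfolding continuous_map_nhdsin
  proof
    fix p assume "p \<in> topspace (prod_topology (fibre_top U q) (fibre_top U q))"
    from limitin_ident[OF this] have l: "limitin (Total U) (\<lambda>p. fst p) (fst p) (nhdsin (prod_topology (fibre_top U q) (fibre_top U q)) p)"
      "limitin (Total U) (\<lambda>p. snd p) (snd p) (nhdsin (prod_topology (fibre_top U q) (fibre_top U q)) p)"
      "bproj U (fst p) = q" "bproj U (snd p) = q" 
      "\<forall>\<^sub>F p in nhdsin (prod_topology (fibre_top U q) (fibre_top U q)) p. bproj U (fst p) = q"
      "\<forall>\<^sub>F p in nhdsin (prod_topology (fibre_top U q) (fibre_top U q)) p. bproj U (snd p) = q"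
      by (auto simp: limitin_pairwise fib o_def)
    have "bproj U (bmlt U u v) = bproj U u" for u v by (simp add: bproj_U bmlt_U)
    then show "limitin (fibre_top U q) (\<lambda>(x, y). x \<otimes>\<^bsub>fibre_group U q\<^esub> y) (case p of (x, y) \<Rightarrow> x \<otimes>\<^bsub>fibre_group U q\<^esub> y)
         (nhdsin (prod_topology (fibre_top U q) (fibre_top U q)) p)"
      unfolding case_prod_unfold mult fib using l
      by (auto intro!: limitin_bmlt elim: eventually_elim2)
  qed
  show "continuous_map (fibre_top U q) (fibre_top U q) (\<lambda>x. inv\<^bsub>fibre_group U q\<^esub> x)"
  proof (rule continuous_map_eq)
    show "continuous_map (fibre_top U q) (fibre_top U q) (bundle_inv U)"
      unfolding fibre_top_def
      by (intro continuous_map_into_subtopology continuous_map_from_subtopology continuous_map_bundle_inv)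
        (auto simp: bundle_inv_U bproj_U)
    show "bundle_inv U x = inv\<^bsub>fibre_group U q\<^esub> x" if "x \<in> topspace (fibre_top U q)" for x
      using that by (simp add: bundle_inv_def fibre_top_def)
  qed
qed

lemma bundle_U: "bundle_of_topological_groups U"
  unfolding bundle_of_topological_groups_def
proof (intro conjI ballI)
  show "bproj U ` topspace (Total U) = topspace (Base U)"
  proof
    show "topspace (Base U) \<subseteq> bproj U ` topspace (Total U)"
    proof
      fix q assume "q \<in> topspace (Base U)"
      then have "q = bproj U (et (uone (db q)))" "et (uone (db q)) \<in> topspace (Total U)"
        by (simp_all add: bproj_U)
      then show "q \<in> bproj U ` topspace (Total U)" by (rule image_eqI)
    qed
  qed (auto simp: bproj_U)
qed (simp_all only: Hausdorff_Base continuous_map_bproj open_map_bproj topological_group_fibre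
    continuous_map_bmlt continuous_map_bundle_inv continuous_map_bone)

text \<open>Source and target coincide, so the pair of them is the proper projection paired with
  itself, over a Hausdorff base. The unit map is an embedding because the projection is its left
  inverse.\<close>

lemma proper_groupoid_U: "proper_groupoid (bundle_groupoid U)"
proof -
  have "groupoid_axioms (bundle_groupoid U)"
    unfolding groupoid_axioms_def bundle_groupoid_def groupoid.simps
    by (auto simp: bundle_inv_U bproj_U, auto simp: bmlt_U bone_U bproj_U bundle_inv_U umul_assoc)
  moreover have "embedding_map (Base U) (Total U) (bone U)"
  proof (rule section_imp_embedding_map)
    show "section_map (Base U) (Total U) (bone U)"
      unfolding section_map_def retraction_maps_def
      using continuous_map_bone continuous_map_bproj by (auto simp: bone_U bproj_U)
  qed
  moreover have "proper_map (Total U) (prod_topology (Base U) (Base U)) (\<lambda>u. (bproj U u, bproj U u))"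
    using proper_map_bproj Hausdorff_Base continuous_map_bproj by (intro proper_map_paired) auto
  ultimately show ?thesis
    unfolding proper_groupoid_def topological_groupoid_def bundle_groupoid_def groupoid.simps
    using Hausdorff_Base Hausdorff_Total continuous_map_bproj open_map_bproj continuous_map_bmlt
      open_map_bmlt continuous_map_bundle_inv continuous_map_bone by simp
qed

section \<open>The fibres as finite products of unitary groups\<close>

lemma unitary_mats_cunitary: "unitary_mats m = {A. cunitary 1 {..<m} {..<m} A}"
  by (auto simp: unitary_mats_def cunitary_def)

text \<open>Dividing the i-th matrix by its scale, for the finitely many i in the support of q,
  gives genuine unitary matrices; the remaining matrices are zero and carry no information. The
  fibre is compact by properness, so the continuous isomorphism is a homeomorphism.\<close>

lemma fibre_unitary:
  assumes q: "q \<in> topspace (Base U)"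
  shows "finite_product_of_unitary_groups (fibre_top U q) (fibre_group U q)"
proof -
  define c where "c = db q"
  define I where "I = {i. c i \<noteq> 0}"
  have fin: "finite I" and c: "c \<in> base_points"
    using q by (auto simp: I_def c_def base_points_def)
  \<comment> \<open>The target product is indexed by the positions of a list, so the support is
    enumerated: the factor at position m is the one of index L ! m.\<close>
  define L where "L = sorted_list_of_set I"
  define ns where "ns = map n L"
  have L: "bij_betw (\<lambda>m. L ! m) {..<length ns} I"
    using fin bij_betw_nth[of L "{..<length L}" "set L"] by (simp add: L_def ns_def)
  have ns: "ns ! m = n (L ! m)" if "m < length ns" for m using that by (simp add: ns_def)
  have index: "\<exists>m<length ns. L ! m = i" if "c i \<noteq> 0" for i
  proof -
    have "i \<in> (\<lambda>m. L ! m) ` {..<length ns}"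
      using bij_betw_imp_surj_on[OF L] that by (simp add: I_def)
    then show ?thesis by auto
  qed
  have cL: "c (L ! m) \<noteq> 0" if "m < length ns" for m using L that by (auto simp: bij_betw_def I_def)
  let ?T = "product_topology (\<lambda>i. unitary_top (ns ! i)) {..<length ns}"
  let ?K = "product_group {..<length ns} (\<lambda>i. unitary_group (ns ! i))"
  define f where "f u = (\<lambda>m\<in>{..<length ns}. \<lambda>j k. snd (dt u) (L ! m) j k / of_real (c (L ! m)))" for u
  have car: "u \<in> carrier (fibre_group U q) \<longleftrightarrow> dt u \<in> total_points \<and> fst (dt u) = c" for u
    by (auto simp: fibre_carrier c_def)
  have top: "topspace (fibre_top U q) = carrier (fibre_group U q)" by (simp add: fibre_group_def)
  have topT: "topspace ?T = carrier ?K"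
    by (simp add: unitary_top_def unitary_group_def)
  have f_in: "f u \<in> carrier ?K" if "u \<in> carrier (fibre_group U q)" for u
  proof -
    have "cunitary 1 (N (L ! m)) (N (L ! m)) (\<lambda>j k. snd (dt u) (L ! m) j k / of_real (c (L ! m)))" if "m < length ns" for m
      using cunitary_scale[OF total_pointsD(2)[of "dt u" "L ! m"], of "inverse (c (L ! m))"] cL[OF that] \<open>u \<in> _\<close>
      by (simp add: car divide_inverse mult.commute)
    then show ?thesis
      by (auto simp: f_def unitary_group_def unitary_mats_cunitary ns)
  qed
  have hom: "f \<in> hom (fibre_group U q) ?K"
  proof (rule homI)
    fix u v assume u: "u \<in> carrier (fibre_group U q)" and v: "v \<in> carrier (fibre_group U q)"
    show "f (u \<otimes>\<^bsub>fibre_group U q\<^esub> v) = f u \<otimes>\<^bsub>?K\<^esub> f v"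
    proof (rule ext)
      fix m
      show "f (u \<otimes>\<^bsub>fibre_group U q\<^esub> v) m = (f u \<otimes>\<^bsub>?K\<^esub> f v) m"
        using u cL[of m] unfolding car
        by (auto simp: f_def fibre_group_def bmlt_U umul_def mcomp_def unitary_group_def ns
            fun_eq_iff sum_divide_distrib)
    qed
  qed (rule f_in)
  have inj: "inj_on f (carrier (fibre_group U q))"
  proof (rule inj_onI)
    fix u v assume u: "u \<in> carrier (fibre_group U q)" and v: "v \<in> carrier (fibre_group U q)" and eq: "f u = f v"
    have "snd (dt u) i = snd (dt v) i" for i
    proof (cases "c i = 0")
      case True
      then show ?thesis
        using cunitary_zero[of "N i" "N i"] total_pointsD(2)[of _ i] u v unfolding car
        by (metis finite_lessThan)
    next
      case False
      then obtain m where m: "m < length ns" "L ! m = i" using index by blast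
      then have "f u m = f v m" using eq by simp
      then show ?thesis using m False by (auto simp: f_def fun_eq_iff)
    qed
    then have "dt u = dt v" using u v by (auto simp: car prod_eq_iff)
    then show "u = v" by (metis et_dt)
  qed
  have surj: "carrier ?K \<subseteq> f ` carrier (fibre_group U q)"
  proof
    fix y assume y: "y \<in> carrier ?K"
    \<comment> \<open>The inverse map: restore the scale, and put the zero matrix where the scale is
      0.\<close>
    define A where "A i = (if c i = 0 then (\<lambda>_ _. 0) else (\<lambda>j k. of_real (c i) * y (the_inv_into {..<length ns} (\<lambda>m. L ! m) i) j k))" for i
    have inv: "the_inv_into {..<length ns} (\<lambda>m. L ! m) (L ! m) = m" if "m < length ns" for m
      using L that by (simp add: bij_betw_def the_inv_into_f_f)
    have yu: "cunitary 1 (N (L ! m)) (N (L ! m)) (y m)" if "m < length ns" for m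
      using y that by (auto simp: unitary_group_def unitary_mats_cunitary ns PiE_iff)
    have "cunitary (c i) (N i) (N i) (A i)" for i
    proof (cases "c i = 0")
      case False
      then obtain m where m: "m < length ns" "L ! m = i" using index by blast
      then show ?thesis using cunitary_scale[OF yu[OF m(1)], of "c i"] False inv[OF m(1)] by (simp add: A_def)
    qed (simp add: A_def cunitary_0)
    then have u: "et (c, A) \<in> carrier (fibre_group U q)" using c by (simp add: car total_points_def)
    have "f (et (c, A)) m = y m" for m
      using y cL[of m] inv[of m] by (cases "m < length ns") (auto simp: f_def A_def PiE_iff extensional_def)
    then have "y = f (et (c, A))" by auto
    then show "y \<in> f ` carrier (fibre_group U q)" using u by blast
  qed
  have "homeomorphic_map (fibre_top U q) ?T f"
  proof (rule continuous_imp_homeomorphic_map)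
    show "continuous_map (fibre_top U q) ?T f"
      unfolding continuous_map_nhdsin
    proof
      fix u assume u: "u \<in> topspace (fibre_top U q)"
      let ?F = "nhdsin (fibre_top U q) u"
      have "limitin (Total U) (\<lambda>v. v) u ?F"
        using limitin_ident[OF u] by (simp add: fibre_top_def limitin_subtopology)
      then have l: "((\<lambda>v. snd (dt v) i j k) \<longlongrightarrow> snd (dt u) i j k) ?F" for i j k
        by (simp add: limitin_Total)
      have ev: "\<forall>\<^sub>F v in ?F. f v \<in> topspace ?T"
        using eventually_in_topspace_nhdsin f_in unfolding topT top[symmetric] by (rule eventually_mono)
      show "limitin ?T f (f u) ?F"
        unfolding limitin_componentwise
      proof (intro conjI ballI ev)
        show "f u \<in> extensional {..<length ns}" by (simp add: f_def)
        fix m assume m: "m \<in> {..<length ns}"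
        have "((\<lambda>v. f v m) \<longlongrightarrow> f u m) ?F"
          using m cL[of m] unfolding tendsto_fun_iff by (auto simp: f_def intro!: tendsto_intros l)
        then show "limitin (unitary_top (ns ! m)) (\<lambda>v. f v m) (f u m) ?F"
          using m ev f_in[of u] u top topT unfolding unitary_top_def limitin_subtopology
          by (auto simp: PiE_iff unitary_group_def elim!: eventually_mono)
      qed
    qed
    have "compactin (Total U) {u \<in> topspace (Total U). bproj U u = q}"
      using proper_map_bproj q unfolding proper_map_def by blast
    moreover have "fibre_top U q = subtopology (Total U) {u \<in> topspace (Total U). bproj U u = q}"
      using subtopology_restrict[of "Total U" "{u. bproj U u = q}"]
      by (simp add: fibre_top_def Collect_conj_eq del: in_Total)
    ultimately show "compact_space (fibre_top U q)"
      by (simp add: compact_space_subtopology)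
    show "Hausdorff_space ?T"
      unfolding Hausdorff_space_product_topology unitary_top_def
      by (simp add: Hausdorff_space_subtopology)
    show "f ` topspace (fibre_top U q) = topspace ?T"
      unfolding top topT using f_in surj by blast
    show "inj_on f (topspace (fibre_top U q))" unfolding top by (rule inj)
  qed
  moreover have "f \<in> iso (fibre_group U q) ?K"
    using hom inj surj f_in by (auto simp: iso_def bij_betw_def)
  ultimately show ?thesis
    unfolding finite_product_of_unitary_groups_def isomorphic_topological_groups_def by blast
qed

end

section \<open>The space of frames\<close>

type_synonym ('o, 'a) frames = "'o \<times> (nat \<Rightarrow> 'a \<Rightarrow> nat \<Rightarrow> complex)"

locale frame_space = proper_etale_groupoid G + unitary_bundle n
  for G :: "('a, 'o, 'm) groupoid_scheme" (structure) and n :: "nat \<Rightarrow> nat" +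
  fixes V :: "nat \<Rightarrow> 'o set" and w :: "nat \<Rightarrow> 'o \<Rightarrow> real"
  assumes open_V: "\<And>i. openin (Obj G) (V i)" and n_pos: "\<And>i. n i \<ge> 1"
    and cont_w: "\<And>i. continuous_map (Obj G) euclideanreal (w i)"
    and w_nonneg: "\<And>i y. y \<in> Ob \<Longrightarrow> 0 \<le> w i y" and w_le_1: "\<And>i y. y \<in> Ob \<Longrightarrow> w i y \<le> 1"
    and w_invariant: "\<And>i g. g \<in> Ar \<Longrightarrow> w i (s g) = w i (t g)"
    and w_even: "\<And>i y. y \<in> Ob \<Longrightarrow> w i y > 0 \<Longrightarrow> evenly_hit (V i) (n i) y"
    and w_cover: "\<And>x. x \<in> Ob \<Longrightarrow> \<exists>i. w i x > 0"
    and w_finite: "\<And>x. x \<in> Ob \<Longrightarrow> finite {i. w i x \<noteq> 0}"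
begin

abbreviation "W x \<equiv> (\<lambda>i. w i x)"
abbreviation "Q i x \<equiv> Fib (V i) x"

lemma W_in [simp]: "x \<in> Ob \<Longrightarrow> W x \<in> base_points"
  using w_nonneg w_le_1 w_finite by (simp add: base_points_def)

lemma limitin_w: "limitin (Obj G) y x F \<Longrightarrow> ((\<lambda>z. w i (y z)) \<longlongrightarrow> w i x) F"
  using continuous_map_limitin[OF cont_w] by fastforce

lemma
  assumes "x \<in> Ob" "w i x \<noteq> 0"
  shows finite_Q: "finite (Q i x)" and card_Q: "card (Q i x) = n i" and Q_nonempty: "Q i x \<noteq> {}"
    and bij_Q: "\<forall>\<^sub>F y in nhdsin (Obj G) x. bij_betw (\<lambda>g. sec g y) (Q i x) (Q i y)"
proof -
  have "evenly_hit (V i) (n i) x"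
    using assms w_nonneg[of x i] by (intro w_even) auto
  then show "finite (Q i x)" "card (Q i x) = n i"
    "\<forall>\<^sub>F y in nhdsin (Obj G) x. bij_betw (\<lambda>g. sec g y) (Q i x) (Q i y)"
    by (auto simp: evenly_hit_def)
  then show "Q i x \<noteq> {}"
    using n_pos[of i] by auto
qed

lemma sec_Q: "g \<in> Q i x \<Longrightarrow> sec g x = g"
  using sec_s[of g] by (simp add: Fib_def)

lemma section_in_V:
  assumes "g \<in> Q i x"
  shows "\<exists>O'. openin (Obj G) O' \<and> x \<in> O' \<and> (\<forall>y\<in>O'. local_section (sec g) y \<and> t (sec g y) \<in> V i)"
proof -
  have g: "g \<in> Ar" "s g = x" "t g \<in> V i" using assms by (simp_all add: Fib_def)
  have "\<forall>\<^sub>F y in nhdsin (Obj G) x. t (sec g y) \<in> V i"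
    using limitinD[OF limitin_t[OF limitin_sec[OF g(1)]] open_V g(3)] g(2) by simp
  then have "\<forall>\<^sub>F y in nhdsin (Obj G) x. local_section (sec g) y \<and> t (sec g y) \<in> V i"
    using eventually_local_section_sec[OF g(1)] g(2) by (simp add: eventually_conj_iff)
  then show ?thesis
    using g s_in[OF g(1)] by (auto simp: eventually_nhdsin)
qed

lemma eventually_sec_in_Q:
  assumes g: "g \<in> Q i x" and y: "limitin (Obj G) y x F"
  shows "\<forall>\<^sub>F z in F. sec g (y z) \<in> Q i (y z)"
proof -
  obtain O' where O': "openin (Obj G) O'" "x \<in> O'" "\<forall>y\<in>O'. local_section (sec g) y \<and> t (sec g y) \<in> V i"
    using section_in_V[OF g] by blast
  have "\<forall>\<^sub>F z in F. y z \<in> O'" using limitinD[OF y O'(1,2)] .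
  then show ?thesis
    by eventually_elim (use O'(3) in \<open>simp add: Fib_def local_section_in local_section_s\<close>)
qed

text \<open>A point of \<open>E\<close> over \<open>x\<close> consists of orthonormal bases, scaled by \<open>w i x\<close>, of the Hilbert
  spaces of functions on the sets \<open>Q i x\<close> of arrows from \<open>x\<close> to \<open>V i\<close>.\<close>

definition E_points :: "('o, 'a) frames set" where
  "E_points = {(x, f). x \<in> Ob \<and> (\<forall>i. cunitary (w i x) (Q i x) (N i) (f i))}"

text \<open>The row index is an arrow with source \<open>fst e\<close> and moves with the base
  point, so an entry can only be followed along a local section into \<open>V i\<close>. The base
  point and these entries are what is made continuous.\<close>

definition E_subbase :: "('o, 'a) frames set set" where
  "E_subbase = {{e \<in> E_points. fst e \<in> O'} | O'. openin (Obj G) O'} \<union>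
     {{e \<in> E_points. fst e \<in> O' \<and> snd e i (\<sigma> (fst e)) k \<in> B} | O' i \<sigma> k B.
        openin (Obj G) O' \<and> open B \<and> (\<forall>y\<in>O'. local_section \<sigma> y \<and> t (\<sigma> y) \<in> V i)}"

definition E :: "('o, 'a) frames topology" where
  "E = topology_generated_by E_subbase"

lemma E_pointsD:
  assumes "e \<in> E_points"
  shows "fst e \<in> Ob" "cunitary (w i (fst e)) (Q i (fst e)) (N i) (snd e i)"
  using assms by (auto simp: E_points_def)

lemma E_points_bound: "e \<in> E_points \<Longrightarrow> cmod (snd e i g k) \<le> w i (fst e)"
  using cunitary_bound[OF E_pointsD(2)] w_nonneg E_pointsD(1) by simp

lemma E_zero:
  assumes "e \<in> E_points" "w i (fst e) = 0"
  shows "snd e i = (\<lambda>_ _. 0)"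
  using cunitary_zero[of "Q i (fst e)" "N i" "snd e i"] E_pointsD(2)[OF assms(1), of i] assms(2) by simp

lemma E_subbase_Obj: "openin (Obj G) O' \<Longrightarrow> {e \<in> E_points. fst e \<in> O'} \<in> E_subbase"
  by (auto simp: E_subbase_def)

lemma E_subbase_entry:
  "openin (Obj G) O' \<Longrightarrow> open B \<Longrightarrow> (\<forall>y\<in>O'. local_section \<sigma> y \<and> t (\<sigma> y) \<in> V i) \<Longrightarrow>
   {e \<in> E_points. fst e \<in> O' \<and> snd e i (\<sigma> (fst e)) k \<in> B} \<in> E_subbase"
  unfolding E_subbase_def by blast

lemma Union_E_subbase: "\<Union>E_subbase = E_points"
proof
  show "\<Union>E_subbase \<subseteq> E_points" by (auto simp: E_subbase_def)
  have "E_points = {e \<in> E_points. fst e \<in> Ob}" by (auto simp: E_points_def)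
  then have "E_points \<in> E_subbase" using E_subbase_Obj[OF openin_topspace] by simp
  then show "E_points \<subseteq> \<Union>E_subbase" by blast
qed

lemma topspace_E [simp]: "topspace E = E_points"
  by (simp add: E_def Union_E_subbase)

text \<open>It suffices to follow entries along the sections \<open>sec g\<close>, because any other
  local section through g agrees with \<open>sec g\<close> near the base point.\<close>

lemma limitin_E:
  "limitin E m e F \<longleftrightarrow> e \<in> E_points \<and> (\<forall>\<^sub>F z in F. m z \<in> E_points) \<and>
     limitin (Obj G) (\<lambda>z. fst (m z)) (fst e) F \<and>
     (\<forall>i k. \<forall>g \<in> Q i (fst e). ((\<lambda>z. snd (m z) i (sec g (fst (m z))) k) \<longlongrightarrow> snd e i g k) F)"
  (is "?L \<longleftrightarrow> ?R")
proof
  assume L: ?L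
  have e: "e \<in> E_points" using limitin_topspace[OF L] by simp
  have ev: "\<forall>\<^sub>F z in F. m z \<in> S" if "S \<in> E_subbase" "e \<in> S" for S
    using L that unfolding E_def limitin_topology_generated_by by blast
  have "\<forall>\<^sub>F z in F. m z \<in> E_points"
    using limitin_eventually_topspace[OF L] by simp
  moreover have "limitin (Obj G) (\<lambda>z. fst (m z)) (fst e) F"
    unfolding limitin_def
  proof (intro conjI allI impI)
    fix O' assume O': "openin (Obj G) O' \<and> fst e \<in> O'"
    then have "\<forall>\<^sub>F z in F. m z \<in> {e \<in> E_points. fst e \<in> O'}"
      using e by (intro ev E_subbase_Obj) auto
    then show "\<forall>\<^sub>F z in F. fst (m z) \<in> O'" by (rule eventually_mono) auto
  qed (use e E_pointsD in blast)
  moreover have "((\<lambda>z. snd (m z) i (sec g (fst (m z))) k) \<longlongrightarrow> snd e i g k) F" if g: "g \<in> Q i (fst e)" for i k g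
    unfolding tendsto_def
  proof (intro allI impI)
    fix B assume B: "open B" "snd e i g k \<in> B"
    obtain O' where O': "openin (Obj G) O'" "fst e \<in> O'" "\<forall>y\<in>O'. local_section (sec g) y \<and> t (sec g y) \<in> V i"
      using section_in_V[OF g] by blast
    have "sec g (fst e) = g" using sec_Q[OF g] .
    then have "\<forall>\<^sub>F z in F. m z \<in> {e \<in> E_points. fst e \<in> O' \<and> snd e i (sec g (fst e)) k \<in> B}"
      using e B O' by (intro ev E_subbase_entry) auto
    then show "\<forall>\<^sub>F z in F. snd (m z) i (sec g (fst (m z))) k \<in> B" by (rule eventually_mono) auto
  qed
  ultimately show ?R using e by (intro conjI allI ballI)
next
  assume R: ?R
  then have e: "e \<in> E_points" and ev: "\<forall>\<^sub>F z in F. m z \<in> E_points"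
    and l: "limitin (Obj G) (\<lambda>z. fst (m z)) (fst e) F"
    and ent: "\<And>i k g. g \<in> Q i (fst e) \<Longrightarrow> ((\<lambda>z. snd (m z) i (sec g (fst (m z))) k) \<longlongrightarrow> snd e i g k) F"
    by auto
  have "\<forall>\<^sub>F z in F. m z \<in> S" if S: "S \<in> E_subbase" "e \<in> S" for S
  proof -
    show ?thesis
      using S(1) unfolding E_subbase_def
    proof (elim UnE CollectE exE conjE)
      fix O' assume *: "S = {e \<in> E_points. fst e \<in> O'}" "openin (Obj G) O'"
      then have "\<forall>\<^sub>F z in F. fst (m z) \<in> O'" using limitinD[OF l] S(2) by simp
      with ev show ?thesis unfolding * by eventually_elim simp
    next
      fix O' i \<sigma> k B
      assume *: "S = {e \<in> E_points. fst e \<in> O' \<and> snd e i (\<sigma> (fst e)) k \<in> B}"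
        "openin (Obj G) O'" "open B" "\<forall>y\<in>O'. local_section \<sigma> y \<and> t (\<sigma> y) \<in> V i"
      have x: "fst e \<in> O'" using S(2) * by simp
      then have \<sigma>: "local_section \<sigma> (fst e)" "t (\<sigma> (fst e)) \<in> V i" using * by auto
      then have g: "\<sigma> (fst e) \<in> Q i (fst e)" by (simp add: Fib_def local_section_in local_section_s)
      have "\<forall>\<^sub>F z in F. fst (m z) \<in> O'" using limitinD[OF l *(2) x] .
      moreover have "\<forall>\<^sub>F z in F. sec (\<sigma> (fst e)) (fst (m z)) = \<sigma> (fst (m z))"
        using eventually_limitin[OF l local_section_eq_sec[OF \<sigma>(1)]] .
      moreover have "\<forall>\<^sub>F z in F. snd (m z) i (sec (\<sigma> (fst e)) (fst (m z))) k \<in> B"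
        using topological_tendstoD[OF ent[OF g] *(3)] S(2) *(1) by simp
      ultimately show ?thesis using ev unfolding *(1) by eventually_elim simp
    qed
  qed
  then show ?L unfolding E_def limitin_topology_generated_by using e Union_E_subbase by simp
qed

text \<open>Where the weight vanishes in the limit the entries are squeezed to 0 by it; only indices
  of non-zero weight remain to be examined.\<close>

lemma limitin_EI:
  assumes e: "e \<in> E_points" and ev: "\<forall>\<^sub>F z in F. m z \<in> E_points"
    and l: "limitin (Obj G) (\<lambda>z. fst (m z)) (fst e) F"
    and ent: "\<And>i k g. w i (fst e) \<noteq> 0 \<Longrightarrow> g \<in> Q i (fst e) \<Longrightarrow>
      ((\<lambda>z. snd (m z) i (sec g (fst (m z))) k) \<longlongrightarrow> snd e i g k) F"
  shows "limitin E m e F"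
  unfolding limitin_E
proof (intro conjI allI ballI e ev l)
  fix i k g assume g: "g \<in> Q i (fst e)"
  show "((\<lambda>z. snd (m z) i (sec g (fst (m z))) k) \<longlongrightarrow> snd e i g k) F"
  proof (cases "w i (fst e) = 0")
    case True
    have "((\<lambda>z. snd (m z) i (sec g (fst (m z))) k) \<longlongrightarrow> 0) F"
    proof (rule Lim_null_comparison)
      show "\<forall>\<^sub>F z in F. norm (snd (m z) i (sec g (fst (m z))) k) \<le> w i (fst (m z))"
        using ev by eventually_elim (rule E_points_bound)
      show "((\<lambda>z. w i (fst (m z))) \<longlongrightarrow> 0) F"
        using limitin_w[OF l, of i] True by simp
    qed
    then show ?thesis using E_zero[OF e True] by simp
  qed (use ent g in blast)
qed

lemma limitin_ED:
  assumes "limitin E m e F"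
  shows "e \<in> E_points" "\<forall>\<^sub>F z in F. m z \<in> E_points" "limitin (Obj G) (\<lambda>z. fst (m z)) (fst e) F"
    "g \<in> Q i (fst e) \<Longrightarrow> ((\<lambda>z. snd (m z) i (sec g (fst (m z))) k) \<longlongrightarrow> snd e i g k) F"
  using assms by (simp_all add: limitin_E)

lemma limitin_E_entry:
  assumes m: "limitin E m e F" and h: "limitin (Arr G) h g F" and g: "g \<in> Q i (fst e)"
    and sh: "\<forall>\<^sub>F z in F. s (h z) = fst (m z)"
  shows "((\<lambda>z. snd (m z) i (h z) k) \<longlongrightarrow> snd e i g k) F"
proof (rule Lim_transform_eventually[OF limitin_ED(4)[OF m g]])
  show "\<forall>\<^sub>F z in F. snd (m z) i (sec g (fst (m z))) k = snd (m z) i (h z) k"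
    using limitin_eventually_sec'[OF h sh] by eventually_elim simp
qed

lemma continuous_map_fst_E: "continuous_map E (Obj G) fst"
  unfolding continuous_map_nhdsin using limitin_ED(3)[OF limitin_ident] by auto

text \<open>Different frames over the same object differ at an entry indexed by some arrow of
  \<open>Q i\<close>, and this entry, followed along a section, separates them.\<close>

lemma Hausdorff_E: "Hausdorff_space E"
  unfolding Hausdorff_space_def
proof (intro allI impI)
  fix e e' assume "e \<in> topspace E \<and> e' \<in> topspace E \<and> e \<noteq> e'"
  then have e: "e \<in> E_points" "e' \<in> E_points" "e \<noteq> e'" by auto
  have op: "openin E S" if "S \<in> E_subbase" for S
    using that by (simp add: E_def topology_generated_by_Basis)
  show "\<exists>S S'. openin E S \<and> openin E S' \<and> e \<in> S \<and> e' \<in> S' \<and> disjnt S S'"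
  proof (cases "fst e = fst e'")
    case False
    then obtain O1 O2 where "openin (Obj G) O1" "openin (Obj G) O2" "fst e \<in> O1" "fst e' \<in> O2" "disjnt O1 O2"
      using Hausdorff_Obj E_pointsD(1) e unfolding Hausdorff_space_def by metis
    then show ?thesis
      using e by (intro exI[of _ "{e \<in> E_points. fst e \<in> O1}"] exI[of _ "{e \<in> E_points. fst e \<in> O2}"])
        (auto simp: disjnt_iff intro!: op E_subbase_Obj)
  next
    case True
    then obtain i g k where ne: "snd e i g k \<noteq> snd e' i g k"
      using e(3) by (auto simp: prod_eq_iff fun_eq_iff)
    then have g: "g \<in> Q i (fst e)"
      using cunitary_outside[OF E_pointsD(2)[OF e(1)]] cunitary_outside[OF E_pointsD(2)[OF e(2)]] True by metis
    obtain O' where O': "openin (Obj G) O'" "fst e \<in> O'" "\<forall>y\<in>O'. local_section (sec g) y \<and> t (sec g y) \<in> V i"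
      using section_in_V[OF g] by blast
    obtain B B' where B: "open B" "open B'" "snd e i g k \<in> B" "snd e' i g k \<in> B'" "B \<inter> B' = {}"
      using hausdorff[OF ne] by blast
    have "sec g (fst e) = g" using sec_Q[OF g] .
    then show ?thesis
      using e O' B True
      by (intro exI[of _ "{e \<in> E_points. fst e \<in> O' \<and> snd e i (sec g (fst e)) k \<in> B}"]
          exI[of _ "{e \<in> E_points. fst e \<in> O' \<and> snd e i (sec g (fst e)) k \<in> B'}"] conjI op E_subbase_entry)
        (auto simp: disjnt_iff)
  qed
qed

lemma ex_frame:
  assumes "x \<in> Ob" shows "\<exists>M. cunitary (w i x) (Q i x) (N i) M"
  by (rule cunitary_exists) (use finite_Q[OF assms] card_Q[OF assms] in simp_all)

lemma fst_E_points: "fst ` E_points = Ob"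
proof
  show "Ob \<subseteq> fst ` E_points"
  proof
    fix x assume x: "x \<in> Ob"
    obtain f where "\<And>i. cunitary (w i x) (Q i x) (N i) (f i)" using ex_frame[OF x] by metis
    then have "(x, f) \<in> E_points" using x by (simp add: E_points_def)
    then show "x \<in> fst ` E_points" by force
  qed
qed (use E_pointsD in auto)

text \<open>The frame e is carried along the sections \<open>sec g\<close> to objects y near x and
  rescaled from \<open>w i x\<close> to \<open>w i y\<close>. Only the finitely many i of non-zero
  weight at x need this care, so one neighbourhood serves for all of them.\<close>

lemma open_map_fst_E: "open_map E (Obj G) fst"
proof (rule open_map_local_sections)
  show "fst \<in> topspace E \<rightarrow> topspace (Obj G)" using E_pointsD(1) by auto
  fix e assume "e \<in> topspace E"
  then have e: "e \<in> E_points" by simp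
  define x where "x = fst e"
  define I where "I = {i. w i x \<noteq> 0}"
  have x: "x \<in> Ob" using E_pointsD(1)[OF e] by (simp add: x_def)
  have I: "finite I" using w_finite[OF x] by (simp add: I_def)
  let ?P = "\<lambda>y e'. e' \<in> E_points \<and> fst e' = y \<and>
    (\<forall>i\<in>I. \<forall>g\<in>Q i x. \<forall>k. snd e' i (sec g y) k = of_real (w i y / w i x) * snd e i g k)"
  have "\<forall>\<^sub>F y in nhdsin (Obj G) x. \<forall>i\<in>I. bij_betw (\<lambda>g. sec g y) (Q i x) (Q i y)"
    using bij_Q[OF x] by (intro eventually_ball_finite[OF I]) (auto simp: I_def)
  with eventually_in_topspace_nhdsin[of "Obj G" x]
  have ex: "\<forall>\<^sub>F y in nhdsin (Obj G) x. \<exists>e'. ?P y e'"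
  proof eventually_elim
    case (elim y)
    obtain f where f: "\<And>i. cunitary (w i y) (Q i y) (N i) (f i)" using ex_frame[OF elim(1)] by metis
    define b where "b i = the_inv_into (Q i x) (\<lambda>g. sec g y)" for i
    define M where "M i = (\<lambda>h k. if h \<in> Q i y then of_real (w i y / w i x) * snd e i (b i h) k else 0)" for i
    have "cunitary (w i y) (Q i y) (N i) (M i)" if i: "i \<in> I" for i
    proof -
      have "bij_betw (b i) (Q i y) (Q i x)"
        unfolding b_def using bij_betw_the_inv_into elim(2) i by blast
      moreover have "cunitary (w i y / w i x * w i x) (Q i x) (N i) (\<lambda>g k. of_real (w i y / w i x) * snd e i g k)"
        unfolding x_def using cunitary_scale[OF E_pointsD(2)[OF e]] .
      ultimately have "cunitary (w i y / w i x * w i x) (Q i y) (N i) (M i)"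
        unfolding M_def by (rule cunitary_reindex[rotated])
      then show ?thesis using i by (simp add: I_def)
    qed
    moreover have "M i (sec g y) k = of_real (w i y / w i x) * snd e i g k" if "i \<in> I" "g \<in> Q i x" for i g k
    proof -
      have "bij_betw (\<lambda>g. sec g y) (Q i x) (Q i y)" using elim(2) that by blast
      then have "b i (sec g y) = g" "sec g y \<in> Q i y"
        using that the_inv_into_f_f[of "\<lambda>g. sec g y" "Q i x" g] unfolding b_def by (auto simp: bij_betw_def)
      then show ?thesis by (simp add: M_def)
    qed
    \<comment> \<open>At an index that is collapsed at x every choice of frames converges to 0, so
      the arbitrary f is good enough there.\<close>
    ultimately have "?P y (y, \<lambda>i. if i \<in> I then M i else f i)"
      using f elim(1) by (simp add: E_points_def)
    then show ?case by blast
  qed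
  define \<sigma> where "\<sigma> y = (SOME e'. ?P y e')" for y
  have \<sigma>: "\<forall>\<^sub>F y in nhdsin (Obj G) x. ?P y (\<sigma> y)"
    using ex unfolding \<sigma>_def by eventually_elim (rule someI_ex)
  have fst\<sigma>: "\<forall>\<^sub>F y in nhdsin (Obj G) x. fst (\<sigma> y) = y"
    using \<sigma> by eventually_elim simp
  have "limitin E \<sigma> e (nhdsin (Obj G) x)"
  proof (rule limitin_EI[OF e])
    show "\<forall>\<^sub>F y in nhdsin (Obj G) x. \<sigma> y \<in> E_points" using \<sigma> by eventually_elim simp
    have "\<forall>\<^sub>F y in nhdsin (Obj G) x. y = fst (\<sigma> y)"
      using fst\<sigma> by eventually_elim simp
    then show "limitin (Obj G) (\<lambda>y. fst (\<sigma> y)) (fst e) (nhdsin (Obj G) x)"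
      using limitin_ident[OF x] unfolding x_def by (rule limitin_transform_eventually)
    fix i k g assume i: "w i (fst e) \<noteq> 0" and g: "g \<in> Q i (fst e)"
    have "((\<lambda>y. of_real (w i y / w i x) * snd e i g k) \<longlongrightarrow> of_real (w i x / w i x) * snd e i g k) (nhdsin (Obj G) x)"
      using i limitin_w[OF limitin_ident[OF x], of i] by (intro tendsto_intros) (auto simp: x_def)
    moreover have "\<forall>\<^sub>F y in nhdsin (Obj G) x. of_real (w i y / w i x) * snd e i g k = snd (\<sigma> y) i (sec g (fst (\<sigma> y))) k"
      using \<sigma> by eventually_elim (use i g in \<open>simp add: I_def x_def\<close>)
    ultimately show "((\<lambda>y. snd (\<sigma> y) i (sec g (fst (\<sigma> y))) k) \<longlongrightarrow> snd e i g k) (nhdsin (Obj G) x)"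
      using i by (simp add: x_def Lim_transform_eventually)
  qed
  then show "\<exists>\<sigma>. limitin E \<sigma> e (nhdsin (Obj G) (fst e)) \<and> (\<forall>\<^sub>F y in nhdsin (Obj G) (fst e). fst (\<sigma> y) = y)"
    using fst\<sigma> unfolding x_def by blast
qed

subsection \<open>The action of the groupoid\<close>

definition lact :: "'a \<Rightarrow> ('o, 'a) frames \<Rightarrow> ('o, 'a) frames" where
  "lact a e = (t a, \<lambda>i g k. if g \<in> Q i (t a) then snd e i (\<mu> g a) k else 0)"

lemma fst_lact [simp]: "fst (lact a e) = t a"
  and snd_lact: "g \<in> Q i (t a) \<Longrightarrow> snd (lact a e) i g k = snd e i (\<mu> g a) k"
  by (simp_all add: lact_def)

lemma \<mu>_in_Q: "g \<in> Q i (t a) \<Longrightarrow> a \<in> Ar \<Longrightarrow> \<mu> g a \<in> Q i (s a)"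
  by (simp add: Fib_def)

text \<open>Right translation by a maps \<open>Q i (t a)\<close> bijectively to
  \<open>Q i (s a)\<close>, so rows are merely renamed; invariance of the weights keeps the
  scale.\<close>

lemma lact_in [simp]:
  assumes "a \<in> Ar" "e \<in> E_points" "s a = fst e"
  shows "lact a e \<in> E_points"
proof -
  have "cunitary (w i (fst e)) (Q i (t a)) (N i) (\<lambda>g k. if g \<in> Q i (t a) then snd e i (\<mu> g a) k else 0)" for i
    using cunitary_reindex[OF E_pointsD(2)[OF assms(2)] bij_betw_Fib_\<mu>[OF assms(1), of "V i", unfolded assms(3)]] .
  then show ?thesis
    using assms w_invariant[OF assms(1)] by (simp add: E_points_def lact_def)
qed

lemma E_eqI:
  assumes "e \<in> E_points" "e' \<in> E_points" "fst e = fst e'"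
    and "\<And>i g k. g \<in> Q i (fst e) \<Longrightarrow> snd e i g k = snd e' i g k"
  shows "e = e'"
proof -
  have "snd e i g k = snd e' i g k" for i g k
    using assms(3,4) cunitary_outside[OF E_pointsD(2)[OF assms(1)]] cunitary_outside[OF E_pointsD(2)[OF assms(2)]]
    by (cases "g \<in> Q i (fst e)") auto
  then show ?thesis using assms(3) by (auto simp: prod_eq_iff fun_eq_iff)
qed

lemma lact_uni [simp]:
  assumes "e \<in> E_points" "x = fst e" shows "lact (uni G x) e = e"
proof (rule E_eqI)
  have "fst e \<in> Ob" using assms E_pointsD(1) by blast
  then show "snd (lact (uni G x) e) i g k = snd e i g k" if "g \<in> Q i (fst (lact (uni G x) e))" for i g k
    using that assms by (simp add: snd_lact) (simp add: Fib_def)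
qed (use assms E_pointsD(1) in auto)

lemma lact_lact:
  assumes "b \<in> Ar" "a \<in> Ar" "e \<in> E_points" "s b = t a" "s a = fst e"
  shows "lact b (lact a e) = lact (\<mu> b a) e"
proof (rule E_eqI)
  fix i g k assume "g \<in> Q i (fst (lact b (lact a e)))"
  then have g: "g \<in> Q i (t b)" by simp
  then have "\<mu> g b \<in> Q i (t a)" using \<mu>_in_Q[OF g assms(1)] assms by simp
  then have "snd (lact b (lact a e)) i g k = snd e i (\<mu> (\<mu> g b) a) k"
    using g by (simp add: snd_lact)
  also have "\<mu> (\<mu> g b) a = \<mu> g (\<mu> b a)"
    using g assms by (intro \<mu>_assoc) (auto simp: Fib_def)
  finally show "snd (lact b (lact a e)) i g k = snd (lact (\<mu> b a) e) i g k"
    using g assms by (simp add: snd_lact)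
qed (use assms in auto)

text \<open>A row of the translate at the continuation of g is the row of \<open>m z\<close> at the
  product with \<open>a z\<close>; these products converge to an arrow of \<open>Q i\<close>, so
  \<open>limitin_E_entry\<close> applies.\<close>

lemma limitin_lact:
  assumes a: "limitin (Arr G) a a0 F" and m: "limitin E m e F"
    and "s a0 = fst e" "\<forall>\<^sub>F z in F. s (a z) = fst (m z)"
  shows "limitin E (\<lambda>z. lact (a z) (m z)) (lact a0 e) F"
proof (rule limitin_EI)
  have a0: "a0 \<in> Ar" using limitin_topspace[OF a] .
  then show "lact a0 e \<in> E_points" using assms limitin_ED(1)[OF m] by simp
  have aA: "\<forall>\<^sub>F z in F. a z \<in> Ar" using limitin_eventually_topspace[OF a] .
  then show "\<forall>\<^sub>F z in F. lact (a z) (m z) \<in> E_points"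
    using assms(4) limitin_ED(2)[OF m] by eventually_elim simp
  show lt: "limitin (Obj G) (\<lambda>z. fst (lact (a z) (m z))) (fst (lact a0 e)) F"
    using limitin_t[OF a] by simp
  fix i k g assume "g \<in> Q i (fst (lact a0 e))"
  then have g: "g \<in> Q i (t a0)" "g \<in> Ar" "s g = t a0" by (simp_all add: Fib_def)
  let ?h = "\<lambda>z. sec g (t (a z))"
  have lt': "limitin (Obj G) (\<lambda>z. t (a z)) (s g) F" using lt g by simp
  have h: "\<forall>\<^sub>F z in F. ?h z \<in> Q i (t (a z))"
    using eventually_sec_in_Q[OF g(1)] lt by simp
  have "((\<lambda>z. snd (m z) i (\<mu> (?h z) (a z)) k) \<longlongrightarrow> snd e i (\<mu> g a0) k) F"
  proof (rule limitin_E_entry[OF m])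
    show "limitin (Arr G) (\<lambda>z. \<mu> (?h z) (a z)) (\<mu> g a0) F"
      by (rule limitin_\<mu>[OF limitin_sec'[OF g(2) lt'] a g(3)]) (use h in \<open>eventually_elim, simp add: Fib_def\<close>)
    show "\<mu> g a0 \<in> Q i (fst e)" using \<mu>_in_Q[OF g(1) a0] assms by simp
    show "\<forall>\<^sub>F z in F. s (\<mu> (?h z) (a z)) = fst (m z)"
      using h assms(4) aA by eventually_elim (simp add: Fib_def)
  qed
  moreover have "\<forall>\<^sub>F z in F. snd (m z) i (\<mu> (?h z) (a z)) k = snd (lact (a z) (m z)) i (sec g (fst (lact (a z) (m z)))) k"
    using h by eventually_elim (simp add: snd_lact)
  ultimately show "((\<lambda>z. snd (lact (a z) (m z)) i (sec g (fst (lact (a z) (m z)))) k) \<longlongrightarrow> snd (lact a0 e) i g k) F"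
    unfolding snd_lact[OF g(1)] by (rule Lim_transform_eventually)
qed

section \<open>Recovering arrows from pairs of frames\<close>

lemma ex_weight_Q:
  assumes "x \<in> Ob" obtains i g where "w i x \<noteq> 0" "g \<in> Q i x"
  using w_cover[OF assms] Q_nonempty[OF assms] by (metis less_irrefl equals0I)

text \<open>Distinct arrows have distinct rows, because the rows are orthogonal and non-zero.\<close>

lemma lact_inj:
  assumes "a \<in> Ar" "b \<in> Ar" "e \<in> E_points" "s a = fst e" "s b = fst e" "lact a e = lact b e"
  shows "a = b"
proof -
  have ta: "t a = t b" using arg_cong[OF assms(6), of fst] by simp
  have "t a \<in> Ob" using assms by simp
  then obtain i g where i: "w i (t a) \<noteq> 0" and g: "g \<in> Q i (t a)"
    by (rule ex_weight_Q)
  have "snd e i (\<mu> g a) k = snd e i (\<mu> g b) k" for k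
    using snd_lact[OF g, of e k] snd_lact[of g i b e k] g assms(6) ta by simp
  then have "\<mu> g a = \<mu> g b"
    using cunitary_row_inj[OF E_pointsD(2)[OF assms(3), of i], of "\<mu> g a" "\<mu> g b"]
      \<mu>_in_Q[OF g assms(1)] \<mu>_in_Q[of g i b] g i assms(1,2,4,5) ta w_invariant[OF assms(1)] by (simp add: fun_eq_iff)
  then have "\<mu> (\<iota> g) (\<mu> g a) = \<mu> (\<iota> g) (\<mu> g b)" by simp
  then show ?thesis using g assms(1,2) ta by (simp add: Fib_def)
qed

definition related where
  "related e' e \<longleftrightarrow> (\<exists>a\<in>Ar. s a = fst e \<and> e' = lact a e)"

lemma related_refl: "e \<in> E_points \<Longrightarrow> related e e"
  unfolding related_def using E_pointsD(1) by (intro bexI[of _ "uni G (fst e)"]) auto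

lemma related_sym:
  assumes "related e' e" "e \<in> E_points" shows "related e e'"
proof -
  obtain a where "a \<in> Ar" "s a = fst e" "e' = lact a e" using assms unfolding related_def by blast
  then show ?thesis
    using assms(2) unfolding related_def by (intro bexI[of _ "\<iota> a"]) (auto simp: lact_lact)
qed

lemma related_trans:
  assumes "related e'' e'" "related e' e" "e \<in> E_points" shows "related e'' e"
proof -
  obtain a b where "a \<in> Ar" "s a = fst e" "e' = lact a e" "b \<in> Ar" "s b = fst e'" "e'' = lact b e'"
    using assms unfolding related_def by blast
  then show ?thesis
    using assms(3) unfolding related_def by (intro bexI[of _ "\<mu> b a"]) (auto simp: lact_lact)
qed

lemma related_in: "related e' e \<Longrightarrow> e \<in> E_points \<Longrightarrow> e' \<in> E_points"
  unfolding related_def by auto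

lemma recover_arrow:
  assumes "h \<in> Q i (t a)" "a \<in> Ar"
  shows "\<mu> (\<iota> h) (\<mu> h a) = a"
  using assms by (simp add: Fib_def)

text \<open>An arrow a is the product of the inverse of h with the product of h and a. If both h and
  that product follow sections, they converge, and so does a.\<close>

lemma limitin_arrow_from_Q:
  assumes h: "h \<in> Q i y" and g: "g \<in> Ar" "t g = t h" and gs: "s g = x"
    and ly: "limitin (Obj G) y' y F" and lx: "limitin (Obj G) x' x F"
    and ev: "\<forall>\<^sub>F z in F. a z \<in> Ar \<and> t (a z) = y' z \<and> \<mu> (sec h (y' z)) (a z) = sec g (x' z)"
  shows "limitin (Arr G) a (\<mu> (\<iota> h) g) F"
proof -
  have h': "h \<in> Ar" "s h = y" using h by (auto simp: Fib_def)
  have hz: "\<forall>\<^sub>F z in F. sec h (y' z) \<in> Q i (y' z)" using eventually_sec_in_Q[OF h ly] .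
  have 1: "limitin (Arr G) (\<lambda>z. \<iota> (sec h (y' z))) (\<iota> h) F"
    using limitin_\<iota>[OF limitin_sec'[OF h'(1)]] ly h'(2) by simp
  have 2: "limitin (Arr G) (\<lambda>z. sec g (x' z)) g F"
    using limitin_sec'[OF g(1)] lx gs by simp
  have "limitin (Arr G) (\<lambda>z. \<mu> (\<iota> (sec h (y' z))) (sec g (x' z))) (\<mu> (\<iota> h) g) F"
  proof (rule limitin_\<mu>[OF 1 2])
    show "s (\<iota> h) = t g" using h' g by simp
    show "\<forall>\<^sub>F z in F. s (\<iota> (sec h (y' z))) = t (sec g (x' z))"
      using ev hz
    proof eventually_elim
      case (elim z)
      then have "t (sec g (x' z)) = t (\<mu> (sec h (y' z)) (a z))" by simp
      also have "\<dots> = t (sec h (y' z))" by (rule t_\<mu>) (use elim in \<open>auto simp: Fib_def\<close>)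
      finally show ?case using elim by (simp add: Fib_def)
    qed
  qed
  moreover have "\<forall>\<^sub>F z in F. \<mu> (\<iota> (sec h (y' z))) (sec g (x' z)) = a z"
    using ev hz
  proof eventually_elim
    case (elim z)
    then show ?case using recover_arrow[of "sec h (y' z)" i "a z"] by simp
  qed
  ultimately show ?thesis by (rule limitin_transform_eventually[rotated])
qed

text \<open>The product lies in the fibre over \<open>x' z\<close>, all of whose elements continue
  one of the finitely many arrows in \<open>Q i x\<close>. So only finitely many candidates for
  \<open>a z\<close> have to be considered.\<close>

lemma eventually_translate_eq_sec:
  assumes h: "h \<in> Q i y" and wx: "w i x \<noteq> 0"
    and ly: "limitin (Obj G) y' y F" and lx: "limitin (Obj G) x' x F"
    and a: "\<forall>\<^sub>F z in F. a z \<in> Ar \<and> s (a z) = x' z \<and> t (a z) = y' z"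
  shows "\<forall>\<^sub>F z in F. \<exists>g\<in>Q i x. \<mu> (sec h (y' z)) (a z) = sec g (x' z)"
  using a eventually_sec_in_Q[OF h ly] eventually_limitin[OF lx bij_Q[OF limitin_topspace[OF lx] wx]]
proof eventually_elim
  case (elim z)
  then have "\<mu> (sec h (y' z)) (a z) \<in> Q i (x' z)"
    using \<mu>_in_Q[of "sec h (y' z)" i "a z"] by simp
  then show ?case
    using bij_betw_imp_surj_on[OF elim(3)] by blast
qed

text \<open>Continuity of the division map. The product of the continued h with \<open>a z\<close>
  continues one of finitely many arrows g. If g is not the product of h and a0, the rows of e at
  these two arrows differ in a coordinate k; comparing row h of \<open>m' z\<close> with row g of
  \<open>m z\<close> there excludes g eventually.\<close>

lemma limitin_translation:
  assumes m: "limitin E m e F" and m': "limitin E m' e' F"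
    and ev: "\<forall>\<^sub>F z in F. a z \<in> Ar \<and> s (a z) = fst (m z) \<and> m' z = lact (a z) (m z)"
    and a0: "a0 \<in> Ar" "s a0 = fst e" "e' = lact a0 e"
  shows "limitin (Arr G) a a0 F"
proof -
  have e: "e \<in> E_points" using limitin_ED(1)[OF m] .
  obtain i h where i: "w i (t a0) \<noteq> 0" and h: "h \<in> Q i (t a0)"
    using ex_weight_Q[of "t a0"] a0(1) by auto
  have x: "fst e \<in> Ob" and wx: "w i (fst e) \<noteq> 0" using E_pointsD(1)[OF e] i w_invariant[OF a0(1)] a0(2) by simp_all
  have lx: "limitin (Obj G) (\<lambda>z. fst (m z)) (fst e) F" using limitin_ED(3)[OF m] .
  have ly: "limitin (Obj G) (\<lambda>z. fst (m' z)) (t a0) F" using limitin_ED(3)[OF m'] a0(3) by simp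
  let ?h = "\<lambda>z. sec h (fst (m' z))"
  let ?g0 = "\<mu> h a0"
  have g0: "?g0 \<in> Q i (fst e)" using \<mu>_in_Q[OF h a0(1)] a0(2) by simp
  have hz: "\<forall>\<^sub>F z in F. ?h z \<in> Q i (fst (m' z))" using eventually_sec_in_Q[OF h ly] .
  have at: "\<forall>\<^sub>F z in F. a z \<in> Ar \<and> s (a z) = fst (m z) \<and> t (a z) = fst (m' z)"
    using ev by eventually_elim simp
  have "\<forall>\<^sub>F z in F. \<forall>g\<in>Q i (fst e) - {?g0}. \<mu> (?h z) (a z) \<noteq> sec g (fst (m z))"
  proof (rule eventually_ball_finite, simp add: finite_Q[OF x wx], rule ballI)
    fix g assume g: "g \<in> Q i (fst e) - {?g0}"
    then have "snd e i g \<noteq> snd e i ?g0"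
      using cunitary_row_inj[OF E_pointsD(2)[OF e, of i] wx] g0 by blast
    then obtain k where k: "snd e i g k \<noteq> snd e i ?g0 k" by auto
    have "((\<lambda>z. snd (m z) i (sec g (fst (m z))) k) \<longlongrightarrow> snd e i g k) F"
      using limitin_ED(4)[OF m] g by blast
    moreover have "((\<lambda>z. snd (m' z) i (?h z) k) \<longlongrightarrow> snd e i ?g0 k) F"
      using limitin_ED(4)[OF m', of h i k] h a0(3) snd_lact[OF h] by simp
    ultimately have "((\<lambda>z. snd (m z) i (sec g (fst (m z))) k - snd (m' z) i (?h z) k) \<longlongrightarrow> snd e i g k - snd e i ?g0 k) F"
      by (rule tendsto_diff)
    then have "\<forall>\<^sub>F z in F. snd (m z) i (sec g (fst (m z))) k - snd (m' z) i (?h z) k \<noteq> 0"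
      by (rule tendsto_imp_eventually_ne) (use k in simp)
    with ev hz show "\<forall>\<^sub>F z in F. \<mu> (?h z) (a z) \<noteq> sec g (fst (m z))"
    proof eventually_elim
      case (elim z)
      then have "snd (m' z) i (?h z) k = snd (m z) i (\<mu> (?h z) (a z)) k"
        by (simp add: snd_lact)
      then show ?case using elim(3) by auto
    qed
  qed
  with at eventually_translate_eq_sec[OF h wx ly lx at]
  have "\<forall>\<^sub>F z in F. a z \<in> Ar \<and> t (a z) = fst (m' z) \<and> \<mu> (?h z) (a z) = sec ?g0 (fst (m z))"
  proof eventually_elim
    case (elim z)
    then show ?case by auto
  qed
  from limitin_arrow_from_Q[OF h _ _ _ ly lx this]
  have "limitin (Arr G) a (\<mu> (\<iota> h) ?g0) F"
    using g0 h a0 by (simp add: Fib_def)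
  then show ?thesis using recover_arrow[OF h a0(1)] by simp
qed

text \<open>The orbit relation is closed, which makes the quotient Hausdorff. Among the finitely
  many candidates for the product of h with the connecting arrow one recurs along the filter; on
  that subfilter the connecting arrows converge, and with them the translated frames.\<close>

lemma limitin_related:
  assumes F: "F \<noteq> bot" and m: "limitin E m e F" and m': "limitin E m' e' F"
    and ev: "\<forall>\<^sub>F z in F. related (m' z) (m z)"
  shows "related e' e"
proof -
  have e: "e \<in> E_points" "e' \<in> E_points" using limitin_ED(1) m m' by blast+
  define a where "a z = (SOME a. a \<in> Ar \<and> s a = fst (m z) \<and> m' z = lact a (m z))" for z
  have a: "\<forall>\<^sub>F z in F. a z \<in> Ar \<and> s (a z) = fst (m z) \<and> m' z = lact (a z) (m z)"
    using ev
  proof eventually_elim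
    case (elim z)
    then have "\<exists>a. a \<in> Ar \<and> s a = fst (m z) \<and> m' z = lact a (m z)"
      unfolding related_def by blast
    then show ?case unfolding a_def by (rule someI_ex)
  qed
  have lx: "limitin (Obj G) (\<lambda>z. fst (m z)) (fst e) F" using limitin_ED(3)[OF m] .
  have ly: "limitin (Obj G) (\<lambda>z. fst (m' z)) (fst e') F" using limitin_ED(3)[OF m'] .
  have x: "fst e \<in> Ob" "fst e' \<in> Ob" using E_pointsD(1) e by blast+
  obtain i h where i: "w i (fst e') \<noteq> 0" and h: "h \<in> Q i (fst e')"
    using ex_weight_Q[OF x(2)] .
  have "\<forall>\<^sub>F z in F. w i (fst (m' z)) = w i (fst (m z))"
    using a
  proof eventually_elim
    case (elim z)
    then show ?case using w_invariant[of "a z" i] by simp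
  qed
  \<comment> \<open>Weights agree along the filter by invariance, hence in the limit, so the index i
    is active at both ends.\<close>
  then have "w i (fst e) = w i (fst e')"
    using tendsto_unique[OF F limitin_w[OF lx, of i] Lim_transform_eventually[OF limitin_w[OF ly, of i]]] by blast
  then have wx: "w i (fst e) \<noteq> 0" using i by simp
  let ?h = "\<lambda>z. sec h (fst (m' z))"
  have hz: "\<forall>\<^sub>F z in F. ?h z \<in> Q i (fst (m' z))" using eventually_sec_in_Q[OF h ly] .
  have at: "\<forall>\<^sub>F z in F. a z \<in> Ar \<and> s (a z) = fst (m z) \<and> t (a z) = fst (m' z)"
    using a by eventually_elim simp
  note exg = eventually_translate_eq_sec[OF h wx ly lx at]
  have "\<exists>g\<in>Q i (fst e). \<exists>\<^sub>F z in F. \<mu> (?h z) (a z) = sec g (fst (m z))"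
  proof (rule ccontr)
    assume "\<not> ?thesis"
    then have "\<forall>\<^sub>F z in F. \<forall>g\<in>Q i (fst e). \<mu> (?h z) (a z) \<noteq> sec g (fst (m z))"
      by (intro eventually_ball_finite[OF finite_Q[OF x(1) wx]]) (simp add: frequently_def)
    with exg have "\<forall>\<^sub>F z in F. False" by eventually_elim blast
    then show False using F by simp
  qed
  then obtain g where g: "g \<in> Q i (fst e)" and fr: "\<exists>\<^sub>F z in F. \<mu> (?h z) (a z) = sec g (fst (m z))"
    by blast
  \<comment> \<open>The subfilter on which the recurring g is attained; it plays the role of a
    convergent subsequence.\<close>
  define F' where "F' = inf F (principal {z. \<mu> (?h z) (a z) = sec g (fst (m z))})"
  have F': "F' \<noteq> bot"
    using fr unfolding F'_def frequently_def by (simp add: trivial_limit_def eventually_inf_principal)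
  have le: "F' \<le> F" by (simp add: F'_def)
  have lim: "limitin X f l F \<Longrightarrow> limitin X f l F'" for X :: "'y topology" and f l
    using filterlim_mono[OF _ order_refl le] by (auto simp: limitin_filterlim)
  have ev': "\<forall>\<^sub>F z in F'. a z \<in> Ar \<and> t (a z) = fst (m' z) \<and> \<mu> (?h z) (a z) = sec g (fst (m z))"
    unfolding F'_def eventually_inf_principal using a by eventually_elim auto
  \<comment> \<open>The targets agree along the subfilter, hence in the limit as the objects form a
    Hausdorff space; only then can the inverse of h be composed with g.\<close>
  have tg: "t g = t h"
  proof -
    have "limitin (Obj G) (\<lambda>z. t (sec g (fst (m z)))) (t g) F'"
      using limitin_t[OF limitin_sec'[of g "\<lambda>z. fst (m z)" F']] lim[OF lx] g by (simp add: Fib_def)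
    moreover have "limitin (Obj G) (\<lambda>z. t (?h z)) (t h) F'"
      using limitin_t[OF limitin_sec'[of h "\<lambda>z. fst (m' z)" F']] lim[OF ly] h by (simp add: Fib_def)
    moreover have "\<forall>\<^sub>F z in F'. t (?h z) = t (sec g (fst (m z)))"
      using ev' filter_leD[OF le hz]
    proof eventually_elim
      case (elim z)
      then have "t (sec g (fst (m z))) = t (\<mu> (?h z) (a z))" by simp
      also have "\<dots> = t (?h z)" by (rule t_\<mu>) (use elim in \<open>auto simp: Fib_def\<close>)
      finally show ?case by simp
    qed
    ultimately show ?thesis
      using limitin_Hausdorff_unique[OF _ limitin_transform_eventually F' Hausdorff_Obj] by meson
  qed
  have la: "limitin (Arr G) a (\<mu> (\<iota> h) g) F'"
    by (rule limitin_arrow_from_Q[OF h _ tg _ lim[OF ly] lim[OF lx] ev']) (use g in \<open>auto simp: Fib_def\<close>)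
  have a0: "\<mu> (\<iota> h) g \<in> Ar" "s (\<mu> (\<iota> h) g) = fst e"
    using h g tg by (auto simp: Fib_def)
  have "limitin E (\<lambda>z. lact (a z) (m z)) (lact (\<mu> (\<iota> h) g) e) F'"
    by (rule limitin_lact[OF la lim[OF m] a0(2)]) (use filter_leD[OF le a] in \<open>eventually_elim, simp\<close>)
  moreover have "\<forall>\<^sub>F z in F'. lact (a z) (m z) = m' z"
    using filter_leD[OF le a] by eventually_elim simp
  ultimately have "limitin E m' (lact (\<mu> (\<iota> h) g) e) F'"
    by (rule limitin_transform_eventually[rotated])
  then have "e' = lact (\<mu> (\<iota> h) g) e"
    using limitin_Hausdorff_unique[OF lim[OF m'] _ F' Hausdorff_E] by blast
  then show ?thesis using a0 unfolding related_def by blast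
qed

subsection \<open>The action of the bundle of unitary groups\<close>

definition base_of :: "('o, 'a) frames \<Rightarrow> point" where
  "base_of e = eb (W (fst e))"

definition ract :: "('o, 'a) frames \<Rightarrow> point \<Rightarrow> ('o, 'a) frames" where
  "ract e u = (fst e, \<lambda>i. mcomp (w i (fst e)) (N i) (snd e i) (snd (dt u) i))"

text \<open>The matrices of e* e' in scaled form, that is, the group element which carries e to e'
  when the two frames lie over the same object.\<close>

definition quot where
  "quot e e' = et (W (fst e), \<lambda>i. mcomp (w i (fst e)) (Q i (fst e)) (madj (snd e i)) (snd e' i))"

lemma fst_ract [simp]: "fst (ract e u) = fst e"
  by (simp add: ract_def)

lemma base_of_eq_bproj: "base_of e = bproj U u \<longleftrightarrow> fst (dt u) = W (fst e)"
  by (auto simp: base_of_def bproj_U)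

lemma base_of_in: "e \<in> E_points \<Longrightarrow> base_of e \<in> topspace (Base U)"
  using E_pointsD(1) by (simp add: base_of_def)

lemma ract_in [simp]:
  assumes "e \<in> E_points" "dt u \<in> total_points" "fst (dt u) = W (fst e)"
  shows "ract e u \<in> E_points"
proof -
  have "cunitary (w i (fst e)) (Q i (fst e)) (N i) (mcomp (w i (fst e)) (N i) (snd e i) (snd (dt u) i))" for i
    by (rule cunitary_mcomp[OF E_pointsD(2)[OF assms(1)]])
      (use total_pointsD(2)[OF assms(2), of i] assms finite_Q E_pointsD(1) in auto)
  then show ?thesis using E_pointsD(1)[OF assms(1)] by (simp add: E_points_def ract_def)
qed

lemma ract_bone: "e \<in> E_points \<Longrightarrow> ract e (bone U (base_of e)) = e"
  using mcomp_mid_right[OF E_pointsD(2)] by (simp add: ract_def bone_U base_of_def uone_def prod_eq_iff)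

lemma ract_ract:
  "fst (dt u) = W (fst e) \<Longrightarrow> ract (ract e u) v = ract e (bmlt U u v)"
  by (simp add: ract_def bmlt_U umul_def mcomp_assoc)

text \<open>Arrows act on the rows and unitary matrices on the columns.\<close>

lemma ract_lact:
  assumes "a \<in> Ar" "e \<in> E_points" "s a = fst e" "dt u \<in> total_points" "fst (dt u) = W (fst e)"
  shows "ract (lact a e) u = lact a (ract e u)"
  using assms w_invariant[OF assms(1)]
  by (auto simp: ract_def lact_def mcomp_def fun_eq_iff)

lemma quot_in:
  assumes "e \<in> E_points" "e' \<in> E_points" "fst e' = fst e"
  shows "dt (quot e e') \<in> total_points" "fst (dt (quot e e')) = W (fst e)"
proof -
  have "cunitary (w i (fst e)) (N i) (N i) (mcomp (w i (fst e)) (Q i (fst e)) (madj (snd e i)) (snd e' i))" for i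
    using E_pointsD(2)[OF assms(2), of i] finite_Q[OF E_pointsD(1)[OF assms(1)], of i] assms(3)
    by (intro cunitary_mcomp[OF cunitary_madj[OF E_pointsD(2)[OF assms(1)]]]) auto
  then show "dt (quot e e') \<in> total_points" using E_pointsD(1)[OF assms(1)] by (simp add: quot_def total_points_def)
qed (simp add: quot_def)

lemma ract_quot:
  assumes "e \<in> E_points" "e' \<in> E_points" "fst e' = fst e"
  shows "ract e (quot e e') = e'"
proof -
  have "mcomp (w i (fst e)) (N i) (snd e i) (mcomp (w i (fst e)) (Q i (fst e)) (madj (snd e i)) (snd e' i)) = snd e' i" for i
    using mcomp_madj_right[OF E_pointsD(2)[OF assms(1), of i]] E_pointsD(2)[OF assms(2), of i]
      finite_Q[OF E_pointsD(1)[OF assms(1)], of i] assms(3)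
    by (simp add: mcomp_mid_left flip: mcomp_assoc)
  then show ?thesis using assms by (simp add: ract_def quot_def prod_eq_iff)
qed

lemma quot_ract:
  assumes "e \<in> E_points" "dt u \<in> total_points" "fst (dt u) = W (fst e)"
  shows "quot e (ract e u) = u"
proof -
  have "mcomp (w i (fst e)) (Q i (fst e)) (madj (snd e i)) (mcomp (w i (fst e)) (N i) (snd e i) (snd (dt u) i)) = snd (dt u) i" for i
    using mcomp_madj_left[OF E_pointsD(2)[OF assms(1), of i]] total_pointsD(2)[OF assms(2), of i] assms(3)
    by (simp add: mcomp_mid_left flip: mcomp_assoc)
  then have "dt (quot e (ract e u)) = dt u" using assms(3) by (simp add: ract_def quot_def prod_eq_iff)
  then show ?thesis by (metis et_dt)
qed

lemma limitin_ract:
  assumes m: "limitin E m e F" and v: "limitin (Total U) v u F" and "fst (dt u) = W (fst e)"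
    and ev: "\<forall>\<^sub>F z in F. fst (dt (v z)) = W (fst (m z))"
  shows "limitin E (\<lambda>z. ract (m z) (v z)) (ract e u) F"
proof (rule limitin_EI)
  show "ract e u \<in> E_points" using limitin_ED(1)[OF m] limitin_TotalD(1)[OF v] assms(3) by simp
  show "\<forall>\<^sub>F z in F. ract (m z) (v z) \<in> E_points"
    using limitin_ED(2)[OF m] limitin_TotalD(2)[OF v] ev by eventually_elim simp
  show "limitin (Obj G) (\<lambda>z. fst (ract (m z) (v z))) (fst (ract e u)) F" using limitin_ED(3)[OF m] by simp
  fix i k g assume "g \<in> Q i (fst (ract e u))"
  then have g: "g \<in> Q i (fst e)" by simp
  have "((\<lambda>z. (\<Sum>l\<in>N i. snd (m z) i (sec g (fst (m z))) l * snd (dt (v z)) i l k) / of_real (w i (fst (m z)))) \<longlongrightarrow>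
     (\<Sum>l\<in>N i. snd e i g l * snd (dt u) i l k) / of_real (w i (fst e))) F"
  proof (rule tendsto_scaled_sum)
    show "\<forall>\<^sub>F z in F. \<forall>l\<in>N i. cmod (snd (m z) i (sec g (fst (m z))) l) \<le> w i (fst (m z))"
      using limitin_ED(2)[OF m] by eventually_elim (simp add: E_points_bound)
    show "\<forall>\<^sub>F z in F. \<forall>l\<in>N i. cmod (snd (dt (v z)) i l k) \<le> w i (fst (m z))"
      using limitin_TotalD(2)[OF v] ev
    proof eventually_elim
      case (elim z)
      then show ?case using total_points_bound[OF elim(1), of i _ k] by simp
    qed
  qed (use limitin_ED(4)[OF m g] limitin_TotalD(4)[OF v] limitin_w[OF limitin_ED(3)[OF m]] in simp_all)
  then show "((\<lambda>z. snd (ract (m z) (v z)) i (sec g (fst (ract (m z) (v z)))) k) \<longlongrightarrow> snd (ract e u) i g k) F"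
    by (simp add: ract_def mcomp_def)
qed

text \<open>The sum is over arrows that move with the base point. Where the weight is non-zero,
  \<open>bij_Q\<close> turns it into a sum over a fixed finite set; where it vanishes, the entries
  are squeezed to 0.\<close>

lemma limitin_quot:
  assumes m: "limitin E m e F" and m': "limitin E m' e' F" and "fst e' = fst e"
    and ev: "\<forall>\<^sub>F z in F. fst (m' z) = fst (m z)"
  shows "limitin (Total U) (\<lambda>z. quot (m z) (m' z)) (quot e e') F"
proof -
  have e: "e \<in> E_points" "e' \<in> E_points" using limitin_ED(1) m m' by blast+
  have x: "fst e \<in> Ob" using E_pointsD(1)[OF e(1)] .
  have in_tot: "\<forall>\<^sub>F z in F. dt (quot (m z) (m' z)) \<in> total_points \<and> fst (dt (quot (m z) (m' z))) = W (fst (m z))"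
    using limitin_ED(2)[OF m] limitin_ED(2)[OF m'] ev by eventually_elim (simp add: quot_in)
  have lx: "limitin (Obj G) (\<lambda>z. fst (m z)) (fst e) F" using limitin_ED(3)[OF m] .
  have "((\<lambda>z. snd (dt (quot (m z) (m' z))) i k l) \<longlongrightarrow> snd (dt (quot e e')) i k l) F" for i k l
  proof (cases "w i (fst e) = 0")
    case True
    have "((\<lambda>z. snd (dt (quot (m z) (m' z))) i k l) \<longlongrightarrow> 0) F"
    proof (rule Lim_null_comparison)
      show "\<forall>\<^sub>F z in F. norm (snd (dt (quot (m z) (m' z))) i k l) \<le> w i (fst (m z))"
        using in_tot
      proof eventually_elim
        case (elim z)
        then show ?case using total_points_bound[of "dt (quot (m z) (m' z))" i k l] by simp
      qed
      show "((\<lambda>z. w i (fst (m z))) \<longlongrightarrow> 0) F" using limitin_w[OF lx, of i] True by simp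
    qed
    then show ?thesis using True by (simp add: quot_def)
  next
    case False
    have "((\<lambda>z. (\<Sum>g\<in>Q i (fst e). cnj (snd (m z) i (sec g (fst (m z))) k) * snd (m' z) i (sec g (fst (m z))) l)
        / of_real (w i (fst (m z)))) \<longlongrightarrow>
        (\<Sum>g\<in>Q i (fst e). cnj (snd e i g k) * snd e' i g l) / of_real (w i (fst e))) F"
    proof (intro tendsto_intros limitin_ED(4)[OF m] limitin_w[OF lx])
      fix g assume "g \<in> Q i (fst e)"
      then have "((\<lambda>z. snd (m' z) i (sec g (fst (m' z))) l) \<longlongrightarrow> snd e' i g l) F"
        using limitin_ED(4)[OF m'] assms(3) by simp
      then show "((\<lambda>z. snd (m' z) i (sec g (fst (m z))) l) \<longlongrightarrow> snd e' i g l) F"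
        by (rule Lim_transform_eventually) (use ev in \<open>eventually_elim, simp\<close>)
    qed (use False in auto)
    moreover have "\<forall>\<^sub>F z in F. (\<Sum>g\<in>Q i (fst e). cnj (snd (m z) i (sec g (fst (m z))) k) * snd (m' z) i (sec g (fst (m z))) l)
        / of_real (w i (fst (m z))) = snd (dt (quot (m z) (m' z))) i k l"
      using eventually_limitin[OF lx bij_Q[OF x False]]
    proof eventually_elim
      case (elim z)
      show ?case
        using sum.reindex_bij_betw[OF elim, of "\<lambda>h. cnj (snd (m z) i h k) * snd (m' z) i h l"]
        by (simp add: quot_def mcomp_def madj_def)
    qed
    ultimately show ?thesis
      by (simp add: quot_def mcomp_def madj_def Lim_transform_eventually)
  qed
  moreover have "\<forall>\<^sub>F z in F. dt (quot (m z) (m' z)) \<in> total_points" using in_tot by eventually_elim simp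
  moreover have "((\<lambda>z. fst (dt (quot (m z) (m' z))) i) \<longlongrightarrow> fst (dt (quot e e')) i) F" for i
    using limitin_w[OF lx] by (simp add: quot_def)
  ultimately show ?thesis using quot_in(1)[OF e assms(3)] by (simp add: limitin_Total)
qed

lemma limitin_base_of:
  assumes m: "limitin E m e F" shows "limitin (Base U) (\<lambda>z. base_of (m z)) (base_of e) F"
proof -
  have "\<forall>\<^sub>F z in F. W (fst (m z)) \<in> base_points"
    using limitin_ED(2)[OF m] by eventually_elim (simp add: E_pointsD(1))
  then show ?thesis
    using E_pointsD(1)[OF limitin_ED(1)[OF m]] limitin_w[OF limitin_ED(3)[OF m]]
    by (simp add: limitin_Base base_of_def)
qed

end

lemma inj_nat_set_second_countable:
  assumes "second_countable X" "Hausdorff_space X"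
  shows "\<exists>c :: 'a \<Rightarrow> nat set. inj_on c (topspace X)"
proof -
  obtain \<B> where \<B>: "countable \<B>" "\<forall>V\<in>\<B>. openin X V"
    "\<forall>U x. openin X U \<and> x \<in> U \<longrightarrow> (\<exists>V\<in>\<B>. x \<in> V \<and> V \<subseteq> U)"
    using assms(1) unfolding second_countable_def by metis
  define c where "c x = {j. x \<in> from_nat_into \<B> j}" for x
  have "c x \<noteq> c y" if xy: "x \<in> topspace X" "y \<in> topspace X" "x \<noteq> y" for x y
  proof -
    obtain O1 O2 where O1: "openin X O1" "x \<in> O1" "y \<in> O2" "disjnt O1 O2"
      using assms(2) xy unfolding Hausdorff_space_def by metis
    then obtain B where B: "B \<in> \<B>" "x \<in> B" "B \<subseteq> O1" using \<B>(3) by metis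
    then obtain j where "B = from_nat_into \<B> j" using from_nat_into_surj[OF \<B>(1)] by metis
    then have "j \<in> c x" "j \<notin> c y" using B O1 by (auto simp: c_def disjnt_iff)
    then show ?thesis by blast
  qed
  then have "inj_on c (topspace X)" by (meson inj_onI)
  then show ?thesis by blast
qed

text \<open>The product of a quotient map with an identity need not be a quotient map. Openness of f
  suffices, since the images f(A) \<times> B of open boxes are open.\<close>

lemma continuous_map_fibre_product_open_map:
  assumes f: "open_map X P f" "f ` topspace X = topspace P"
    and h: "continuous_map (fibre_product X (\<phi> \<circ> f) T r) Z (\<lambda>(e, u). k (f e) u)"
  shows "continuous_map (fibre_product P \<phi> T r) Z (\<lambda>(p, u). k p u)"
  unfolding continuous_map_nhdsin
proof
  fix q assume q: "q \<in> topspace (fibre_product P \<phi> T r)"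
  obtain p u where q_eq: "q = (p, u)" by fastforce
  then have pu: "p \<in> topspace P" "u \<in> topspace T" "\<phi> p = r u" using q by (auto simp: topspace_fibre_product)
  then obtain e where e: "e \<in> topspace X" "p = f e" using f(2) by blast
  let ?X = "fibre_product X (\<phi> \<circ> f) T r"
  have eu: "(e, u) \<in> topspace ?X" using e pu by (simp add: topspace_fibre_product)
  have "limitin Z (\<lambda>(e, u). k (f e) u) (k p u) (nhdsin ?X (e, u))"
    using h eu e unfolding continuous_map_nhdsin by fastforce
  note lim = this
  show "limitin Z (\<lambda>(p, u). k p u) (case q of (p, u) \<Rightarrow> k p u) (nhdsin (fibre_product P \<phi> T r) q)"
    unfolding q_eq prod.case limitin_def
  proof (intro conjI allI impI)
    show "k p u \<in> topspace Z" using limitin_topspace[OF lim] .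
    fix V assume V: "openin Z V \<and> k p u \<in> V"
    then have "\<forall>\<^sub>F x in nhdsin ?X (e, u). (case x of (e, u) \<Rightarrow> k (f e) u) \<in> V"
      using limitinD[OF lim] by blast
    then obtain S where S: "openin ?X S" "(e, u) \<in> S" "\<forall>x\<in>S. (case x of (e, u) \<Rightarrow> k (f e) u) \<in> V"
      using eu unfolding eventually_nhdsin by blast
    then obtain S' where S': "openin (prod_topology X T) S'" "S = S' \<inter> {(x, y). (\<phi> \<circ> f) x = r y}"
      unfolding fibre_product_def openin_subtopology by blast
    then have eu': "(e, u) \<in> S'" using S(2) by simp
    obtain A B where AB: "openin X A" "openin T B" "e \<in> A" "u \<in> B" "A \<times> B \<subseteq> S'"
      using S'(1)[unfolded openin_prod_topology_alt, rule_format, OF eu'] by blast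
    have fA: "openin P (f ` A)" using f(1) AB(1) unfolding open_map_def by blast
    have "openin (fibre_product P \<phi> T r) ((f ` A \<times> B) \<inter> {(x, y). \<phi> x = r y})"
      unfolding fibre_product_def openin_subtopology
      using fA AB(2) by (intro exI[of _ "f ` A \<times> B"]) (auto simp: openin_prod_Times_iff)
    moreover have "(p, u) \<in> (f ` A \<times> B) \<inter> {(x, y). \<phi> x = r y}" using AB e pu by auto
    ultimately have "\<forall>\<^sub>F x in nhdsin (fibre_product P \<phi> T r) (p, u). x \<in> (f ` A \<times> B) \<inter> {(x, y). \<phi> x = r y}"
      by (rule eventually_nhdsin_open)
    then show "\<forall>\<^sub>F x in nhdsin (fibre_product P \<phi> T r) (p, u). (case x of (p, u) \<Rightarrow> k p u) \<in> V"
    proof eventually_elim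
      case (elim x)
      then obtain e' u' where x: "x = (f e', u')" "e' \<in> A" "u' \<in> B" "\<phi> (f e') = r u'" by auto
      then have "(e', u') \<in> S" using AB(5) S'(2) by auto
      then show ?case using S(3) x(1) by fastforce
    qed
  qed
qed

context unitary_bundle
begin

abbreviation "TU \<equiv> topspace (Total U)"

lemma bmlt_in: "u \<in> TU \<Longrightarrow> v \<in> TU \<Longrightarrow> bproj U u = bproj U v \<Longrightarrow> bmlt U u v \<in> TU"
  and bproj_bmlt: "bproj U (bmlt U u v) = bproj U u"
  and bproj_in: "u \<in> TU \<Longrightarrow> bproj U u \<in> topspace (Base U)"
  and bmlt_assoc: "bproj U u = bproj U v \<Longrightarrow> bmlt U (bmlt U u v) z = bmlt U u (bmlt U v z)"
  and bone_in: "q \<in> topspace (Base U) \<Longrightarrow> bone U q \<in> TU"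
  and bproj_bone: "bproj U (bone U q) = q"
  and bmlt_bone: "u \<in> TU \<Longrightarrow> bproj U u = q \<Longrightarrow> bmlt U u (bone U q) = u"
  and bone_bmlt: "u \<in> TU \<Longrightarrow> bproj U u = q \<Longrightarrow> bmlt U (bone U q) u = u"
  and bundle_inv_in: "u \<in> TU \<Longrightarrow> bundle_inv U u \<in> TU"
  and bproj_bundle_inv: "u \<in> TU \<Longrightarrow> bproj U (bundle_inv U u) = bproj U u"
  and bmlt_bundle_inv: "u \<in> TU \<Longrightarrow> bmlt U u (bundle_inv U u) = bone U (bproj U u)"
  and bundle_inv_bmlt: "u \<in> TU \<Longrightarrow> bmlt U (bundle_inv U u) u = bone U (bproj U u)"
  and through_TU: "u \<in> TU \<Longrightarrow> q \<in> topspace (Base U) \<Longrightarrow> through u q \<in> TU"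
  by (auto simp: bproj_U bmlt_U bone_U bundle_inv_U umul_assoc)

lemmas bundle_simps = bmlt_in bproj_bmlt bproj_in bone_in bproj_bone bmlt_bone bone_bmlt bundle_inv_in
  bproj_bundle_inv bmlt_bundle_inv bundle_inv_bmlt through_TU bproj_through

end

section \<open>The quotient of the space of frames\<close>

context frame_space
begin

text \<open>A frame is determined by its object and, for each i of non-zero weight, by its entries
  in an enumeration of the finite set \<open>Q i x\<close>; all other rows vanish. Hence E has at
  most the cardinality of the continuum.\<close>

lemma ex_code: "\<exists>c :: _ \<Rightarrow> point. inj_on c E_points"
proof -
  obtain cO :: "'o \<Rightarrow> nat set" where cO: "inj_on cO Ob"
    using inj_nat_set_second_countable[OF second_countable Hausdorff_Obj] by blast
  obtain cm :: "(nat \<Rightarrow> nat \<Rightarrow> nat \<Rightarrow> complex) \<Rightarrow> nat set" where cm: "bij cm"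
    using bij_matrices_nat_set by blast
  obtain h :: "nat set \<times> nat set \<Rightarrow> nat set" where h: "bij h"
    using bij_prod_nat_set[OF bij_id bij_id] by blast
  have "\<exists>b. w i x \<noteq> 0 \<longrightarrow> Q i x \<subseteq> range (b :: nat \<Rightarrow> 'a)" if x: "x \<in> Ob" for i x
  proof (cases "w i x = 0")
    case False
    then obtain b where "bij_betw b {0..<card (Q i x)} (Q i x)"
      using ex_bij_betw_nat_finite[OF finite_Q[OF x False]] by blast
    then have "Q i x \<subseteq> range b" by (auto simp: bij_betw_def)
    then show ?thesis by blast
  qed simp
  note ex_b = this
  define b where "b i x = (SOME b. w i x \<noteq> 0 \<longrightarrow> Q i x \<subseteq> range (b :: nat \<Rightarrow> 'a))" for i x
  have b: "Q i x \<subseteq> range (b i x)" if "x \<in> Ob" "w i x \<noteq> 0" for i x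
    using someI_ex[OF ex_b[OF that(1), of i]] that(2) unfolding b_def by blast
  define c where "c e = h (cO (fst e), cm (\<lambda>i j k. snd e i (b i (fst e) j) k))" for e
  have "inj_on c E_points"
  proof (rule inj_onI)
    fix e e' assume e: "e \<in> E_points" and e': "e' \<in> E_points" and eq: "c e = c e'"
    then have "cO (fst e) = cO (fst e')"
      and m: "(\<lambda>i j k. snd e i (b i (fst e) j) k) = (\<lambda>i j k. snd e' i (b i (fst e') j) k)"
      using h cm by (auto simp: c_def bij_def inj_eq)
    then have x: "fst e = fst e'" using cO E_pointsD(1) e e' by (meson inj_onD)
    show "e = e'"
    proof (rule E_eqI[OF e e' x])
      fix i g k assume g: "g \<in> Q i (fst e)"
      show "snd e i g k = snd e' i g k"
      proof (cases "w i (fst e) = 0")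
        case True
        then show ?thesis using E_zero[OF e] E_zero[OF e'] x by simp
      next
        case False
        then obtain j where "g = b i (fst e) j" using b[OF E_pointsD(1)[OF e]] g by blast
        then show ?thesis using m x by (simp add: fun_eq_iff)
      qed
    qed
  qed
  then show ?thesis by blast
qed

definition code :: "('o, 'a) frames \<Rightarrow> point" where
  "code = (SOME c. inj_on c E_points)"

text \<open>An orbit is represented by the code of a chosen member. Only the quotient has to live on
  the type \<open>point\<close>; E keeps its own type, as \<open>morita_equivalentI\<close> accepts
  any.\<close>

definition cls :: "('o, 'a) frames \<Rightarrow> point" where
  "cls e = code (SOME e'. related e' e)"

lemma inj_code: "inj_on code E_points"
  unfolding code_def using ex_code by (rule someI_ex)

lemma cls_eq_iff:
  assumes "e \<in> E_points" "e' \<in> E_points"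
  shows "cls e' = cls e \<longleftrightarrow> related e' e"
proof
  have r: "related (SOME e'. related e' e) e" if "e \<in> E_points" for e
    using related_refl[OF that] by (rule someI)
  {
    assume "cls e' = cls e"
    then have "(SOME x. related x e') = (SOME x. related x e)"
      using inj_onD[OF inj_code] related_in[OF r] assms unfolding cls_def by blast
    then have "related (SOME x. related x e) e'" using r[OF assms(2)] by simp
    then show "related e' e"
      using related_trans[OF related_sym r] assms by blast
  next
    assume "related e' e"
    then have "related x e' \<longleftrightarrow> related x e" for x
      using related_trans related_sym assms by meson
    then show "cls e' = cls e" by (simp add: cls_def)
  }
qed

lemma cls_lact: "a \<in> Ar \<Longrightarrow> e \<in> E_points \<Longrightarrow> s a = fst e \<Longrightarrow> cls (lact a e) = cls e"
  by (subst cls_eq_iff) (auto simp: related_def)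

definition P :: "point topology" where
  "P = topology (\<lambda>S. S \<subseteq> cls ` E_points \<and> openin E {e \<in> E_points. cls e \<in> S})"

lemma openin_P: "openin P S \<longleftrightarrow> S \<subseteq> cls ` E_points \<and> openin E {e \<in> E_points. cls e \<in> S}"
proof -
  have "istopology (\<lambda>S. S \<subseteq> cls ` E_points \<and> openin E {e \<in> E_points. cls e \<in> S})"
    unfolding istopology_def
  proof (intro conjI allI impI)
    fix S T
    assume *: "S \<subseteq> cls ` E_points \<and> openin E {e \<in> E_points. cls e \<in> S}"
      "T \<subseteq> cls ` E_points \<and> openin E {e \<in> E_points. cls e \<in> T}"
    have "openin E ({e \<in> E_points. cls e \<in> S} \<inter> {e \<in> E_points. cls e \<in> T})"
      using * by (intro openin_Int) blast+
    moreover have "{e \<in> E_points. cls e \<in> S} \<inter> {e \<in> E_points. cls e \<in> T} = {e \<in> E_points. cls e \<in> S \<inter> T}" by blast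
    ultimately show "openin E {e \<in> E_points. cls e \<in> S \<inter> T}" by (simp only:)
    show "S \<inter> T \<subseteq> cls ` E_points" using * by blast
  next
    fix K assume *: "\<forall>S\<in>K. S \<subseteq> cls ` E_points \<and> openin E {e \<in> E_points. cls e \<in> S}"
    have "{e \<in> E_points. cls e \<in> \<Union>K} = (\<Union>S\<in>K. {e \<in> E_points. cls e \<in> S})" by auto
    then show "openin E {e \<in> E_points. cls e \<in> \<Union>K}" using * by auto
    show "\<Union>K \<subseteq> cls ` E_points" using * by blast
  qed
  then show ?thesis by (simp add: P_def topology_inverse')
qed

lemma topspace_P [simp]: "topspace P = cls ` E_points"
proof
  show "topspace P \<subseteq> cls ` E_points" using openin_topspace[of P] unfolding openin_P by blast
  have "{e \<in> E_points. cls e \<in> cls ` E_points} = topspace E" by auto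
  then have "openin P (cls ` E_points)" unfolding openin_P by (metis openin_topspace order_refl)
  then show "cls ` E_points \<subseteq> topspace P" by (rule openin_subset)
qed

lemma continuous_map_cls: "continuous_map E P cls"
  by (auto simp: continuous_map_def openin_P)

text \<open>If an arrow a moves e to a point e' of S, the section through a moves all points near e
  close to e', hence into S; so the saturation of S is open.\<close>

lemma open_map_cls: "open_map E P cls"
  unfolding open_map_def
proof (intro allI impI)
  fix S assume S: "openin E S"
  have SE: "S \<subseteq> E_points" using openin_subset[OF S] by simp
  have "openin E {e \<in> E_points. cls e \<in> cls ` S}"
    unfolding openin_nhdsin
  proof (intro conjI ballI)
    fix e assume "e \<in> {e \<in> E_points. cls e \<in> cls ` S}"
    then obtain e' where e: "e \<in> E_points" and e': "e' \<in> S" "cls e = cls e'" by blast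
    then have "related e' e" using cls_eq_iff[of e e'] SE by auto
    then obtain a where a: "a \<in> Ar" "s a = fst e" "e' = lact a e" unfolding related_def by blast
    let ?F = "nhdsin E e"
    have l: "limitin E (\<lambda>x. x) e ?F" using limitin_ident[of e E] e by simp
    have lx: "limitin (Obj G) fst (s a) ?F" using limitin_ED(3)[OF l] a(2) by simp
    note sa = eventually_s_sec[OF a(1) lx]
    have "limitin E (\<lambda>x. lact (sec a (fst x)) x) e' ?F"
      unfolding a(3) by (rule limitin_lact[OF limitin_sec'[OF a(1) lx] l a(2)])
        (use sa in \<open>eventually_elim, simp\<close>)
    then have "\<forall>\<^sub>F x in ?F. lact (sec a (fst x)) x \<in> S"
      using limitinD[OF _ S e'(1)] by blast
    with sa eventually_in_topspace_nhdsin[of E e]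
    show "\<forall>\<^sub>F x in ?F. x \<in> {e \<in> E_points. cls e \<in> cls ` S}"
    proof eventually_elim
      case (elim x)
      then have "cls (lact (sec a (fst x)) x) = cls x" by (intro cls_lact) auto
      then show ?case using elim by (auto intro: image_eqI[of _ cls, OF sym])
    qed
  qed auto
  then show "openin P (cls ` S)" using SE by (auto simp: openin_P)
qed

lemma quotient_map_cls: "quotient_map E P cls"
  using continuous_map_cls open_map_cls by (intro continuous_open_imp_quotient_map) auto

text \<open>Restrict the neighbourhood filter of (e', e) to related pairs. Were it non-trivial,
  \<open>limitin_related\<close> would relate e' and e; so it is trivial, and some box around (e',
  e) contains no related pair.\<close>

lemma Hausdorff_P: "Hausdorff_space P"
  unfolding Hausdorff_space_def
proof (intro allI impI)
  fix p p' assume "p \<in> topspace P \<and> p' \<in> topspace P \<and> p \<noteq> p'"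
  then have "p \<in> cls ` E_points" "p' \<in> cls ` E_points" "p \<noteq> p'" by simp_all
  then obtain e e' where e: "e \<in> E_points" "e' \<in> E_points" "p = cls e" "p' = cls e'" "p \<noteq> p'" by blast
  then have nr: "\<not> related e' e" using cls_eq_iff[of e e'] by auto
  let ?F0 = "nhdsin (prod_topology E E) (e', e)"
  define F where "F = inf ?F0 (principal {z. related (fst z) (snd z)})"
  have "limitin (prod_topology E E) (\<lambda>z. z) (e', e) ?F0" using e by (intro limitin_ident) simp
  then have l0: "limitin E fst e' ?F0" "limitin E snd e ?F0" by (simp_all add: limitin_pairwise o_def)
  have le: "F \<le> ?F0" by (simp add: F_def)
  have l: "limitin E snd e F" "limitin E fst e' F"
    using filterlim_mono[OF _ order_refl le] l0 by (auto simp: limitin_filterlim)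
  have "\<forall>\<^sub>F z in F. related (fst z) (snd z)"
    by (simp add: F_def eventually_inf_principal)
  then have "F = bot" using limitin_related[OF _ l] nr by blast
  then have "\<forall>\<^sub>F z in F. False" by simp
  then have "\<forall>\<^sub>F z in ?F0. \<not> related (fst z) (snd z)"
    by (simp add: F_def eventually_inf_principal)
  then obtain S where S: "openin (prod_topology E E) S" "(e', e) \<in> S" "\<forall>z\<in>S. \<not> related (fst z) (snd z)"
    using e unfolding eventually_nhdsin by auto
  obtain A B where AB: "openin E A" "openin E B" "e' \<in> A" "e \<in> B" "A \<times> B \<subseteq> S"
    using S(1)[unfolded openin_prod_topology_alt, rule_format, OF S(2)] by blast
  have "disjnt (cls ` B) (cls ` A)"
    unfolding disjnt_iff
  proof (intro allI notI)
    fix x assume "x \<in> cls ` B \<and> x \<in> cls ` A"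
    then obtain a b where ab: "a \<in> A" "b \<in> B" "cls a = cls b" by auto
    then have "a \<in> E_points" "b \<in> E_points" using openin_subset[OF AB(1)] openin_subset[OF AB(2)] by auto
    then have "related a b" using cls_eq_iff ab by blast
    then show False using S(3) AB(5) ab by force
  qed
  moreover have "openin P (cls ` A)" "openin P (cls ` B)" using open_map_cls AB unfolding open_map_def by auto
  ultimately show "\<exists>S S'. openin P S \<and> openin P S' \<and> p \<in> S \<and> p' \<in> S' \<and> disjnt S S'"
    using AB e by blast
qed

section \<open>The action induced on the quotient\<close>

definition pick :: "point \<Rightarrow> ('o, 'a) frames" where
  "pick p = (SOME e. e \<in> E_points \<and> cls e = p)"

definition \<phi> :: "point \<Rightarrow> point" where "\<phi> p = base_of (pick p)"

definition act :: "point \<Rightarrow> point \<Rightarrow> point" where "act p u = cls (ract (pick p) u)"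

lemma pick: "e \<in> E_points \<Longrightarrow> pick (cls e) \<in> E_points \<and> cls (pick (cls e)) = cls e"
  unfolding pick_def by (rule someI[of "\<lambda>x. x \<in> E_points \<and> cls x = cls e"]) simp

lemma pick_cls:
  assumes "e \<in> E_points" obtains a where "a \<in> Ar" "s a = fst e" "pick (cls e) = lact a e"
  using pick[OF assms] cls_eq_iff[OF assms, of "pick (cls e)"] unfolding related_def by blast

lemma \<phi>_cls [simp]: assumes "e \<in> E_points" shows "\<phi> (cls e) = base_of e"
proof -
  obtain a where a: "a \<in> Ar" "s a = fst e" "pick (cls e) = lact a e" using pick_cls[OF assms] .
  have "w i (t a) = w i (fst e)" for i using w_invariant[OF a(1)] a(2) by simp
  then show ?thesis by (simp add: \<phi>_def a(3) base_of_def)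
qed

text \<open>The chosen representative is a translate of e by an arrow, and the two actions commute,
  so acting by u on either gives the same orbit.\<close>

lemma act_cls:
  assumes "e \<in> E_points" "u \<in> TU" "base_of e = bproj U u"
  shows "act (cls e) u = cls (ract e u)"
proof -
  obtain a where a: "a \<in> Ar" "s a = fst e" "pick (cls e) = lact a e" using pick_cls[OF assms(1)] .
  have u: "dt u \<in> total_points" "fst (dt u) = W (fst e)" using assms by (simp_all add: base_of_eq_bproj)
  have "act (cls e) u = cls (lact a (ract e u))"
    using ract_lact[OF a(1) assms(1) a(2) u] by (simp add: act_def a(3))
  also have "\<dots> = cls (ract e u)" using a assms(1) u by (intro cls_lact) auto
  finally show ?thesis .
qed

lemma ract_in': "e \<in> E_points \<Longrightarrow> u \<in> TU \<Longrightarrow> base_of e = bproj U u \<Longrightarrow> ract e u \<in> E_points"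
  by (simp add: base_of_eq_bproj)

lemma base_of_ract [simp]: "base_of (ract e u) = base_of e"
  by (simp add: base_of_def)

lemma ract_ract': "base_of e = bproj U u \<Longrightarrow> ract (ract e u) v = ract e (bmlt U u v)"
  by (rule ract_ract) (simp add: base_of_eq_bproj)

lemma
  assumes p: "p \<in> topspace P" and u: "u \<in> TU" and pu: "\<phi> p = bproj U u"
  shows act_in: "act p u \<in> topspace P" and \<phi>_act: "\<phi> (act p u) = \<phi> p"
    and act_act: "v \<in> TU \<Longrightarrow> bproj U v = bproj U u \<Longrightarrow> act (act p u) v = act p (bmlt U u v)"
proof -
  obtain e where e: "e \<in> E_points" "p = cls e" using p by auto
  have eu: "base_of e = bproj U u" using pu e by simp
  note in' = ract_in'[OF e(1) u eu]
  show "act p u \<in> topspace P" "\<phi> (act p u) = \<phi> p"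
    using e act_cls[OF e(1) u eu] in' by simp_all
  show "act (act p u) v = act p (bmlt U u v)" if v: "v \<in> TU" "bproj U v = bproj U u"
    using e eu in' v act_cls[OF e(1) u eu] act_cls[OF in' v(1)] act_cls[OF e(1) bmlt_in[OF u v(1)]]
    by (simp add: ract_ract' bproj_bmlt)
qed

lemma \<phi>_in: "p \<in> topspace P \<Longrightarrow> \<phi> p \<in> topspace (Base U)"
  using base_of_in by auto

lemma act_bone: "p \<in> topspace P \<Longrightarrow> act p (bone U (\<phi> p)) = p"
  using act_cls[of _ "bone U (base_of _)"] bone_in[OF base_of_in] ract_bone by (auto simp: bproj_bone)

lemma continuous_map_\<phi>: "continuous_map P (Base U) \<phi>"
proof (rule continuous_compose_quotient_map[OF quotient_map_cls])
  have "continuous_map E (Base U) base_of"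
    unfolding continuous_map_nhdsin using limitin_base_of[OF limitin_ident] by blast
  then show "continuous_map E (Base U) (\<phi> \<circ> cls)"
    by (rule continuous_map_eq) simp
qed

lemma continuous_map_act:
  "continuous_map (fibre_product P \<phi> (Total U) (bproj U)) P (\<lambda>(p, u). act p u)"
proof (rule continuous_map_fibre_product_open_map[OF open_map_cls])
  let ?X = "fibre_product E (\<phi> \<circ> cls) (Total U) (bproj U)"
  have "continuous_map ?X P (\<lambda>(e, u). cls (ract e u))"
    unfolding continuous_map_nhdsin
  proof
    fix x assume x: "x \<in> topspace ?X"
    from limitin_ident[OF x] have l: "limitin E (\<lambda>y. fst y) (fst x) (nhdsin ?X x)"
      "limitin (Total U) (\<lambda>y. snd y) (snd x) (nhdsin ?X x)"
      by (simp_all add: limitin_fibre_product)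
    have b: "fst (dt (snd y)) = W (fst (fst y))" if "y \<in> topspace ?X" for y
      using that by (auto simp: topspace_fibre_product base_of_eq_bproj simp del: in_Total)
    have "limitin E (\<lambda>y. ract (fst y) (snd y)) (ract (fst x) (snd x)) (nhdsin ?X x)"
      by (rule limitin_ract[OF l b[OF x]]) (rule eventually_nhdsinI[OF b])
    then show "limitin P (\<lambda>(e, u). cls (ract e u)) (case x of (e, u) \<Rightarrow> cls (ract e u)) (nhdsin ?X x)"
      unfolding case_prod_unfold by (rule continuous_map_limitin[OF continuous_map_cls])
  qed
  then show "continuous_map ?X P (\<lambda>(e, u). act (cls e) u)"
    by (rule continuous_map_eq) (auto simp: topspace_fibre_product act_cls simp del: in_Total)
qed simp

lemma limitin_act:
  assumes "limitin P p p0 F" "limitin (Total U) u u0 F" "\<phi> p0 = bproj U u0" "\<forall>\<^sub>F z in F. \<phi> (p z) = bproj U (u z)"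
  shows "limitin P (\<lambda>z. act (p z) (u z)) (act p0 u0) F"
  using continuous_map_limitin[OF continuous_map_act, of "\<lambda>z. (p z, u z)" "(p0, u0)" F] assms
  by (simp add: limitin_fibre_product)

lemma limitin_\<phi>: "limitin P p p0 F \<Longrightarrow> limitin (Base U) (\<lambda>z. \<phi> (p z)) (\<phi> p0) F"
  by (rule continuous_map_limitin[OF continuous_map_\<phi>])

lemma right_action_P: "right_action (bundle_groupoid U) P \<phi> act"
  unfolding right_action_def bundle_groupoid_def groupoid.simps
  using continuous_map_\<phi> continuous_map_act
  by (auto simp: \<phi>_act act_act act_bone simp del: in_Total topspace_P)

subsection \<open>The translation groupoid\<close>

abbreviation "T \<equiv> translation_groupoid P \<phi> act U"

abbreviation "PU \<equiv> fibre_product P \<phi> (Total U) (bproj U)"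

lemma T_simps: "Arr T = PU" "Obj T = P" "src T = (\<lambda>(p, u). act p u)" "tgt T = fst"
  "mlt T = (\<lambda>(p, u) (p', u'). (p, bmlt U u u'))" "ginv T = (\<lambda>(p, u). (act p u, bundle_inv U u))"
  "uni T = (\<lambda>p. (p, bone U (\<phi> p)))"
  by (auto simp: translation_groupoid_def)

lemma in_PU: "x \<in> topspace PU \<longleftrightarrow> fst x \<in> topspace P \<and> snd x \<in> TU \<and> \<phi> (fst x) = bproj U (snd x)"
  by (auto simp: topspace_fibre_product)

lemma act_inv: "p \<in> topspace P \<Longrightarrow> u \<in> TU \<Longrightarrow> \<phi> p = bproj U u \<Longrightarrow> act (act p u) (bundle_inv U u) = p"
  using act_bone[of p] by (simp add: act_act bundle_simps del: in_Total topspace_P)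

lemma act_bone': "p \<in> topspace P \<Longrightarrow> \<phi> p = q \<Longrightarrow> act p (bone U q) = p"
  using act_bone by blast

lemma bproj_composable:
  "g \<in> topspace PU \<Longrightarrow> h \<in> topspace PU \<Longrightarrow> act (fst g) (snd g) = fst h \<Longrightarrow> bproj U (snd h) = bproj U (snd g)"
  using \<phi>_act[of "fst g" "snd g"] by (simp add: in_PU del: in_Total topspace_P)

lemma groupoid_axioms_T: "groupoid_axioms T"
proof -
  have *: "bmlt U (snd g) (snd h) \<in> TU" "act (fst g) (bmlt U (snd g) (snd h)) = act (fst h) (snd h)"
    "bmlt U (bmlt U (snd g) (snd h)) z = bmlt U (snd g) (bmlt U (snd h) z)"
    if "g \<in> topspace PU" "h \<in> topspace PU" "act (fst g) (snd g) = fst h" for g h z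
    using that bproj_composable[OF that] act_act[of "fst g" "snd g" "snd h"]
    by (simp_all add: in_PU bmlt_in bmlt_assoc del: in_Total topspace_P)
  show ?thesis
    unfolding groupoid_axioms_def T_simps case_prod_unfold
    by (simp_all add: * act_in \<phi>_act act_act act_bone' \<phi>_in bundle_simps act_inv
        prod_eq_iff Pi_iff in_PU del: in_Total topspace_P in_Base)
qed

lemma limitin_PU:
  "limitin PU h l F \<longleftrightarrow> limitin P (\<lambda>z. fst (h z)) (fst l) F \<and> limitin (Total U) (\<lambda>z. snd (h z)) (snd l) F \<and>
     \<phi> (fst l) = bproj U (snd l) \<and> (\<forall>\<^sub>F z in F. \<phi> (fst (h z)) = bproj U (snd (h z)))"
  by (rule limitin_fibre_product)

lemma limitin_through_\<phi>:
  assumes "limitin P p p0 F" "u \<in> TU" "\<phi> p0 = bproj U u"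
  shows "limitin (Total U) (\<lambda>z. through u (\<phi> (p z))) u F"
  using limitin_through[OF _ limitin_\<phi>[OF assms(1)], of u] through_self[of u] assms by simp

lemma open_map_tgt_T: "open_map PU P fst"
proof (rule open_map_local_sections)
  show "fst \<in> topspace PU \<rightarrow> topspace P" by (simp add: in_PU del: in_Total topspace_P)
  fix x assume "x \<in> topspace PU"
  then have x: "fst x \<in> topspace P" "snd x \<in> TU" "\<phi> (fst x) = bproj U (snd x)" by (simp_all only: in_PU)
  have "limitin PU (\<lambda>p. (p, through (snd x) (\<phi> p))) x (nhdsin P (fst x))"
    using limitin_ident[OF x(1)] limitin_through_\<phi>[OF limitin_ident[OF x(1)] x(2,3)] x(3)
    by (simp add: limitin_PU del: in_Total topspace_P)
  then show "\<exists>\<sigma>. limitin PU \<sigma> x (nhdsin P (fst x)) \<and> (\<forall>\<^sub>F y in nhdsin P (fst x). fst (\<sigma> y) = y)"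
    by (intro exI[of _ "\<lambda>p. (p, through (snd x) (\<phi> p))"]) simp
qed

lemma limitin_inv_PU:
  assumes "limitin PU h l F"
  shows "limitin PU (\<lambda>z. (act (fst (h z)) (snd (h z)), bundle_inv U (snd (h z)))) (act (fst l) (snd l), bundle_inv U (snd l)) F"
proof -
  have l: "limitin P (\<lambda>z. fst (h z)) (fst l) F" "limitin (Total U) (\<lambda>z. snd (h z)) (snd l) F"
    "\<phi> (fst l) = bproj U (snd l)" "\<forall>\<^sub>F z in F. \<phi> (fst (h z)) = bproj U (snd (h z))"
    using assms by (simp_all add: limitin_PU)
  have "\<forall>\<^sub>F z in F. \<phi> (act (fst (h z)) (snd (h z))) = bproj U (bundle_inv U (snd (h z)))"
    using l(4) limitin_eventually_topspace[OF l(1)] limitin_eventually_topspace[OF l(2)]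
    by eventually_elim (simp add: \<phi>_act bundle_simps del: in_Total topspace_P)
  moreover have "\<phi> (act (fst l) (snd l)) = bproj U (bundle_inv U (snd l))"
    using l(3) limitin_topspace[OF l(1)] limitin_topspace[OF l(2)]
    by (simp add: \<phi>_act bundle_simps del: in_Total topspace_P)
  ultimately show ?thesis
    using limitin_act[OF l] limitin_bundle_inv[OF l(2)] by (simp add: limitin_PU)
qed

text \<open>The source map is the target map after inversion: a section of the target through the
  inverse of x becomes, on inverting it, a section of the source through x.\<close>

lemma open_map_src_T: "open_map PU P (\<lambda>(p, u). act p u)"
proof (rule open_map_local_sections)
  show "(\<lambda>(p, u). act p u) \<in> topspace PU \<rightarrow> topspace P"
    by (auto simp: in_PU act_in simp del: in_Total topspace_P)
  fix x assume "x \<in> topspace PU"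
  then have x: "fst x \<in> topspace P" "snd x \<in> TU" "\<phi> (fst x) = bproj U (snd x)" by (simp_all only: in_PU)
  let ?p = "act (fst x) (snd x)"
  let ?F = "nhdsin P ?p"
  define \<tau> where "\<tau> p = bundle_inv U (through (snd x) (\<phi> p))" for p
  have p: "?p \<in> topspace P" "\<phi> ?p = bproj U (snd x)" using act_in[OF x] \<phi>_act[OF x] x(3) by simp_all
  have \<tau>: "limitin (Total U) \<tau> (bundle_inv U (snd x)) ?F"
    unfolding \<tau>_def using limitin_bundle_inv[OF limitin_through_\<phi>[OF limitin_ident[OF p(1)] x(2) p(2)]] .
  have \<tau>': "\<tau> q \<in> TU" "bproj U (\<tau> q) = \<phi> q" if "q \<in> topspace P" for q
    using that x(2) \<phi>_in[OF that] by (simp_all add: \<tau>_def bundle_simps del: in_Total topspace_P in_Base)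
  have ev: "\<forall>\<^sub>F q in ?F. \<phi> q = bproj U (\<tau> q)"
    by (rule eventually_nhdsinI) (simp add: \<tau>' del: in_Total topspace_P)
  have "limitin PU (\<lambda>q. (q, \<tau> q)) (?p, bundle_inv U (snd x)) ?F"
    using limitin_ident[OF p(1)] \<tau> ev p(2) x(2) by (simp add: limitin_PU bundle_simps del: in_Total topspace_P)
  from limitin_inv_PU[OF this]
  have "limitin PU (\<lambda>q. (act q (\<tau> q), bundle_inv U (\<tau> q))) (act ?p (bundle_inv U (snd x)), bundle_inv U (bundle_inv U (snd x))) ?F"
    by simp
  moreover have inv_inv: "bundle_inv U (bundle_inv U u) = u" if "u \<in> TU" for u
    using that by (simp add: bundle_inv_U) (simp add: uadj_def)
  ultimately have "limitin PU (\<lambda>q. (act q (\<tau> q), bundle_inv U (\<tau> q))) x ?F"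
    using act_inv[OF x] x(2) by (simp del: in_Total topspace_P)
  moreover have "\<forall>\<^sub>F q in ?F. act (act q (\<tau> q)) (bundle_inv U (\<tau> q)) = q"
    by (rule eventually_nhdsinI) (simp add: act_inv \<tau>' del: in_Total topspace_P)
  ultimately show "\<exists>\<sigma>. limitin PU \<sigma> x (nhdsin P (case x of (p, u) \<Rightarrow> act p u)) \<and>
      (\<forall>\<^sub>F y in nhdsin P (case x of (p, u) \<Rightarrow> act p u). (case \<sigma> y of (p, u) \<Rightarrow> act p u) = y)"
    unfolding case_prod_unfold by (intro exI[of _ "\<lambda>q. (act q (\<tau> q), bundle_inv U (\<tau> q))"]) simp
qed

abbreviation "PUU \<equiv> fibre_product PU (\<lambda>(p, u). act p u) PU fst"

lemma continuous_map_mlt_T: "continuous_map PUU PU (\<lambda>(g, h). mlt T g h)"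
  unfolding continuous_map_nhdsin
proof
  fix x assume "x \<in> topspace PUU"
  from limitin_ident[OF this]
  have l: "limitin P (\<lambda>z. fst (fst z)) (fst (fst x)) (nhdsin PUU x)"
    "limitin (Total U) (\<lambda>z. snd (fst z)) (snd (fst x)) (nhdsin PUU x)"
    "limitin (Total U) (\<lambda>z. snd (snd z)) (snd (snd x)) (nhdsin PUU x)"
    and top: "x \<in> topspace PUU"
    using \<open>x \<in> topspace PUU\<close> by (simp_all add: limitin_fibre_product)
  have b: "bproj U (snd (fst z)) = bproj U (snd (snd z))" "\<phi> (fst (fst z)) = bproj U (snd (fst z))" if "z \<in> topspace PUU" for z
    using that \<phi>_act[of "fst (fst z)" "snd (fst z)"] by (auto simp: topspace_fibre_product)
  have "limitin (Total U) (\<lambda>z. bmlt U (snd (fst z)) (snd (snd z))) (bmlt U (snd (fst x)) (snd (snd x))) (nhdsin PUU x)"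
    by (rule limitin_bmlt[OF l(2,3) b(1)[OF top]]) (rule eventually_nhdsinI[OF b(1)])
  moreover have "\<forall>\<^sub>F z in nhdsin PUU x. \<phi> (fst (fst z)) = bproj U (snd (fst z))"
    by (rule eventually_nhdsinI[OF b(2)])
  ultimately show "limitin PU (\<lambda>(g, h). mlt T g h) (case x of (g, h) \<Rightarrow> mlt T g h) (nhdsin PUU x)"
    using l(1) b(2)[OF top] by (simp add: limitin_PU T_simps case_prod_unfold bproj_bmlt)
qed

text \<open>As for \<open>open_map_bmlt\<close>: continue the left factor by \<open>through\<close>,
  and let the right factor be what remains, starting where the left factor leads.\<close>

lemma open_map_mlt_T: "open_map PUU PU (\<lambda>(g, h). mlt T g h)"
proof (rule open_map_local_sections)
  show "(\<lambda>(g, h). mlt T g h) \<in> topspace PUU \<rightarrow> topspace PU"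
    using continuous_map_mlt_T unfolding continuous_map_def by blast
  fix x assume "x \<in> topspace PUU"
  then obtain p u v where x: "x = ((p, u), (act p u, v))" "p \<in> topspace P" "u \<in> TU" "v \<in> TU"
    "\<phi> p = bproj U u" "bproj U v = bproj U u"
    using \<phi>_act by (auto simp: topspace_fibre_product simp del: in_Total topspace_P)
  define y where "y = (p, bmlt U u v)"
  have y: "y \<in> topspace PU" using x by (simp add: y_def in_PU bundle_simps del: in_Total topspace_P)
  let ?F = "nhdsin PU y"
  define a where "a z = through u (\<phi> (fst z))" for z :: "point \<times> point"
  have lz: "limitin P fst p ?F" "limitin (Total U) snd (bmlt U u v) ?F"
    using limitin_ident[OF y] by (simp_all add: limitin_PU y_def)
  have a: "limitin (Total U) a u ?F"
    unfolding a_def by (rule limitin_through_\<phi>[OF lz(1) x(3,5)])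
  have a': "a z \<in> TU" "bproj U (a z) = \<phi> (fst z)" "fst z \<in> topspace P" "snd z \<in> TU" "\<phi> (fst z) = bproj U (snd z)"
    if "z \<in> topspace PU" for z
    using that x(3) \<phi>_in[of "fst z"] unfolding in_PU by (simp_all add: a_def bundle_simps del: in_Total topspace_P in_Base)
  define b where "b z = bmlt U (bundle_inv U (a z)) (snd z)" for z
  have b: "limitin (Total U) b (bmlt U (bundle_inv U u) (bmlt U u v)) ?F"
    unfolding b_def
  proof (rule limitin_bmlt[OF limitin_bundle_inv[OF a] lz(2)])
    show "\<forall>\<^sub>F z in ?F. bproj U (bundle_inv U (a z)) = bproj U (snd z)"
      by (rule eventually_nhdsinI)
        (simp add: a' bundle_simps del: in_Total topspace_P)
  qed (use x in \<open>simp add: bundle_simps del: in_Total topspace_P\<close>)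
  have bv: "bmlt U (bundle_inv U u) (bmlt U u v) = v"
    using x by (simp add: bundle_simps flip: bmlt_assoc del: in_Total topspace_P)
  have la: "limitin P (\<lambda>z. act (fst z) (a z)) (act p u) ?F"
    by (rule limitin_act[OF lz(1) a x(5)])
      (rule eventually_nhdsinI, simp add: a')
  define \<sigma> where "\<sigma> z = ((fst z, a z), (act (fst z) (a z), b z))" for z
  have e1: "\<phi> (fst z) = bproj U (a z) \<and> \<phi> (act (fst z) (a z)) = bproj U (b z)" if "z \<in> topspace PU" for z
    using a'[OF that] by (simp add: b_def \<phi>_act bundle_simps del: in_Total topspace_P)
  have ev: "\<forall>\<^sub>F z in ?F. \<phi> (fst z) = bproj U (a z) \<and> \<phi> (act (fst z) (a z)) = bproj U (b z)"
    by (rule eventually_nhdsinI[OF e1])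
  have "limitin PUU \<sigma> x ?F"
    using lz(1) a b bv la x ev \<phi>_act[OF x(2,3,5)]
    by (simp add: limitin_fibre_product \<sigma>_def eventually_conj_iff del: in_Total topspace_P)
  moreover have "mlt T (fst (\<sigma> z)) (snd (\<sigma> z)) = z" if "z \<in> topspace PU" for z
    using a'[OF that] by (simp add: \<sigma>_def b_def T_simps bundle_simps flip: bmlt_assoc del: in_Total topspace_P)
  then have "\<forall>\<^sub>F z in ?F. mlt T (fst (\<sigma> z)) (snd (\<sigma> z)) = z"
    by (rule eventually_nhdsinI)
  moreover have "(case x of (g, h) \<Rightarrow> mlt T g h) = y" by (simp add: x(1) y_def T_simps)
  ultimately show "\<exists>\<sigma>. limitin PUU \<sigma> x (nhdsin PU (case x of (g, h) \<Rightarrow> mlt T g h)) \<and>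
      (\<forall>\<^sub>F z in nhdsin PU (case x of (g, h) \<Rightarrow> mlt T g h). (case \<sigma> z of (g, h) \<Rightarrow> mlt T g h) = z)"
    unfolding case_prod_unfold by (intro exI[of _ \<sigma>]) simp
qed

lemma topological_groupoid_T: "topological_groupoid T"
proof -
  have tgt: "continuous_map PU P fst"
    unfolding continuous_map_nhdsin using limitin_ident[of _ PU] by (simp add: limitin_PU)
  have inv: "continuous_map PU PU (\<lambda>(p, u). (act p u, bundle_inv U u))"
    unfolding continuous_map_nhdsin case_prod_unfold using limitin_inv_PU[OF limitin_ident] by blast
  have uni: "continuous_map P PU (\<lambda>p. (p, bone U (\<phi> p)))"
    unfolding continuous_map_nhdsin
    using limitin_bone[OF limitin_\<phi>[OF limitin_ident]] limitin_ident[of _ P] by (simp add: limitin_PU bproj_bone)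
  have "embedding_map P PU (\<lambda>p. (p, bone U (\<phi> p)))"
  proof (rule section_imp_embedding_map)
    show "section_map P PU (\<lambda>p. (p, bone U (\<phi> p)))"
      unfolding section_map_def retraction_maps_def using uni tgt by auto
  qed
  then show ?thesis
    unfolding topological_groupoid_def
    using groupoid_axioms_T Hausdorff_P continuous_map_act open_map_src_T tgt open_map_tgt_T
      continuous_map_mlt_T open_map_mlt_T inv uni
    by (simp add: T_simps)
qed

subsection \<open>The Morita bibundle\<close>

abbreviation "ract' \<equiv> (\<lambda>e h. ract e (snd h))"

lemma left_action_E: "left_action G E fst lact"
  unfolding left_action_def
proof (intro conjI ballI impI)
  show "continuous_map (fibre_product (Arr G) s E fst) E (\<lambda>(g, p). lact g p)"
    unfolding continuous_map_nhdsin
  proof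
    fix x assume "x \<in> topspace (fibre_product (Arr G) s E fst)"
    from limitin_ident[OF this] show "limitin E (\<lambda>(g, p). lact g p) (case x of (g, p) \<Rightarrow> lact g p)
        (nhdsin (fibre_product (Arr G) s E fst) x)"
      unfolding case_prod_unfold limitin_fibre_product by (auto intro: limitin_lact)
  qed
qed (auto simp: continuous_map_fst_E lact_lact)

lemma base_of_PU: "e \<in> E_points \<Longrightarrow> h \<in> topspace PU \<Longrightarrow> cls e = fst h \<Longrightarrow> base_of e = bproj U (snd h)"
  using \<phi>_cls[of e] by (simp add: in_PU)

lemma right_action_E: "right_action T E cls ract'"
  unfolding right_action_def T_simps
proof (intro conjI ballI impI)
  let ?X = "fibre_product E cls PU fst"
  have b: "fst (dt (snd (snd x))) = W (fst (fst x))" if "x \<in> topspace ?X" for x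
    using that base_of_PU[of "fst x" "snd x"] by (auto simp: topspace_fibre_product[of E] base_of_eq_bproj)
  show "continuous_map ?X E (\<lambda>(p, h). ract p (snd h))"
    unfolding continuous_map_nhdsin case_prod_unfold
  proof
    fix x assume x: "x \<in> topspace ?X"
    from limitin_ident[OF x] have l: "limitin E fst (fst x) (nhdsin ?X x)"
      "limitin (Total U) (\<lambda>y. snd (snd y)) (snd (snd x)) (nhdsin ?X x)"
      by (simp_all add: limitin_fibre_product)
    show "limitin E (\<lambda>y. ract (fst y) (snd (snd y))) (ract (fst x) (snd (snd x))) (nhdsin ?X x)"
      by (rule limitin_ract[OF l b[OF x]]) (rule eventually_nhdsinI[OF b])
  qed
  show "cls (ract p (snd h)) = (case h of (p, u) \<Rightarrow> act p u)"
    if "p \<in> topspace E" "h \<in> topspace PU" "cls p = fst h" for p h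
    using that base_of_PU[of p h] act_cls[of p "snd h"] by (simp add: in_PU case_prod_unfold del: in_Total)
  show "ract p (snd (cls p, bone U (\<phi> (cls p)))) = p" if "p \<in> topspace E" for p
    using that by (simp add: ract_bone)
  show "ract (ract p (snd h)) (snd h') = ract p (snd ((\<lambda>(p, u) (p', u'). (p, bmlt U u u')) h h'))"
    if "p \<in> topspace E" "h \<in> topspace PU" "cls p = fst h" for p h h'
    using that base_of_PU[of p h] by (simp add: ract_ract' case_prod_unfold)
qed (rule continuous_map_cls)

text \<open>Principality for the translation groupoid: \<open>quot\<close> supplies the inverse and
  \<open>limitin_quot\<close> its continuity.\<close>

lemma homeomorphic_right: "homeomorphic_map (fibre_product E cls PU fst) (fibre_product E fst E fst) (\<lambda>(p, h). (p, ract p (snd h)))"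
proof -
  let ?X = "fibre_product E cls PU fst" and ?Y = "fibre_product E fst E fst"
  have "homeomorphic_maps ?X ?Y (\<lambda>(p, h). (p, ract p (snd h))) (\<lambda>(e, e'). (e, (cls e, quot e e')))"
    unfolding homeomorphic_maps_def
  proof (intro conjI)
    have "continuous_map ?X E (\<lambda>(p, h). ract p (snd h))"
      using right_action_E unfolding right_action_def T_simps by blast
    then have 1: "limitin E (\<lambda>y. ract (fst y) (snd (snd y))) (ract (fst x) (snd (snd x))) (nhdsin ?X x)" if "x \<in> topspace ?X" for x
      using that unfolding continuous_map_nhdsin case_prod_unfold by blast
    show "continuous_map ?X ?Y (\<lambda>(p, h). (p, ract p (snd h)))"
      unfolding continuous_map_nhdsin case_prod_unfold
    proof
      fix x assume x: "x \<in> topspace ?X"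
      show "limitin ?Y (\<lambda>p. (fst p, ract (fst p) (snd (snd p)))) (fst x, ract (fst x) (snd (snd x))) (nhdsin ?X x)"
        using 1[OF x] limitin_ident[OF x] by (simp add: limitin_fibre_product)
    qed
    show "continuous_map ?Y ?X (\<lambda>(e, e'). (e, (cls e, quot e e')))"
      unfolding continuous_map_nhdsin case_prod_unfold
    proof
      fix x assume x: "x \<in> topspace ?Y"
      from limitin_ident[OF x] have l: "limitin E fst (fst x) (nhdsin ?Y x)" "limitin E snd (snd x) (nhdsin ?Y x)"
        "fst (snd x) = fst (fst x)" "\<forall>\<^sub>F y in nhdsin ?Y x. fst (snd y) = fst (fst y)"
        by (simp_all add: limitin_fibre_product eq_commute)
      have b: "\<phi> (cls (fst y)) = bproj U (quot (fst y) (snd y))" if "y \<in> topspace ?Y" for y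
      proof -
        have y: "fst y \<in> E_points" "snd y \<in> E_points" "fst (snd y) = fst (fst y)"
          using that by (auto simp: topspace_fibre_product)
        then have "base_of (fst y) = bproj U (quot (fst y) (snd y))"
          unfolding base_of_eq_bproj by (rule quot_in)
        then show ?thesis using y(1) by simp
      qed
      have "\<forall>\<^sub>F y in nhdsin ?Y x. \<phi> (cls (fst y)) = bproj U (quot (fst y) (snd y))"
        by (rule eventually_nhdsinI[OF b])
      then show "limitin ?X (\<lambda>p. (fst p, cls (fst p), quot (fst p) (snd p))) (fst x, cls (fst x), quot (fst x) (snd x)) (nhdsin ?Y x)"
        using limitin_quot[OF l] l(1) continuous_map_limitin[OF continuous_map_cls l(1)] b[OF x]
        by (simp add: limitin_fibre_product)
    qed
  qed (auto simp: topspace_fibre_product quot_ract ract_quot base_of_eq_bproj)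
  then show ?thesis using homeomorphic_maps_map by blast
qed

text \<open>Principality for G: the inverse \<delta> assigns to related frames the arrow between
  them, unique by \<open>lact_inj\<close> and continuous by
  \<open>limitin_translation\<close>.\<close>

lemma homeomorphic_left: "homeomorphic_map (fibre_product (Arr G) s E fst) (fibre_product E cls E cls) (\<lambda>(g, p). (lact g p, p))"
proof -
  let ?X = "fibre_product (Arr G) s E fst" and ?Y = "fibre_product E cls E cls"
  define \<delta> where "\<delta> = (\<lambda>e' e. SOME a. a \<in> Ar \<and> s a = fst e \<and> e' = lact a e)"
  have \<delta>: "\<delta> e' e \<in> Ar \<and> s (\<delta> e' e) = fst e \<and> e' = lact (\<delta> e' e) e"
    if "e \<in> E_points" "e' \<in> E_points" "cls e' = cls e" for e e'
  proof -
    have "\<exists>a. a \<in> Ar \<and> s a = fst e \<and> e' = lact a e"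
      using cls_eq_iff[OF that(1,2)] that(3) unfolding related_def by blast
    then show ?thesis unfolding \<delta>_def by (rule someI_ex)
  qed
  have \<delta>_lact: "\<delta> (lact a e) e = a" if "a \<in> Ar" "e \<in> E_points" "s a = fst e" for a e
    using \<delta>[of e "lact a e"] that cls_lact[OF that] lact_inj[of "\<delta> (lact a e) e" a e] by simp
  have "homeomorphic_maps ?X ?Y (\<lambda>(g, p). (lact g p, p)) (\<lambda>(e', e). (\<delta> e' e, e))"
    unfolding homeomorphic_maps_def
  proof (intro conjI)
    have "continuous_map ?X E (\<lambda>(g, p). lact g p)"
      using left_action_E unfolding left_action_def by blast
    then have 1: "limitin E (\<lambda>y. lact (fst y) (snd y)) (lact (fst x) (snd x)) (nhdsin ?X x)" if "x \<in> topspace ?X" for x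
      using that unfolding continuous_map_nhdsin case_prod_unfold by blast
    have b: "cls (lact (fst y) (snd y)) = cls (snd y)" if "y \<in> topspace ?X" for y
      using that by (auto simp: topspace_fibre_product cls_lact)
    show "continuous_map ?X ?Y (\<lambda>(g, p). (lact g p, p))"
      unfolding continuous_map_nhdsin case_prod_unfold
    proof
      fix x assume x: "x \<in> topspace ?X"
      have "\<forall>\<^sub>F y in nhdsin ?X x. cls (lact (fst y) (snd y)) = cls (snd y)"
        by (rule eventually_nhdsinI[OF b])
      then show "limitin ?Y (\<lambda>p. (lact (fst p) (snd p), snd p)) (lact (fst x) (snd x), snd x) (nhdsin ?X x)"
        using 1[OF x] limitin_ident[OF x] b[OF x] by (simp add: limitin_fibre_product)
    qed
    show "continuous_map ?Y ?X (\<lambda>(e', e). (\<delta> e' e, e))"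
      unfolding continuous_map_nhdsin case_prod_unfold
    proof
      fix x assume x: "x \<in> topspace ?Y"
      from limitin_ident[OF x] have l: "limitin E fst (fst x) (nhdsin ?Y x)" "limitin E snd (snd x) (nhdsin ?Y x)"
        by (simp_all add: limitin_fibre_product)
      have d: "\<delta> (fst y) (snd y) \<in> Ar \<and> s (\<delta> (fst y) (snd y)) = fst (snd y) \<and> fst y = lact (\<delta> (fst y) (snd y)) (snd y)"
        if "y \<in> topspace ?Y" for y
        using that by (intro \<delta>) (auto simp: topspace_fibre_product)
      have ev: "\<forall>\<^sub>F y in nhdsin ?Y x. \<delta> (fst y) (snd y) \<in> Ar \<and> s (\<delta> (fst y) (snd y)) = fst (snd y) \<and> fst y = lact (\<delta> (fst y) (snd y)) (snd y)"
        by (rule eventually_nhdsinI[OF d])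
      have "limitin (Arr G) (\<lambda>y. \<delta> (fst y) (snd y)) (\<delta> (fst x) (snd x)) (nhdsin ?Y x)"
        using limitin_translation[OF l(2,1) ev] d[OF x] by blast
      moreover have "\<forall>\<^sub>F y in nhdsin ?Y x. s (\<delta> (fst y) (snd y)) = fst (snd y)"
        using ev by eventually_elim blast
      ultimately show "limitin ?X (\<lambda>p. (\<delta> (fst p) (snd p), snd p)) (\<delta> (fst x) (snd x), snd x) (nhdsin ?Y x)"
        using l(2) d[OF x] by (simp add: limitin_fibre_product)
    qed
    show "\<forall>x\<in>topspace ?X. (case case x of (g, p) \<Rightarrow> (lact g p, p) of (e', e) \<Rightarrow> (\<delta> e' e, e)) = x"
      by (auto simp: topspace_fibre_product \<delta>_lact)
    show "\<forall>y\<in>topspace ?Y. (case case y of (e', e) \<Rightarrow> (\<delta> e' e, e) of (g, p) \<Rightarrow> (lact g p, p)) = y"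
    proof
      fix y assume "y \<in> topspace ?Y"
      then have "snd y \<in> E_points" "fst y \<in> E_points" "cls (fst y) = cls (snd y)" by (auto simp: topspace_fibre_product)
      then show "(case case y of (e', e) \<Rightarrow> (\<delta> e' e, e) of (g, p) \<Rightarrow> (lact g p, p)) = y"
        using \<delta>[of "snd y" "fst y"] by (simp add: case_prod_unfold)
    qed
  qed
  then show ?thesis using homeomorphic_maps_map by blast
qed

lemma morita_bibundle_E: "morita_bibundle G T E fst cls lact ract'"
  unfolding morita_bibundle_def principal_bundle_def T_simps
proof (intro conjI ballI impI)
  show "ract (lact g p) (snd h) = lact g (ract p (snd h))"
    if "g \<in> Ar" "p \<in> topspace E" "h \<in> topspace PU" "s g = fst p" "cls p = fst h" for g p h
    using that base_of_PU[of p h] by (intro ract_lact) (auto simp: in_PU base_of_eq_bproj)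
qed (simp_all add: left_action_E right_action_E open_map_fst_E fst_E_points open_map_cls cls_lact
    homeomorphic_left homeomorphic_right)

text \<open>If u fixes the class of e, it changes e as an isotropy arrow a of \<open>fst e\<close>
  does, and \<open>quot\<close> recovers u from e and its translate. So the finite isotropy group of
  G bounds the isotropy of the action.\<close>

lemma almost_free_P: "almost_free P \<phi> act U"
  unfolding almost_free_def
proof
  fix p assume "p \<in> topspace P"
  then obtain e where e: "e \<in> E_points" "p = cls e" by auto
  have x: "fst e \<in> Ob" using E_pointsD(1)[OF e(1)] .
  have "isotropy T p \<subseteq> (\<lambda>a. (p, quot e (lact a e))) ` {a \<in> Ar. s a = fst e \<and> t a = fst e}"
  proof
    fix h assume "h \<in> isotropy T p"
    then obtain u where u: "h = (p, u)" "u \<in> TU" "\<phi> p = bproj U u" "act p u = p"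
      by (auto simp: isotropy_def T_simps topspace_fibre_product simp del: in_Total)
    then have eu: "base_of e = bproj U u" "dt u \<in> total_points" "fst (dt u) = W (fst e)"
      using e by (simp_all add: base_of_eq_bproj)
    have "cls (ract e u) = cls e" using act_cls[OF e(1) u(2) eu(1)] u(4) e(2) by simp
    then have "related (ract e u) e" using cls_eq_iff[OF e(1) ract_in'[OF e(1) u(2) eu(1)]] by simp
    then obtain a where a: "a \<in> Ar" "s a = fst e" "ract e u = lact a e" unfolding related_def by blast
    have "t a = fst e" using arg_cong[OF a(3), of fst] by simp
    moreover have "u = quot e (lact a e)" using quot_ract[OF e(1) eu(2,3)] a(3) by simp
    ultimately show "h \<in> (\<lambda>a. (p, quot e (lact a e))) ` {a \<in> Ar. s a = fst e \<and> t a = fst e}"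
      using a u(1) by blast
  qed
  then show "finite (isotropy T p)" using finite_isotropy[OF x] finite_surj by blast
qed

lemma morita_equivalent_T: "morita_equivalent G T"
  using morita_equivalentI[OF topological topological_groupoid_T morita_bibundle_E] .

end

section \<open>Orbifold groupoids\<close>

lemma (in proper_etale_groupoid) presentation_by_unitary_bundle:
  "\<exists>(U :: (point, point) group_bundle) (P :: point topology) \<phi> act.
     bundle_of_topological_groups U \<and> proper_groupoid (bundle_groupoid U) \<and> Hausdorff_space P \<and>
     right_action (bundle_groupoid U) P \<phi> act \<and> almost_free P \<phi> act U \<and>
     morita_equivalent G (translation_groupoid P \<phi> act U) \<and>
     (\<forall>q \<in> topspace (Base U). finite_product_of_unitary_groups (fibre_top U q) (fibre_group U q))"
proof -
  obtain V n w where V: "(\<forall>i::nat. openin (Obj G) (V i) \<and> n i \<ge> 1 \<and> continuous_map (Obj G) euclideanreal (w i) \<and>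
     (\<forall>y\<in>Ob. 0 \<le> w i y \<and> w i y \<le> 1) \<and> (\<forall>g\<in>Ar. w i (s g) = w i (t g)) \<and>
     (\<forall>y\<in>Ob. w i y > 0 \<longrightarrow> evenly_hit (V i) (n i) y)) \<and>
     (\<forall>x\<in>Ob. (\<exists>i. w i x > 0) \<and> finite {i. w i x \<noteq> 0})"
    using point_finite_evenly_hit_cover by blast
  interpret frame_space G n V w
    by unfold_locales (use V in auto)
  show ?thesis
    using bundle_U proper_groupoid_U Hausdorff_P right_action_P almost_free_P morita_equivalent_T fibre_unitary
    by blast
qed

lemma locally_compact_smooth_atlas:
  assumes "smooth_atlas X A" shows "locally_compact_space X"
  unfolding locally_compact_space_def
proof
  fix x assume "x \<in> topspace X"
  then obtain n W c where c: "(n, W, c) \<in> A" "x \<in> W"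
    using assms unfolding smooth_atlas_def by blast
  then have ch: "openin X W" "openin (Euclidean_space n) (c ` W)"
    and h: "homeomorphic_map (subtopology X W) (subtopology (Euclidean_space n) (c ` W)) c"
    using assms unfolding smooth_atlas_def chart_of_def by fastforce+
  have "locally_compact_space (subtopology (Euclidean_space n) (c ` W))"
    using locally_compact_Euclidean_space Hausdorff_Euclidean_space ch(2)
    by (intro locally_compact_space_open_subset) auto
  then have "locally_compact_space (subtopology X W)"
    using homeomorphic_locally_compact_space homeomorphic_map_imp_homeomorphic_space[OF h] by blast
  moreover have "x \<in> topspace (subtopology X W)" using c(2) \<open>x \<in> topspace X\<close> by simp
  ultimately obtain O' K where "openin (subtopology X W) O'" "compactin (subtopology X W) K" "x \<in> O'" "O' \<subseteq> K"
    unfolding locally_compact_space_def by blast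
  then show "\<exists>O' K. openin X O' \<and> compactin X K \<and> x \<in> O' \<and> O' \<subseteq> K"
    using ch(1) openin_trans_full[of X W O'] compactin_subtopology[of X W K] by metis
qed

lemma homeomorphic_map_diffeomorphism:
  assumes "diffeomorphism X A Y B f" shows "homeomorphic_map X Y f"
proof -
  obtain g where "continuous_map X Y f" "continuous_map Y X g" "\<forall>x\<in>topspace X. g (f x) = x" "\<forall>y\<in>topspace Y. f (g y) = y"
    using assms unfolding diffeomorphism_def smooth_map_def by blast
  then have "homeomorphic_maps X Y f g" by (simp add: homeomorphic_maps_def)
  then show ?thesis using homeomorphic_maps_map by blast
qed

lemma orbifold_proper_etale_groupoid:
  assumes "orbifold_groupoid G" shows "proper_etale_groupoid G"
proof
  have G: "etale_groupoid G" and L: "Lie_groupoid G"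
    using assms by (auto simp: orbifold_groupoid_def etale_groupoid_def)
  show "proper_groupoid G" using assms by (simp add: orbifold_groupoid_def)
  show "second_countable (Obj G)" using L by (simp add: Lie_groupoid_def)
  show "locally_compact_space (Obj G)" using L locally_compact_smooth_atlas unfolding Lie_groupoid_def by blast
  fix g assume "g \<in> topspace (Arr G)"
  then show "\<exists>B. openin (Arr G) B \<and> g \<in> B \<and> openin (Obj G) (src G ` B) \<and>
      homeomorphic_map (subtopology (Arr G) B) (subtopology (Obj G) (src G ` B)) (src G)"
    using G homeomorphic_map_diffeomorphism unfolding etale_groupoid_def local_diffeomorphism_def by meson
qed

theorem theorem5p2:
  fixes G :: "('a, 'o) lie_groupoid"
  assumes "orbifold_groupoid G"
  shows "\<exists>(U :: (point, point) group_bundle) (P :: point topology) \<phi> act.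
           bundle_of_topological_groups U \<and>
           proper_groupoid (bundle_groupoid U) \<and>
           Hausdorff_space P \<and>
           right_action (bundle_groupoid U) P \<phi> act \<and>
           almost_free P \<phi> act U \<and>
           morita_equivalent G (translation_groupoid P \<phi> act U) \<and>
           (\<forall>q \<in> topspace (Base U).
              finite_product_of_unitary_groups (fibre_top U q) (fibre_group U q))"
  using proper_etale_groupoid.presentation_by_unitary_bundle[OF orbifold_proper_etale_groupoid[OF assms]] .

end
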